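(* Let $E$ be a Banach space over $\mathbb{K}$ and let $X$ be a compact metric space with metric $d$. Suppose that $\operatorname{lip}(X)$ separates points uniformly and that either $E^{*}$ or $\operatorname{lip}(X)^{*}$ has the approximation property. Then $\operatorname{lip}(X,E)^{**}$ is isometrically isomorphic to $\operatorname{Lip}(X,E^{**})$.
   Context: $\mathbb{K}$ is $\mathbb{R}$ or $\mathbb{C}$. For a compact metric space $(X,d)$ and a Banach space $E$ over $\mathbb{K}$, $\operatorname{Lip}(X,E)$ is the space of continuous $f\colon X\to E$ with $\mathcal{L}_{X,E}(f):=\sup_{x\ne x'}\|f(x)-f(x')\|_E/d(x,x')<\infty$, with the norm $\|f\|_{\max}:=\max\{\sup_{x\in X}\|f(x)\|_E,\ \mathcal{L}_{X,E}(f)\}$; it is a Banach space. $\operatorname{lip}(X,E)$ is the closed subspace of little Lipschitz functions, i.e. those $f\in\operatorname{Lip}(X,E)$ with $\|f(x)-f(x')\|_E/d(x,x')\to 0$ as $d(x,x')\to 0$ ($x\neq x'$), with the same norm. Write $\operatorname{Lip}(X)=\operatorname{Lip}(X,\mathbb{K})$ and $\operatorname{lip}(X)=\operatorname{lip}(X,\mathbb{K})$. $\operatorname{lip}(X)$ separates points uniformly if there is a constant $c>1$ such that for all $x\neq x'$ in $X$ some $f\in\operatorname{lip}(X)$ satisfies $\mathcal{L}_{X,\mathbb{K}}(f)\le c$ and $|f(x)-f(x')|=d(x,x')$. $B^{*}$ and $B^{**}$ denote the (norm) dual and second dual of a Banach space $B$. Isometrically isomorphic means that there is a surjective linear isometry.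 *)

theory Defs
  imports "HOL-Analysis.Analysis" "HOL-Library.Function_Algebras"
begin

text \<open>
  The scalar field is \<open>\<real>\<close> or \<open>\<complex>\<close>, up to an isometric isomorphism of normed fields.
\<close>

class real_or_complex = real_normed_field +
  assumes real_or_complex:
    "(\<exists>\<phi> :: 'a \<Rightarrow> real. bij \<phi> \<and> (\<forall>x y. \<phi> (x + y) = \<phi> x + \<phi> y) \<and>
        (\<forall>x y. \<phi> (x * y) = \<phi> x * \<phi> y) \<and> (\<forall>x. norm (\<phi> x) = norm x)) \<or>
     (\<exists>\<phi> :: 'a \<Rightarrow> complex. bij \<phi> \<and> (\<forall>x y. \<phi> (x + y) = \<phi> x + \<phi> y) \<and>
        (\<forall>x y. \<phi> (x * y) = \<phi> x * \<phi> y) \<and> (\<forall>x. norm (\<phi> x) = norm x))"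

instance real :: real_or_complex
  by standard (rule disjI1, rule exI[of _ id], simp)

instance complex :: real_or_complex
  by standard (rule disjI2, rule exI[of _ id], simp)

text \<open>
  Duals and spaces of Lipschitz functions depend on terms and on the scalar field, so normed
  spaces are carried by linear subspaces of an ambient vector space. The norm is meaningful only
  on \<open>carr\<close>. For function spaces the ambient space consists of all functions with the pointwise
  operations, and elements of a function space vanish outside the domain, so that equality
  in HOL is equality of functions on the domain.
\<close>

record ('k, 'v) nspace =
  carr :: "'v set"
  scl :: "'k \<Rightarrow> 'v \<Rightarrow> 'v"
  nrm :: "'v \<Rightarrow> real"

definition normed_space :: "('k::real_or_complex, 'v::ab_group_add) nspace \<Rightarrow> bool" where
  "normed_space V \<longleftrightarrow> vector_space (scl V) \<and> module.subspace (scl V) (carr V) \<and>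
     (\<forall>x\<in>carr V. 0 \<le> nrm V x \<and> (nrm V x = 0 \<longleftrightarrow> x = 0)) \<and>
     (\<forall>x\<in>carr V. \<forall>y\<in>carr V. nrm V (x + y) \<le> nrm V x + nrm V y) \<and>
     (\<forall>c. \<forall>x\<in>carr V. nrm V (scl V c x) = norm c * nrm V x)"

text \<open>
  The locale \<open>Metric_space\<close> requires nonnegativity and symmetry on the whole type, whereas
  \<open>nrm\<close> is arbitrary outside \<open>carr\<close>.
\<close>

definition ndist :: "('k, 'v::ab_group_add) nspace \<Rightarrow> 'v \<Rightarrow> 'v \<Rightarrow> real" where
  "ndist V x y = (if x \<in> carr V \<and> y \<in> carr V then nrm V (x - y) else 0)"

lemma normed_space_Metric_space:
  assumes "normed_space V"
  shows "Metric_space (carr V) (ndist V)"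
proof -
  interpret vector_space "scl V"
    using assms by (simp add: normed_space_def)
  have sub: "subspace (carr V)"
    using assms by (simp add: normed_space_def)
  have V: "0 \<le> nrm V x" "nrm V x = 0 \<longleftrightarrow> x = 0" "nrm V (scl V c x) = norm c * nrm V x"
    if "x \<in> carr V" for x c
    using assms that unfolding normed_space_def by simp_all
  have triangle: "nrm V (x + y) \<le> nrm V x + nrm V y" if "x \<in> carr V" "y \<in> carr V" for x y
    using assms that by (simp add: normed_space_def)
  have diff: "x - y \<in> carr V" if "x \<in> carr V" "y \<in> carr V" for x y
    using subspace_diff[OF sub that] .
  have comm: "nrm V (x - y) = nrm V (y - x)" if "x \<in> carr V" "y \<in> carr V" for x y
    using V(3)[OF diff[OF that(2,1)], of "- 1"] by simp
  have tri: "nrm V (x - z) \<le> nrm V (x - y) + nrm V (y - z)"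
    if "x \<in> carr V" "y \<in> carr V" "z \<in> carr V" for x y z
    using triangle[OF diff[OF that(1,2)] diff[OF that(2,3)]] by simp
  show ?thesis
  proof
    show "0 \<le> ndist V x y" for x y
      using V(1) diff by (simp add: ndist_def)
    show "ndist V x y = ndist V y x" for x y
      by (simp add: ndist_def comm[of x y])
    show "ndist V x y = 0 \<longleftrightarrow> x = y" if "x \<in> carr V" "y \<in> carr V" for x y
      using V(2) diff that by (simp add: ndist_def)
    show "ndist V x z \<le> ndist V x y + ndist V y z"
      if "x \<in> carr V" "y \<in> carr V" "z \<in> carr V" for x y z
      using tri that by (simp add: ndist_def)
  qed
qed

definition ntopology :: "('k, 'v::ab_group_add) nspace \<Rightarrow> 'v topology" where
  "ntopology V = Metric_space.mtopology (carr V) (ndist V)"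

definition banach_space :: "('k::real_or_complex, 'v::ab_group_add) nspace \<Rightarrow> bool" where
  "banach_space V \<longleftrightarrow> normed_space V \<and> Metric_space.mcomplete (carr V) (ndist V)"

definition scalars :: "('k::real_or_complex, 'k) nspace" where
  "scalars = \<lparr>carr = UNIV, scl = (*), nrm = norm\<rparr>"

definition linear_map ::
  "('k, 'v::ab_group_add) nspace \<Rightarrow> ('k, 'w::ab_group_add) nspace \<Rightarrow> ('v \<Rightarrow> 'w) \<Rightarrow> bool" where
  "linear_map V W T \<longleftrightarrow> T ` carr V \<subseteq> carr W \<and>
     (\<forall>x\<in>carr V. \<forall>y\<in>carr V. T (x + y) = T x + T y) \<and>
     (\<forall>c. \<forall>x\<in>carr V. T (scl V c x) = scl W c (T x))"

definition bounded_operators ::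
  "('k, 'v::ab_group_add) nspace \<Rightarrow> ('k, 'w::ab_group_add) nspace \<Rightarrow> ('k, 'v \<Rightarrow> 'w) nspace" where
  "bounded_operators V W =
     \<lparr>carr = {T. linear_map V W T \<and> (\<exists>C. \<forall>x\<in>carr V. nrm W (T x) \<le> C * nrm V x) \<and>
                 (\<forall>x. x \<notin> carr V \<longrightarrow> T x = 0)},
      scl = (\<lambda>c T x. scl W c (T x)),
      nrm = (\<lambda>T. SUP x\<in>{x \<in> carr V. nrm V x \<le> 1}. nrm W (T x))\<rparr>"

definition dual ::
  "('k::real_or_complex, 'v::ab_group_add) nspace \<Rightarrow> ('k, 'v \<Rightarrow> 'k) nspace" where
  "dual V = bounded_operators V scalars"

definition isometrically_isomorphic ::
  "('k, 'v::ab_group_add) nspace \<Rightarrow> ('k, 'w::ab_group_add) nspace \<Rightarrow> bool" where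
  "isometrically_isomorphic V W \<longleftrightarrow>
     (\<exists>T. linear_map V W T \<and> (\<forall>x\<in>carr V. nrm W (T x) = nrm V x) \<and> T ` carr V = carr W)"

definition finite_rank ::
  "('k::real_or_complex, 'v::ab_group_add) nspace \<Rightarrow> ('k, 'w::ab_group_add) nspace \<Rightarrow>
    ('v \<Rightarrow> 'w) \<Rightarrow> bool" where
  "finite_rank V W T \<longleftrightarrow>
     (\<exists>S. finite S \<and> S \<subseteq> carr W \<and> T ` carr V \<subseteq> module.span (scl W) S)"

definition approximation_property ::
  "('k::real_or_complex, 'v::ab_group_add) nspace \<Rightarrow> bool" where
  "approximation_property V \<longleftrightarrow>
     (\<forall>C \<epsilon>. compactin (ntopology V) C \<and> \<epsilon> > 0 \<longrightarrow>
        (\<exists>T\<in>carr (bounded_operators V V). finite_rank V V T \<and> (\<forall>x\<in>C. nrm V (T x - x) < \<epsilon>)))"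

definition lip_quotients ::
  "'x::metric_space set \<Rightarrow> ('k, 'e::ab_group_add) nspace \<Rightarrow> ('x \<Rightarrow> 'e) \<Rightarrow> real set" where
  "lip_quotients X E f =
     {nrm E (f x - f x') / dist x x' | x x'. x \<in> X \<and> x' \<in> X \<and> x \<noteq> x'}"

text \<open>
  Inserting 0 realises the convention that a supremum of nonnegative quantities over the
  empty set is 0 (\<open>Sup {}\<close> is unspecified on the reals).
\<close>

definition lip_const ::
  "'x::metric_space set \<Rightarrow> ('k, 'e::ab_group_add) nspace \<Rightarrow> ('x \<Rightarrow> 'e) \<Rightarrow> real" where
  "lip_const X E f = Sup (insert 0 (lip_quotients X E f))"

definition sup_norm ::
  "'x set \<Rightarrow> ('k, 'e) nspace \<Rightarrow> ('x \<Rightarrow> 'e) \<Rightarrow> real" where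
  "sup_norm X E f = Sup (insert 0 ((\<lambda>x. nrm E (f x)) ` X))"

definition Lip ::
  "'x::metric_space set \<Rightarrow> ('k, 'e::ab_group_add) nspace \<Rightarrow> ('k, 'x \<Rightarrow> 'e) nspace" where
  "Lip X E =
     \<lparr>carr = {f. continuous_map (top_of_set X) (ntopology E) f \<and> bdd_above (lip_quotients X E f) \<and>
                 (\<forall>x. x \<notin> X \<longrightarrow> f x = 0)},
      scl = (\<lambda>c f x. scl E c (f x)),
      nrm = (\<lambda>f. max (sup_norm X E f) (lip_const X E f))\<rparr>"

definition little_lip ::
  "'x::metric_space set \<Rightarrow> ('k, 'e::ab_group_add) nspace \<Rightarrow> ('k, 'x \<Rightarrow> 'e) nspace" where
  "little_lip X E = (Lip X E)
     \<lparr>carr := {f \<in> carr (Lip X E). \<forall>\<epsilon>>0. \<exists>\<delta>>0. \<forall>x\<in>X. \<forall>x'\<in>X.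
                 x \<noteq> x' \<and> dist x x' < \<delta> \<longrightarrow> nrm E (f x - f x') / dist x x' < \<epsilon>}\<rparr>"

definition lip_separates_points_uniformly ::
  "'k::real_or_complex itself \<Rightarrow> 'x::metric_space set \<Rightarrow> bool" where
  "lip_separates_points_uniformly _ X \<longleftrightarrow>
     (\<exists>c>1. \<forall>x\<in>X. \<forall>x'\<in>X. x \<noteq> x' \<longrightarrow>
        (\<exists>f\<in>carr (little_lip X (scalars :: ('k, 'k) nspace)).
           lip_const X (scalars :: ('k, 'k) nspace) f \<le> c \<and> norm (f x - f x') = dist x x'))"

end

theory Submission
  imports Defs
begin

text \<open>
  Identify a pair \<open>(x, x')\<close> with the evaluation at \<open>x\<close> if \<open>x = x'\<close> and with the difference quotient
  otherwise. This embeds \<open>lip(X,E)\<close> isometrically into the bounded \<open>E\<close>-valued functions on \<open>X \<times> X\<close>.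
  A functional on \<open>lip(X,E)\<close> extends to these by Hahn--Banach; as little Lipschitz functions have
  small quotients near the diagonal, the extension may be restricted to quotients over distances at
  least \<open>\<delta>\<close>, and there, by compactness, it is approximated in norm by finite sums \<open>\<Sum> b\<^sub>j \<circ> w\<^sub>j\<close> with
  \<open>w\<^sub>j \<in> X \<times> X\<close>, \<open>b\<^sub>j \<in> E\<^sup>*\<close> and \<open>\<Sum> \<parallel>b\<^sub>j\<parallel>\<close> at most the norm of the functional. Hence every functional is
  a norm convergent series of such sums, and the restriction map \<open>\<Phi> \<mapsto> (x \<mapsto> (b \<mapsto> \<Phi>(b \<circ> \<delta>\<^sub>x)))\<close> from
  \<open>lip(X,E)\<^sup>*\<^sup>*\<close> to \<open>Lip(X,E\<^sup>*\<^sup>*)\<close> is isometric. A function \<open>F\<close> lies in its range as soon as \<open>F\<close> annihilates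
  all series that represent the functional \<open>0\<close>. For \<open>E = K\<close> this holds because the uniform
  separation of points allows to interpolate on finite sets by little Lipschitz functions of
  controlled norm. Thus \<open>F\<close> induces in general a bounded bilinear form on \<open>lip(X)\<^sup>* \<times> E\<^sup>*\<close>, and the
  approximation property of one factor makes it annihilate the null series by trace duality.
\<close>

text \<open>The extension to bounded functions is in general only finitely additive, and the
  distance from the diagonal below which a little Lipschitz function has small quotients depends on
  the function. The mass of the extension near the diagonal is therefore made small uniformly, by
  superadditivity of its variation. Approximating the remainders in turn then yields series with
  terms of size \<open>C / 4 ^ k\<close>; the ratio leaves room for a factor \<open>2 ^ k\<close>,
  lost when the terms are rescaled to a null sequence for the approximation property.

  Such a series is not determined by its functional, and this is the whole obstruction to
  surjectivity. In the scalar case a null series is tested, for each \<open>n\<close>, on a little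
  Lipschitz function that interpolates the given function at the points of the first
  \<open>n\<close> terms. The test function varies with \<open>n\<close>, but its norm stays
  bounded, and the partial sum is minus a tail of order \<open>1 / 4 ^ n\<close>.\<close>

section \<open>Scalars and normed spaces\<close>

text \<open>One formula serves both fields: \<open>\<iota>\<close> is the imaginary unit or, over
  the reals, 0. The class provides a ring isomorphism that is isometric but not assumed to be
  real-linear, so its values on the reals must be found first.\<close>

lemma real_part_exists:
  obtains \<rho> :: "'k::real_or_complex \<Rightarrow> real" and \<iota> :: 'k
  where "\<And>x y. \<rho> (x + y) = \<rho> x + \<rho> y" "\<And>r x. \<rho> (of_real r * x) = r * \<rho> x"
    "\<And>x. \<bar>\<rho> x\<bar> \<le> norm x" "\<rho> 1 = 1" "\<rho> \<iota> = 0" "norm \<iota> \<le> 1" "\<iota> * \<iota> = - 1 \<or> \<iota> = 0"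
    "\<And>x. x = of_real (\<rho> x) - \<iota> * of_real (\<rho> (\<iota> * x))"
proof -
  from real_or_complex show ?thesis
  proof
    assume "\<exists>\<phi> :: 'k \<Rightarrow> real. bij \<phi> \<and> (\<forall>x y. \<phi> (x + y) = \<phi> x + \<phi> y) \<and>
        (\<forall>x y. \<phi> (x * y) = \<phi> x * \<phi> y) \<and> (\<forall>x. norm (\<phi> x) = norm x)"
    then obtain \<phi> :: "'k \<Rightarrow> real" where \<phi>: "bij \<phi>" "\<And>x y. \<phi> (x + y) = \<phi> x + \<phi> y"
      "\<And>x y. \<phi> (x * y) = \<phi> x * \<phi> y" "\<And>x. norm (\<phi> x) = norm x"
      by blast
    have one: "\<phi> 1 = 1"
      by (metis \<phi>(3,4) mult_cancel_right2 mult_1 norm_eq_zero zero_neq_one)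
    have diff: "\<phi> (x - y) = \<phi> x - \<phi> y" for x y
      using \<phi>(2)[of "x - y" y] by simp
    \<comment> \<open>Only \<open>r\<close> has distance \<open>\<bar>r\<bar>\<close> from 0 and
      distance \<open>\<bar>r - 1\<bar>\<close> from 1.\<close>
    have of_real: "\<phi> (of_real r) = r" for r
    proof -
      have "\<bar>\<phi> (of_real r)\<bar> = \<bar>r\<bar>"
        using \<phi>(4)[of "of_real r"] by simp
      moreover have "\<bar>\<phi> (of_real r) - 1\<bar> = \<bar>r - 1\<bar>"
        using \<phi>(4)[of "of_real (r - 1)"] unfolding of_real_diff diff of_real_1 one
        by (metis norm_of_real of_real_1 of_real_diff real_norm_def)
      ultimately show ?thesis by linarith
    qed
    have "x = of_real (\<phi> x)" for x
      using bij_is_inj[OF \<phi>(1)] of_real[of "\<phi> x"] by (auto dest: injD)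
    then show ?thesis
      using \<phi> one of_real of_real[of 0] by (intro that[of \<phi> 0]) auto
  next
    assume "\<exists>\<phi> :: 'k \<Rightarrow> complex. bij \<phi> \<and> (\<forall>x y. \<phi> (x + y) = \<phi> x + \<phi> y) \<and>
        (\<forall>x y. \<phi> (x * y) = \<phi> x * \<phi> y) \<and> (\<forall>x. norm (\<phi> x) = norm x)"
    then obtain \<phi> :: "'k \<Rightarrow> complex" where \<phi>: "bij \<phi>" "\<And>x y. \<phi> (x + y) = \<phi> x + \<phi> y"
      "\<And>x y. \<phi> (x * y) = \<phi> x * \<phi> y" "\<And>x. norm (\<phi> x) = norm x"
      by blast
    have one: "\<phi> 1 = 1"
      by (metis \<phi>(3,4) mult_cancel_right2 mult_1 norm_eq_zero zero_neq_one)
    have diff: "\<phi> (x - y) = \<phi> x - \<phi> y" for x y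
      using \<phi>(2)[of "x - y" y] by simp
    \<comment> \<open>The circles around 0 and 1 through the real number \<open>r\<close> meet only
      at \<open>r\<close>.\<close>
    have of_real: "\<phi> (of_real r) = of_real r" for r
    proof -
      have 1: "(Re (\<phi> (of_real r)))\<^sup>2 + (Im (\<phi> (of_real r)))\<^sup>2 = r\<^sup>2"
        using \<phi>(4)[of "of_real r"] by (simp flip: cmod_power2)
      have "norm (\<phi> (of_real r) - 1) = \<bar>r - 1\<bar>"
        using \<phi>(4)[of "of_real (r - 1)"] unfolding of_real_diff diff of_real_1 one
        by (metis norm_of_real of_real_1 of_real_diff)
      then have 2: "(Re (\<phi> (of_real r)) - 1)\<^sup>2 + (Im (\<phi> (of_real r)))\<^sup>2 = (r - 1)\<^sup>2"
        using cmod_power2[of "\<phi> (of_real r) - 1"] by simp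
      have "Re (\<phi> (of_real r)) = r"
        using 1 2 by (simp add: power2_diff)
      with 1 show ?thesis
        by (simp add: complex_eq_iff)
    qed
    obtain \<iota> where \<iota>: "\<phi> \<iota> = \<i>"
      using \<phi>(1) by (metis bij_pointE)
    have inj: "x = y" if "\<phi> x = \<phi> y" for x y
      using \<phi>(1) that by (metis bij_pointE)
    have "\<phi> (\<iota> * \<iota>) = \<phi> (0 - 1)"
      unfolding diff \<phi>(3) \<iota> one using of_real[of 0] by simp
    then have sq: "\<iota> * \<iota> = - 1"
      using inj by fastforce
    have "\<phi> (of_real (Re (\<phi> x)) - \<iota> * of_real (Re (\<phi> (\<iota> * x)))) = \<phi> x" for x
      unfolding diff \<phi>(3) \<iota> of_real by (simp add: complex_eq_iff)
    then have rep: "x = of_real (Re (\<phi> x)) - \<iota> * of_real (Re (\<phi> (\<iota> * x)))" for x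
      using inj by metis
    show ?thesis
    proof (rule that[of "\<lambda>x. Re (\<phi> x)" \<iota>])
      show "\<bar>Re (\<phi> x)\<bar> \<le> norm x" for x
        using abs_Re_le_cmod[of "\<phi> x"] \<phi>(4) by simp
      show "norm \<iota> \<le> 1"
        using \<phi>(4)[of \<iota>] \<iota> by simp
      show "x = of_real (Re (\<phi> x)) - \<iota> * of_real (Re (\<phi> (\<iota> * x)))" for x
        by (rule rep)
    qed (use \<phi>(2,3) of_real one \<iota> sq in auto)
  qed
qed

section \<open>Normed spaces on a carrier set\<close>

locale normed_nspace =
  fixes V :: "('k::real_or_complex, 'v::ab_group_add) nspace"
  assumes normed_space: "normed_space V"
begin

sublocale vector_space "scl V"
  using normed_space by (simp add: normed_space_def)

lemma subspace_carr: "subspace (carr V)"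
  using normed_space by (simp add: normed_space_def)

lemma zero_in [simp]: "0 \<in> carr V"
  and add_in [intro, simp]: "x \<in> carr V \<Longrightarrow> y \<in> carr V \<Longrightarrow> x + y \<in> carr V"
  and diff_in [intro, simp]: "x \<in> carr V \<Longrightarrow> y \<in> carr V \<Longrightarrow> x - y \<in> carr V"
  and minus_in [intro, simp]: "x \<in> carr V \<Longrightarrow> - x \<in> carr V"
  and scl_in [intro, simp]: "x \<in> carr V \<Longrightarrow> scl V c x \<in> carr V"
  by (simp_all add: subspace_0[OF subspace_carr] subspace_add[OF subspace_carr]
      subspace_diff[OF subspace_carr] subspace_neg[OF subspace_carr] subspace_scale[OF subspace_carr])

lemma nrm_nonneg [simp]: "x \<in> carr V \<Longrightarrow> 0 \<le> nrm V x"
  and nrm_eq_0 [simp]: "x \<in> carr V \<Longrightarrow> nrm V x = 0 \<longleftrightarrow> x = 0"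
  and nrm_scl [simp]: "x \<in> carr V \<Longrightarrow> nrm V (scl V c x) = norm c * nrm V x"
  and nrm_add: "x \<in> carr V \<Longrightarrow> y \<in> carr V \<Longrightarrow> nrm V (x + y) \<le> nrm V x + nrm V y"
  using normed_space by (simp_all add: normed_space_def)

lemma nrm_0 [simp]: "nrm V 0 = 0"
  by simp

lemma nrm_minus [simp]: "x \<in> carr V \<Longrightarrow> nrm V (- x) = nrm V x"
  using nrm_scl[of x "- 1"] by simp

lemma nrm_diff: "x \<in> carr V \<Longrightarrow> y \<in> carr V \<Longrightarrow> nrm V (x - y) \<le> nrm V x + nrm V y"
  using nrm_add[of x "- y"] by simp

lemma nrm_diff_commute: "x \<in> carr V \<Longrightarrow> y \<in> carr V \<Longrightarrow> nrm V (x - y) = nrm V (y - x)"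
  using nrm_minus[of "x - y"] by simp

end

lemma normed_nspace_scalars: "normed_nspace (scalars :: ('k::real_or_complex, 'k) nspace)"
proof -
  have vs: "vector_space ((*) :: 'k \<Rightarrow> 'k \<Rightarrow> 'k)"
    by unfold_locales (simp_all add: algebra_simps)
  show ?thesis
    by unfold_locales
      (use vs vector_space_over_itself.subspace_UNIV in
        \<open>simp add: scalars_def normed_space_def norm_mult norm_triangle_ineq\<close>)
qed

lemma scalars_simps [simp]:
  "carr scalars = UNIV" "scl scalars c x = c * x" "nrm scalars x = norm x"
  by (simp_all add: scalars_def)

section \<open>Dual spaces\<close>

lemma dual_iff: "\<phi> \<in> carr (dual V) \<longleftrightarrow>
    (\<forall>x\<in>carr V. \<forall>y\<in>carr V. \<phi> (x + y) = \<phi> x + \<phi> y) \<and>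
    (\<forall>c. \<forall>x\<in>carr V. \<phi> (scl V c x) = c * \<phi> x) \<and>
    (\<exists>C. \<forall>x\<in>carr V. norm (\<phi> x) \<le> C * nrm V x) \<and> (\<forall>x. x \<notin> carr V \<longrightarrow> \<phi> x = 0)"
  by (simp add: dual_def bounded_operators_def linear_map_def)

lemma scl_dual [simp]: "scl (dual V) c \<phi> = (\<lambda>x. c * \<phi> x)"
  by (simp add: dual_def bounded_operators_def)

lemma dual_add: "\<phi> \<in> carr (dual V) \<Longrightarrow> x \<in> carr V \<Longrightarrow> y \<in> carr V \<Longrightarrow> \<phi> (x + y) = \<phi> x + \<phi> y"
  and dual_scl: "\<phi> \<in> carr (dual V) \<Longrightarrow> x \<in> carr V \<Longrightarrow> \<phi> (scl V c x) = c * \<phi> x"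
  and dual_outside: "\<phi> \<in> carr (dual V) \<Longrightarrow> x \<notin> carr V \<Longrightarrow> \<phi> x = 0"
  by (auto simp: dual_iff)

context normed_nspace
begin

lemma dual_minus: "\<phi> \<in> carr (dual V) \<Longrightarrow> x \<in> carr V \<Longrightarrow> \<phi> (- x) = - \<phi> x"
  using dual_scl[of \<phi> V x "- 1"] by simp

lemma dual_diff:
  "\<phi> \<in> carr (dual V) \<Longrightarrow> x \<in> carr V \<Longrightarrow> y \<in> carr V \<Longrightarrow> \<phi> (x - y) = \<phi> x - \<phi> y"
  using dual_add[of \<phi> V x "- y"] by (simp add: dual_minus)

lemma dual_0: "\<phi> \<in> carr (dual V) \<Longrightarrow> \<phi> 0 = 0"
  using dual_scl[of \<phi> V 0 0] by simp

lemma dual_bdd: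
  assumes "\<phi> \<in> carr (dual V)"
  shows "bdd_above ((\<lambda>x. norm (\<phi> x)) ` {x \<in> carr V. nrm V x \<le> 1})"
proof -
  obtain C where C: "\<And>x. x \<in> carr V \<Longrightarrow> norm (\<phi> x) \<le> C * nrm V x"
    using assms unfolding dual_iff by blast
  have "norm (\<phi> x) \<le> \<bar>C\<bar>" if "x \<in> carr V" "nrm V x \<le> 1" for x
  proof -
    have "norm (\<phi> x) \<le> C * nrm V x" using C that by simp
    also have "\<dots> \<le> \<bar>C\<bar> * 1" using that by (intro mult_mono) auto
    finally show ?thesis by simp
  qed
  then show ?thesis by (auto intro!: bdd_aboveI)
qed

lemma nrm_dual: "nrm (dual V) \<phi> = (SUP x\<in>{x \<in> carr V. nrm V x \<le> 1}. norm (\<phi> x))"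
  by (simp add: dual_def bounded_operators_def)

lemma nrm_dual_nonneg: "\<phi> \<in> carr (dual V) \<Longrightarrow> 0 \<le> nrm (dual V) \<phi>"
  unfolding nrm_dual by (rule cSUP_upper2[OF dual_bdd, of _ 0]) auto

lemma dual_bound:
  assumes "\<phi> \<in> carr (dual V)" "x \<in> carr V"
  shows "norm (\<phi> x) \<le> nrm (dual V) \<phi> * nrm V x"
proof (cases "x = 0")
  case True
  then show ?thesis using assms by (simp add: dual_0)
next
  case False
  then have pos: "nrm V x > 0"
    using assms nrm_nonneg[of x] nrm_eq_0[of x] by linarith
  let ?y = "scl V (of_real (inverse (nrm V x))) x"
  have "inverse (nrm V x) * nrm V x = 1"
    using pos by simp
  then have "norm (\<phi> ?y) \<le> nrm (dual V) \<phi>"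
    unfolding nrm_dual using assms pos
    by (intro cSUP_upper[OF _ dual_bdd]) (auto simp: norm_inverse)
  then show ?thesis
    using assms pos by (simp add: dual_scl norm_mult norm_divide field_simps norm_inverse)
qed

lemma nrm_dual_le:
  assumes "\<And>x. x \<in> carr V \<Longrightarrow> norm (\<phi> x) \<le> C * nrm V x" "0 \<le> C"
  shows "nrm (dual V) \<phi> \<le> C"
  unfolding nrm_dual
proof (rule cSUP_least)
  show "norm (\<phi> x) \<le> C" if "x \<in> {x \<in> carr V. nrm V x \<le> 1}" for x
    using assms(1)[of x] that mult_left_mono[of "nrm V x" 1 C] assms(2) by auto
  have "0 \<in> {x \<in> carr V. nrm V x \<le> 1}" by simp
  then show "{x \<in> carr V. nrm V x \<le> 1} \<noteq> {}" by blast
qed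

lemma dualI:
  assumes "\<And>x y. x \<in> carr V \<Longrightarrow> y \<in> carr V \<Longrightarrow> \<phi> (x + y) = \<phi> x + \<phi> y"
    "\<And>c x. x \<in> carr V \<Longrightarrow> \<phi> (scl V c x) = c * \<phi> x"
    "\<And>x. x \<in> carr V \<Longrightarrow> norm (\<phi> x) \<le> C * nrm V x"
    "\<And>x. x \<notin> carr V \<Longrightarrow> \<phi> x = 0"
  shows "\<phi> \<in> carr (dual V)"
  unfolding dual_iff using assms by (intro conjI exI[of _ C]) auto

lemma normed_nspace_dual: "normed_nspace (dual V)"
proof
  let ?D = "dual V"
  have vs: "vector_space (\<lambda>c \<phi> x. c * \<phi> x :: 'k)" for d :: 'v
    by unfold_locales (auto simp: algebra_simps)
  have eq: "scl ?D = (\<lambda>c \<phi> x. c * \<phi> x)"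
    by (intro ext) simp
  interpret D: vector_space "scl ?D"
    unfolding eq by (rule vs)
  have add: "\<phi> + \<psi> \<in> carr ?D" "nrm ?D (\<phi> + \<psi>) \<le> nrm ?D \<phi> + nrm ?D \<psi>"
    if "\<phi> \<in> carr ?D" "\<psi> \<in> carr ?D" for \<phi> \<psi>
  proof -
    have le: "norm ((\<phi> + \<psi>) x) \<le> (nrm ?D \<phi> + nrm ?D \<psi>) * nrm V x" if "x \<in> carr V" for x
      using norm_triangle_ineq[of "\<phi> x" "\<psi> x"] dual_bound[of \<phi> x] dual_bound[of \<psi> x]
        \<open>\<phi> \<in> _\<close> \<open>\<psi> \<in> _\<close> that by (simp add: algebra_simps)
    show "\<phi> + \<psi> \<in> carr ?D"
      using that by (intro dualI[OF _ _ le]) (auto simp: dual_add dual_scl dual_outside algebra_simps)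
    show "nrm ?D (\<phi> + \<psi>) \<le> nrm ?D \<phi> + nrm ?D \<psi>"
      by (intro nrm_dual_le le) (auto simp: nrm_dual_nonneg that)
  qed
  have scl: "scl ?D c \<phi> \<in> carr ?D"
    and scl_le: "nrm ?D (scl ?D c \<phi>) \<le> norm c * nrm ?D \<phi>"
    if "\<phi> \<in> carr ?D" for c \<phi>
  proof -
    have le: "norm (scl ?D c \<phi> x) \<le> (norm c * nrm ?D \<phi>) * nrm V x" if "x \<in> carr V" for x
      using dual_bound[OF \<open>\<phi> \<in> _\<close> that] by (simp add: norm_mult mult.assoc mult_left_mono)
    show "scl ?D c \<phi> \<in> carr ?D"
      using that by (intro dualI[OF _ _ le]) (auto simp: dual_add dual_scl dual_outside algebra_simps)
    show "nrm ?D (scl ?D c \<phi>) \<le> norm c * nrm ?D \<phi>"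
      by (intro nrm_dual_le le) (auto simp: nrm_dual_nonneg that)
  qed
  have z: "0 \<in> carr ?D"
    by (rule dualI[where C = 0]) auto
  have scl_eq: "nrm ?D (scl ?D c \<phi>) = norm c * nrm ?D \<phi>"
    if "\<phi> \<in> carr ?D" for c \<phi>
  proof (cases "c = 0")
    case True
    have "0 \<le> nrm ?D (scl ?D c \<phi>)"
      using scl that by (intro nrm_dual_nonneg)
    then show ?thesis
      using scl_le[OF that, of c] True by simp
  next
    case False
    have "nrm ?D (scl ?D (inverse c) (scl ?D c \<phi>)) \<le>
        norm (inverse c) * nrm ?D (scl ?D c \<phi>)"
      by (rule scl_le[OF scl[OF that]])
    then have "norm c * nrm ?D \<phi> \<le> nrm ?D (scl ?D c \<phi>)"
      using False by (simp add: norm_inverse norm_divide field_simps)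
    with scl_le[OF that, of c] show ?thesis by simp
  qed
  have eq0: "nrm ?D \<phi> = 0 \<longleftrightarrow> \<phi> = 0" if "\<phi> \<in> carr ?D" for \<phi>
  proof
    assume "nrm ?D \<phi> = 0"
    then have "\<phi> x = 0" for x
      using dual_bound[OF that, of x] dual_outside[OF that, of x] by (cases "x \<in> carr V") auto
    then show "\<phi> = 0" by (simp add: fun_eq_iff)
  next
    assume "\<phi> = 0"
    then show "nrm ?D \<phi> = 0"
      using scl_eq[OF that, of 0] by (simp add: zero_fun_def)
  qed
  have "D.subspace (carr ?D)"
    using z add(1) scl unfolding D.subspace_def by blast
  then show "normed_space ?D"
    unfolding normed_space_def
    using D.vector_space_axioms eq0 nrm_dual_nonneg add(2) scl_eq by blast
qed

end

section \<open>The Hahn-Banach theorem\<close>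

text \<open>Zorn's lemma is applied to graphs, that is, sets of pairs ordered by inclusion, so that
  unions of chains require no gluing of functions. Single-valuedness of a graph is a consequence of
  domination.\<close>

lemma (in normed_nspace) dominated_extension:
  assumes M: "subspace M" "M \<subseteq> carr V"
    and f: "\<And>x y. x \<in> M \<Longrightarrow> y \<in> M \<Longrightarrow> f (x + y) = f x + f y"
      "\<And>r x. x \<in> M \<Longrightarrow> f (scl V (of_real r) x) = r * f x"
    and C: "0 \<le> C" "\<And>x. x \<in> M \<Longrightarrow> f x \<le> C * nrm V x"
  shows "\<exists>g :: 'v \<Rightarrow> real. (\<forall>x\<in>M. g x = f x) \<and>
    (\<forall>x\<in>carr V. \<forall>y\<in>carr V. g (x + y) = g x + g y) \<and>
    (\<forall>r. \<forall>x\<in>carr V. g (scl V (of_real r) x) = r * g x) \<and> (\<forall>x\<in>carr V. g x \<le> C * nrm V x)"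
proof -
  define s where "s r = scl V (of_real r)" for r :: real
  have s: "s r x \<in> carr V" "nrm V (s r x) = \<bar>r\<bar> * nrm V x" if "x \<in> carr V" for r x
    using that by (simp_all add: s_def)
  have s_simps: "s r (x + y) = s r x + s r y" "s r (x - y) = s r x - s r y" "s r (s r' x) = s (r * r') x"
    "s 1 x = x" "s 0 x = 0" "s (r + r') x = s r x + s r' x" for r r' x y
    by (simp_all add: s_def scale_right_distrib scale_right_diff_distrib scale_left_distrib)
  define ok where "ok G \<longleftrightarrow> (\<forall>x y. (x, y) \<in> G \<longrightarrow> x \<in> carr V \<and> y \<le> C * nrm V x) \<and>
      (\<forall>x y x' y'. (x, y) \<in> G \<longrightarrow> (x', y') \<in> G \<longrightarrow> (x + x', y + y') \<in> G) \<and>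
      (\<forall>r x y. (x, y) \<in> G \<longrightarrow> (s r x, r * y) \<in> G)" for G :: "('v \<times> real) set"
  define G0 where "G0 = (\<lambda>x. (x, f x)) ` M"
  have ok0: "ok G0"
    using M C f subspace_add[OF M(1)] subspace_scale[OF M(1)]
    unfolding ok_def G0_def s_def by (auto simp: image_iff)
  have "\<exists>G\<in>{G. ok G \<and> G0 \<subseteq> G}. \<forall>G'\<in>{G. ok G \<and> G0 \<subseteq> G}. G \<subseteq> G' \<longrightarrow> G' = G"
  proof (rule subset_Zorn_nonempty)
    show "{G. ok G \<and> G0 \<subseteq> G} \<noteq> {}" using ok0 by blast
    fix \<C> assume \<C>: "\<C> \<noteq> {}" "subset.chain {G. ok G \<and> G0 \<subseteq> G} \<C>"
    then have sub: "\<And>G. G \<in> \<C> \<Longrightarrow> ok G" "\<And>G. G \<in> \<C> \<Longrightarrow> G0 \<subseteq> G"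
      and lin: "\<And>G G'. G \<in> \<C> \<Longrightarrow> G' \<in> \<C> \<Longrightarrow> G \<subseteq> G' \<or> G' \<subseteq> G"
      unfolding subset_chain_def by auto
    have "ok (\<Union>\<C>)"
      unfolding ok_def
    proof (intro conjI allI impI)
      fix x y x' y' assume "(x, y) \<in> \<Union>\<C>" "(x', y') \<in> \<Union>\<C>"
      then obtain G G' where "G \<in> \<C>" "(x, y) \<in> G" "G' \<in> \<C>" "(x', y') \<in> G'" by blast
      with lin[of G G'] obtain H where "H \<in> \<C>" "(x, y) \<in> H" "(x', y') \<in> H" by blast
      then show "(x + x', y + y') \<in> \<Union>\<C>"
        using sub(1)[of H] unfolding ok_def by blast
    qed (use sub(1) in \<open>unfold ok_def, blast+\<close>)
    moreover have "G0 \<subseteq> \<Union>\<C>"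
      using sub(2) \<C>(1) by blast
    ultimately show "\<Union>\<C> \<in> {G. ok G \<and> G0 \<subseteq> G}" by simp
  qed
  then obtain G where G: "ok G" "G0 \<subseteq> G" and max: "\<And>G'. ok G' \<Longrightarrow> G0 \<subseteq> G' \<Longrightarrow> G \<subseteq> G' \<Longrightarrow> G' = G"
    by auto
  have G_dom: "x \<in> carr V" "y \<le> C * nrm V x" if "(x, y) \<in> G" for x y
    using G(1) that unfolding ok_def by blast+
  have G_add: "(x + x', y + y') \<in> G" if "(x, y) \<in> G" "(x', y') \<in> G" for x y x' y'
    using G(1) that unfolding ok_def by blast
  have G_scl: "(s r x, r * y) \<in> G" if "(x, y) \<in> G" for r x y
    using G(1) that unfolding ok_def by blast
  have G_diff: "(x - x', y - y') \<in> G" if "(x, y) \<in> G" "(x', y') \<in> G" for x y x' y'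
    using G_add[OF that(1) G_scl[OF that(2), of "- 1"]] by (simp add: s_def)
  have uniq: "y = y'" if "(x, y) \<in> G" "(x, y') \<in> G" for x y y'
  proof -
    \<comment> \<open>All multiples of \<open>(0, y - y')\<close> lie in \<open>G\<close>, and
      domination at 0 bounds their second entries by 0.\<close>
    have "t * (y - y') \<le> 0" for t
      using G_dom(2)[OF G_scl[OF G_diff[OF that], of t]] by (simp add: s_def)
    from this[of 1] this[of "- 1"] show ?thesis by simp
  qed
  have ne: "(0, 0) \<in> G"
    using G(2) subspace_0[OF M(1)] f(2)[of 0 0] unfolding G0_def by force
  have total: "\<exists>y. (x0, y) \<in> G" if x0: "x0 \<in> carr V" for x0
  proof (rule ccontr)
    assume no: "\<nexists>y. (x0, y) \<in> G"
    have le: "y - C * nrm V (x - x0) \<le> C * nrm V (x' + x0) - y'" if "(x, y) \<in> G" "(x', y') \<in> G" for x y x' y'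
    proof -
      have "nrm V (x + x') \<le> nrm V (x - x0) + nrm V (x' + x0)"
        using nrm_add[of "x - x0" "x' + x0"] G_dom(1)[OF that(1)] G_dom(1)[OF that(2)] x0 by simp
      then have "y + y' \<le> C * (nrm V (x - x0) + nrm V (x' + x0))"
        using G_dom(2)[OF G_add[OF that]] C(1) by (meson mult_left_mono order_trans)
      then show ?thesis by (simp add: algebra_simps)
    qed
    \<comment> \<open>The future value at \<open>x0\<close>. By \<open>le\<close> every lower bound
      is at most every upper bound, so the supremum of the lower ones lies between them.\<close>
    define c where "c = (SUP (x, y)\<in>G. y - C * nrm V (x - x0))"
    have bdd: "bdd_above ((\<lambda>(x, y). y - C * nrm V (x - x0)) ` G)"
      using le[OF _ ne] by (intro bdd_aboveI[of _ "C * nrm V (0 + x0) - 0"]) auto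
    have c1: "y - C * nrm V (x - x0) \<le> c" if "(x, y) \<in> G" for x y
      unfolding c_def using cSUP_upper[OF that bdd] by simp
    have c2: "c \<le> C * nrm V (x + x0) - y" if "(x, y) \<in> G" for x y
      unfolding c_def using ne le that by (intro cSUP_least) auto
    define G' where "G' = {(x + s t x0, y + t * c) | x y t. (x, y) \<in> G}"
    have G'I: "(x + s t x0, y + t * c) \<in> G'" if "(x, y) \<in> G" for x y t
      using that unfolding G'_def by blast
    \<comment> \<open>Dividing by \<open>\<bar>t\<bar>\<close> reduces the claim to a vector plus or
      minus \<open>x0\<close>, where \<open>c2\<close> and \<open>c1\<close> apply.\<close>
    have bound: "y + t * c \<le> C * nrm V (x + s t x0)" if xy: "(x, y) \<in> G" for x y t
    proof (cases t "0 :: real" rule: linorder_cases)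
      case equal
      then show ?thesis using G_dom[OF xy] by (simp add: s_simps)
    next
      case greater
      have "x + s t x0 = s t (s (inverse t) x + x0)"
        using greater by (simp add: s_simps)
      then have n: "nrm V (x + s t x0) = t * nrm V (s (inverse t) x + x0)"
        using G_dom(1)[OF xy] x0 greater by (simp add: s)
      have "c \<le> C * nrm V (s (inverse t) x + x0) - inverse t * y"
        by (rule c2[OF G_scl[OF xy]])
      then have "t * c \<le> t * (C * nrm V (s (inverse t) x + x0) - inverse t * y)"
        using greater by (intro mult_left_mono) auto
      also have "\<dots> = C * (t * nrm V (s (inverse t) x + x0)) - y"
        using greater by (simp add: right_diff_distrib flip: mult.assoc)
      finally show ?thesis unfolding n by simp
    next
      case less
      have "x + s t x0 = s (- t) (s (inverse (- t)) x - x0)"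
        using less by (simp add: s_simps) (simp add: s_def)
      then have n: "nrm V (x + s t x0) = (- t) * nrm V (s (inverse (- t)) x - x0)"
        using G_dom(1)[OF xy] x0 less by (simp add: s)
      have "inverse (- t) * y - C * nrm V (s (inverse (- t)) x - x0) \<le> c"
        by (rule c1[OF G_scl[OF xy]])
      then have "(- t) * (inverse (- t) * y - C * nrm V (s (inverse (- t)) x - x0)) \<le> (- t) * c"
        using less by (intro mult_left_mono) auto
      then show ?thesis unfolding n using less by (simp add: algebra_simps)
    qed
    have "ok G'"
      unfolding ok_def
    proof (intro conjI allI impI)
      fix x y assume "(x, y) \<in> G'"
      then show "x \<in> carr V" "y \<le> C * nrm V x"
        using bound G_dom(1) x0 s(1) unfolding G'_def by auto
    next
      fix x y x' y' assume "(x, y) \<in> G'" "(x', y') \<in> G'"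
      then obtain a b t a' b' t' where *: "(a, b) \<in> G" "x = a + s t x0" "y = b + t * c"
        "(a', b') \<in> G" "x' = a' + s t' x0" "y' = b' + t' * c"
        unfolding G'_def by blast
      show "(x + x', y + y') \<in> G'"
        using G'I[OF G_add[OF *(1,4)], of "t + t'"] *
        by (simp add: s_simps algebra_simps)
    next
      fix r x y assume "(x, y) \<in> G'"
      then obtain a b t where *: "(a, b) \<in> G" "x = a + s t x0" "y = b + t * c"
        unfolding G'_def by blast
      show "(s r x, r * y) \<in> G'"
        using G'I[OF G_scl[OF *(1)], of r "r * t"] * by (simp add: s_simps algebra_simps)
    qed
    moreover have "G \<subseteq> G'"
    proof
      fix p assume "p \<in> G"
      then show "p \<in> G'"
        using G'I[of "fst p" "snd p" 0] by (simp add: s_simps)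
    qed
    ultimately have "G' = G"
      using max G(2) by blast
    moreover have "(x0, c) \<in> G'"
      using G'I[OF ne, of 1] by (simp add: s_simps)
    ultimately show False using no by blast
  qed
  define g where "g x = (THE y. (x, y) \<in> G)" for x
  have g_eq: "g x = y" if "(x, y) \<in> G" for x y
    unfolding g_def using uniq that by blast
  have g: "(x, g x) \<in> G" if "x \<in> carr V" for x
    using total[OF that] g_eq by blast
  show ?thesis
  proof (intro exI[of _ g] conjI ballI allI)
    show "g x = f x" if "x \<in> M" for x
      using G(2) that by (intro g_eq) (auto simp: G0_def)
    show "g (x + y) = g x + g y" if "x \<in> carr V" "y \<in> carr V" for x y
      using that by (intro g_eq G_add g)
    show "g (scl V (of_real r) x) = r * g x" if "x \<in> carr V" for x r
      using g_eq[OF G_scl[OF g[OF that]]] by (simp add: s_def)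
    show "g x \<le> C * nrm V x" if "x \<in> carr V" for x
      using G_dom(2)[OF g[OF that]] .
  qed
qed

text \<open>The real part of \<open>f\<close> is extended to \<open>g\<close>, and the functional is
  recovered from \<open>g\<close> by the formula that recovers a scalar from its real part.\<close>

theorem (in normed_nspace) hahn_banach:
  assumes M: "subspace M" "M \<subseteq> carr V"
    and f: "\<And>x y. x \<in> M \<Longrightarrow> y \<in> M \<Longrightarrow> f (x + y) = f x + f y"
      "\<And>c x. x \<in> M \<Longrightarrow> f (scl V c x) = c * f x"
    and C: "0 \<le> C" "\<And>x. x \<in> M \<Longrightarrow> norm (f x) \<le> C * nrm V x"
  shows "\<exists>F\<in>carr (dual V). (\<forall>x\<in>M. F x = f x) \<and> (\<forall>x\<in>carr V. norm (F x) \<le> C * nrm V x)"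
proof -
  obtain \<rho> :: "'k \<Rightarrow> real" and \<iota> :: 'k where \<rho>: "\<And>x y. \<rho> (x + y) = \<rho> x + \<rho> y"
    "\<And>r x. \<rho> (of_real r * x) = r * \<rho> x" "\<And>x. \<bar>\<rho> x\<bar> \<le> norm x" "\<rho> 1 = 1" "\<rho> \<iota> = 0"
    and \<iota>: "norm \<iota> \<le> 1" "\<iota> * \<iota> = - 1 \<or> \<iota> = 0"
    and rep: "\<And>x. x = of_real (\<rho> x) - \<iota> * of_real (\<rho> (\<iota> * x))"
    using real_part_exists by blast
  have \<rho>_minus: "\<rho> (- x) = - \<rho> x" for x
    using \<rho>(2)[of "- 1" x] by simp
  have \<rho>_diff: "\<rho> (x - y) = \<rho> x - \<rho> y" for x y
    using \<rho>(1)[of x "- y"] \<rho>_minus by simp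
  have \<rho>_of_real: "\<rho> (of_real r) = r" "\<rho> (\<iota> * of_real r) = 0" for r
    using \<rho>(2)[of r 1] \<rho>(2)[of r \<iota>] \<rho>(4,5) by (simp_all add: mult.commute)
  have "\<exists>g :: 'v \<Rightarrow> real. (\<forall>x\<in>M. g x = \<rho> (f x)) \<and>
    (\<forall>x\<in>carr V. \<forall>y\<in>carr V. g (x + y) = g x + g y) \<and>
    (\<forall>r. \<forall>x\<in>carr V. g (scl V (of_real r) x) = r * g x) \<and> (\<forall>x\<in>carr V. g x \<le> C * nrm V x)"
  proof (rule dominated_extension[OF M _ _ C(1)])
    show "\<rho> (f x) \<le> C * nrm V x" if "x \<in> M" for x
      using C(2)[OF that] \<rho>(3)[of "f x"] by linarith
  qed (simp_all add: f \<rho>)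
  then obtain g :: "'v \<Rightarrow> real" where g: "\<And>x. x \<in> M \<Longrightarrow> g x = \<rho> (f x)"
    "\<And>x y. x \<in> carr V \<Longrightarrow> y \<in> carr V \<Longrightarrow> g (x + y) = g x + g y"
    "\<And>r x. x \<in> carr V \<Longrightarrow> g (scl V (of_real r) x) = r * g x"
    "\<And>x. x \<in> carr V \<Longrightarrow> g x \<le> C * nrm V x"
    by blast
  define F where "F x = (if x \<in> carr V then of_real (g x) - \<iota> * of_real (g (scl V \<iota> x)) else 0)" for x
  have F_add: "F (x + y) = F x + F y" if "x \<in> carr V" "y \<in> carr V" for x y
    using that by (simp add: F_def g scale_right_distrib algebra_simps)
  have F_real: "F (scl V (of_real r) x) = of_real r * F x" if "x \<in> carr V" for r x
    using that g(3)[of "scl V \<iota> x" r] by (simp add: F_def g(3) algebra_simps)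
  have F_\<iota>: "F (scl V \<iota> x) = \<iota> * F x" if "x \<in> carr V" for x
    using \<iota>(2)
  proof
    assume "\<iota> * \<iota> = - 1"
    moreover have "scl V (- 1) x = scl V (of_real (- 1)) x" by simp
    then have "g (scl V (- 1) x) = - g x"
      using g(3)[OF that, of "- 1"] by simp
    ultimately show ?thesis
      using that by (simp add: F_def right_diff_distrib flip: mult.assoc)
  next
    have "F 0 = 0"
      using F_real[of 0 0] by simp
    moreover assume "\<iota> = 0"
    ultimately show ?thesis by simp
  qed
  have F_scl: "F (scl V c x) = c * F x" if "x \<in> carr V" for c x
  proof -
    define a b where "a = \<rho> c" and "b = - \<rho> (\<iota> * c)"
    have c: "c = of_real a + \<iota> * of_real b"
      using rep[of c] by (simp add: a_def b_def)
    have "scl V c x = scl V (of_real a) x + scl V (of_real b) (scl V \<iota> x)"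
      unfolding c by (simp add: scale_left_distrib mult.commute)
    then have "F (scl V c x) = of_real a * F x + of_real b * (\<iota> * F x)"
      using that by (simp add: F_add F_real F_\<iota> del: scale_scale)
    then show ?thesis
      by (simp add: c algebra_simps)
  qed
  have \<rho>F: "\<rho> (F x) = g x" if "x \<in> carr V" for x
    using that by (simp add: F_def \<rho>_diff \<rho>_of_real)
  have F_bound: "norm (F x) \<le> C * nrm V x" if "x \<in> carr V" for x
  proof (cases "F x = 0")
    case False
    \<comment> \<open>Rotating \<open>x\<close> makes the value real and nonnegative, so the bound
      on the real part \<open>g\<close> passes to \<open>F\<close> without a constant.\<close>
    define u where "u = of_real (norm (F x)) / F x"
    have u: "norm u = 1" "u * F x = of_real (norm (F x))"
      using False by (simp_all add: u_def norm_divide)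
    have "norm (F x) = \<rho> (F (scl V u x))"
      using that by (simp add: F_scl u \<rho>_of_real)
    also have "\<dots> = g (scl V u x)"
      using that by (simp add: \<rho>F)
    also have "\<dots> \<le> C * nrm V x"
      using g(4)[of "scl V u x"] that u by simp
    finally show ?thesis .
  qed (use that C(1) in auto)
  have "F \<in> carr (dual V)"
    by (rule dualI[OF F_add F_scl F_bound]) (auto simp: F_def)
  moreover have "F x = f x" if "x \<in> M" for x
  proof -
    have "scl V \<iota> x \<in> M" "x \<in> carr V"
      using subspace_scale[OF M(1) that] M(2) that by auto
    then show ?thesis
      using rep[of "f x"] that by (simp add: F_def g(1) f(2))
  qed
  ultimately show ?thesis using F_bound by blast
qed

section \<open>Spaces of Lipschitz functions\<close>

definition bounded_functions ::
  "'w set \<Rightarrow> ('k, 'e::ab_group_add) nspace \<Rightarrow> ('k, 'w \<Rightarrow> 'e) nspace" where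
  "bounded_functions W E =
     \<lparr>carr = {g. (\<forall>w\<in>W. g w \<in> carr E) \<and> (\<exists>C. \<forall>w\<in>W. nrm E (g w) \<le> C) \<and> (\<forall>w. w \<notin> W \<longrightarrow> g w = 0)},
      scl = (\<lambda>c g w. scl E c (g w)),
      nrm = sup_norm W E\<rparr>"

lemma bounded_functions_simps [simp]:
  "g \<in> carr (bounded_functions W E) \<longleftrightarrow>
     (\<forall>w\<in>W. g w \<in> carr E) \<and> (\<exists>C. \<forall>w\<in>W. nrm E (g w) \<le> C) \<and> (\<forall>w. w \<notin> W \<longrightarrow> g w = 0)"
  "scl (bounded_functions W E) c g = (\<lambda>w. scl E c (g w))"
  "nrm (bounded_functions W E) = sup_norm W E"
  by (simp_all add: bounded_functions_def)

lemma sup_norm_nonneg: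
  assumes "\<And>w. w \<in> W \<Longrightarrow> nrm E (g w) \<le> C"
  shows "0 \<le> sup_norm W E g"
proof -
  have "bdd_above (insert 0 ((\<lambda>w. nrm E (g w)) ` W))"
    using assms by (simp, intro bdd_aboveI) auto
  then show ?thesis
    unfolding sup_norm_def by (intro cSup_upper) auto
qed

lemma bounded_functions_nonneg: "g \<in> carr (bounded_functions W E) \<Longrightarrow> 0 \<le> sup_norm W E g"
  using sup_norm_nonneg[of W E g] unfolding bounded_functions_simps by blast

lemma sup_norm_upper:
  assumes "\<And>w. w \<in> W \<Longrightarrow> nrm E (g w) \<le> C" "w \<in> W"
  shows "nrm E (g w) \<le> sup_norm W E g"
proof -
  have "bdd_above (insert 0 ((\<lambda>w. nrm E (g w)) ` W))"
    using assms by (simp, intro bdd_aboveI) auto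
  then show ?thesis
    unfolding sup_norm_def using assms(2) by (intro cSup_upper) auto
qed

lemma sup_norm_least:
  assumes "\<And>w. w \<in> W \<Longrightarrow> nrm E (g w) \<le> C" "0 \<le> C"
  shows "sup_norm W E g \<le> C"
  unfolding sup_norm_def using assms by (intro cSup_least) auto

lemma (in normed_nspace) vector_space_pointwise: "vector_space (\<lambda>c (f :: 'w \<Rightarrow> 'v) x. scl V c (f x))"
  by unfold_locales (auto simp: fun_eq_iff scale_right_distrib scale_left_distrib)

lemma (in normed_nspace) normed_nspace_bounded_functions: "normed_nspace (bounded_functions W V)"
proof
  let ?B = "bounded_functions W V"
  have eq: "scl ?B = (\<lambda>c f x. scl V c (f x))"
    by (intro ext) simp
  interpret B: vector_space "scl ?B"
    unfolding eq by (rule vector_space_pointwise)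
  have add: "x + y \<in> carr ?B \<and> nrm ?B (x + y) \<le> nrm ?B x + nrm ?B y"
    if x: "x \<in> carr ?B" and y: "y \<in> carr ?B" for x y
  proof -
    obtain C where C: "\<And>w. w \<in> W \<Longrightarrow> nrm V (x w) \<le> C" using x by auto
    obtain D where D: "\<And>w. w \<in> W \<Longrightarrow> nrm V (y w) \<le> D" using y by auto
    have le: "nrm V ((x + y) w) \<le> sup_norm W V x + sup_norm W V y" if "w \<in> W" for w
      using nrm_add[of "x w" "y w"] sup_norm_upper[of W V x C w] sup_norm_upper[of W V y D w] C D x y that
      by simp
    then have "nrm ?B (x + y) \<le> nrm ?B x + nrm ?B y"
      using sup_norm_nonneg[of W V x C] sup_norm_nonneg[of W V y D] C D
      by (simp, intro sup_norm_least) auto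
    then show ?thesis using x y le by auto
  qed
  have scl: "scl ?B c x \<in> carr ?B \<and> nrm ?B (scl ?B c x) \<le> norm c * nrm ?B x" if x: "x \<in> carr ?B" for c x
  proof -
    obtain C where C: "\<And>w. w \<in> W \<Longrightarrow> nrm V (x w) \<le> C" using x by auto
    have le: "nrm V (scl V c (x w)) \<le> norm c * sup_norm W V x" if "w \<in> W" for w
      using sup_norm_upper[of W V x C w] C x that by (simp add: mult_left_mono)
    then have "nrm ?B (scl ?B c x) \<le> norm c * nrm ?B x"
      using sup_norm_nonneg[of W V x C] C by (simp, intro sup_norm_least) auto
    then show ?thesis using x le by auto
  qed
  have z: "0 \<in> carr ?B"
    by (auto intro!: exI[of _ 0])
  have scl_eq: "nrm ?B (scl ?B c x) = norm c * nrm ?B x" if x: "x \<in> carr ?B" for c x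
  proof (cases "c = 0")
    case True
    have "0 \<le> nrm ?B (scl ?B c x)"
      using bounded_functions_nonneg scl[OF x, of c] unfolding bounded_functions_simps(3) by blast
    then show ?thesis
      using scl[OF x, of c] True by simp
  next
    case False
    have "nrm ?B (scl ?B (inverse c) (scl ?B c x)) \<le> norm (inverse c) * nrm ?B (scl ?B c x)"
      using scl x by blast
    then have "norm c * nrm ?B x \<le> nrm ?B (scl ?B c x)"
      using False by (simp add: norm_inverse norm_divide field_simps)
    with scl[OF x, of c] show ?thesis by simp
  qed
  have pos: "0 \<le> nrm ?B x \<and> (nrm ?B x = 0 \<longleftrightarrow> x = 0)" if x: "x \<in> carr ?B" for x
  proof (intro conjI iffI)
    show "0 \<le> nrm ?B x"
      using bounded_functions_nonneg[OF x] by simp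
    assume *: "nrm ?B x = 0"
    obtain C where C: "\<And>w. w \<in> W \<Longrightarrow> nrm V (x w) \<le> C" using x by auto
    have "x w = 0" for w
    proof (cases "w \<in> W")
      case True
      then have "nrm V (x w) \<le> 0"
        using sup_norm_upper[of W V x C w] C * by simp
      then show ?thesis
        using True x by (metis antisym bounded_functions_simps(1) nrm_eq_0 nrm_nonneg)
    qed (use x in auto)
    then show "x = 0" by (simp add: fun_eq_iff)
  next
    assume "x = 0"
    then show "nrm ?B x = 0"
      using scl_eq[OF x, of 0] by (simp add: zero_fun_def)
  qed
  have "B.subspace (carr ?B)"
    unfolding B.subspace_def using z add scl by blast
  then show "normed_space ?B"
    unfolding normed_space_def using B.vector_space_axioms pos add scl_eq by blast
qed

text \<open>
  The diagonal of \<open>X \<times> X\<close> carries the values of \<open>f\<close> and its complement the difference quotients,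
  so that the norm of \<open>Lip X E\<close> is the supremum norm of \<open>dq E f\<close>.
\<close>

definition dq :: "('k::real_or_complex, 'e::ab_group_add) nspace \<Rightarrow> ('x::metric_space \<Rightarrow> 'e) \<Rightarrow> 'x \<times> 'x \<Rightarrow> 'e" where
  "dq E f w = (if fst w = snd w then f (fst w)
     else scl E (of_real (inverse (dist (fst w) (snd w)))) (f (fst w) - f (snd w)))"

lemma little_lip_simps [simp]:
  "nrm (little_lip X E) = nrm (Lip X E)"
  "scl (little_lip X E) c f = (\<lambda>x. scl E c (f x))"
  "scl (Lip X E) c f = (\<lambda>x. scl E c (f x))"
  by (simp_all add: little_lip_def Lip_def)

section \<open>Lipschitz functions as bounded functions on pairs\<close>

locale lip_setting = normed_nspace E
  for E :: "('k::real_or_complex, 'e::ab_group_add) nspace" +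
  fixes X :: "'x::metric_space set"
  assumes compact: "compact X"
begin

lemma dq_add: "dq E (f + g) w = dq E f w + dq E g w"
  by (simp add: dq_def add_diff_add scale_right_distrib)

lemma dq_scl: "dq E (\<lambda>x. scl E c (f x)) w = scl E c (dq E f w)"
  by (simp add: dq_def scale_right_diff_distrib mult.commute)

lemma dq_in: "f ` X \<subseteq> carr E \<Longrightarrow> w \<in> X \<times> X \<Longrightarrow> dq E f w \<in> carr E"
  by (auto simp: dq_def image_subset_iff)

lemma nrm_dq_offdiag:
  "f ` X \<subseteq> carr E \<Longrightarrow> x \<in> X \<Longrightarrow> x' \<in> X \<Longrightarrow> x \<noteq> x' \<Longrightarrow>
    nrm E (dq E f (x, x')) = nrm E (f x - f x') / dist x x'"
  by (auto simp: dq_def image_subset_iff norm_inverse norm_divide divide_inverse)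

lemma nrm_diff_le_dq:
  assumes "f ` X \<subseteq> carr E" "\<And>w. w \<in> X \<times> X \<Longrightarrow> nrm E (dq E f w) \<le> C" "x \<in> X" "x' \<in> X"
  shows "nrm E (f x - f x') \<le> C * dist x x'"
proof (cases "x = x'")
  case False
  then show ?thesis
    using assms(2)[of "(x, x')"] assms by (simp add: nrm_dq_offdiag field_simps)
qed simp

lemma continuous_if_lipschitz:
  assumes "f ` X \<subseteq> carr E" "\<And>x x'. x \<in> X \<Longrightarrow> x' \<in> X \<Longrightarrow> nrm E (f x - f x') \<le> C * dist x x'"
  shows "continuous_map (top_of_set X) (ntopology E) f"
proof -
  interpret M: Metric_space "carr E" "ndist E"
    by (rule normed_space_Metric_space[OF normed_space])
  show ?thesis
    unfolding ntopology_def M.continuous_map_to_metric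
  proof (intro ballI allI impI)
    fix x \<epsilon> assume x: "x \<in> topspace (top_of_set X)" and "\<epsilon> > (0::real)"
    \<comment> \<open>\<open>\<bar>C\<bar> + 1\<close> is positive whatever the sign of
      \<open>C\<close>.\<close>
    define \<delta> where "\<delta> = \<epsilon> / (\<bar>C\<bar> + 1)"
    have "\<delta> > 0" using \<open>\<epsilon> > 0\<close> by (simp add: \<delta>_def)
    have "f y \<in> M.mball (f x) \<epsilon>" if "y \<in> X \<inter> ball x \<delta>" for y
    proof -
      have "nrm E (f x - f y) \<le> C * dist x y"
        using assms(2) x that by simp
      also have "\<dots> \<le> (\<bar>C\<bar> + 1) * dist x y"
        by (intro mult_right_mono) auto
      also have "\<dots> < (\<bar>C\<bar> + 1) * \<delta>"
        using that by (intro mult_strict_left_mono) auto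
      also have "\<dots> = \<epsilon>" by (simp add: \<delta>_def)
      finally show ?thesis
        using assms(1) x that by (auto simp: ndist_def)
    qed
    moreover have "openin (top_of_set X) (X \<inter> ball x \<delta>)"
      by (simp add: openin_open_Int)
    ultimately show "\<exists>U. openin (top_of_set X) U \<and> x \<in> U \<and> (\<forall>y\<in>U. f y \<in> M.mball (f x) \<epsilon>)"
      using x \<open>\<delta> > 0\<close> by (intro exI[of _ "X \<inter> ball x \<delta>"]) auto
  qed
qed

text \<open>A bound on the difference quotients also bounds the values because the compact set
  \<open>X\<close> has finite diameter. Conversely, bounded quotients imply continuity, which
  thereby disappears from the description.\<close>

lemma Lip_iff:
  "f \<in> carr (Lip X E) \<longleftrightarrow> f ` X \<subseteq> carr E \<and> (\<forall>x. x \<notin> X \<longrightarrow> f x = 0) \<and>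
     (\<exists>C. \<forall>w\<in>X \<times> X. nrm E (dq E f w) \<le> C)"
proof
  assume f: "f \<in> carr (Lip X E)"
  interpret M: Metric_space "carr E" "ndist E"
    by (rule normed_space_Metric_space[OF normed_space])
  have im: "f ` X \<subseteq> carr E"
    using f continuous_map_image_subset_topspace[of "top_of_set X" "ntopology E" f]
    by (auto simp: Lip_def ntopology_def)
  obtain L where "\<And>q. q \<in> lip_quotients X E f \<Longrightarrow> q \<le> L"
    using f by (auto simp: Lip_def bdd_above_def)
  then have L: "nrm E (f x - f x') / dist x x' \<le> L" if "x \<in> X" "x' \<in> X" "x \<noteq> x'" for x x'
    using that unfolding lip_quotients_def by blast
  have "\<exists>C. \<forall>w\<in>X \<times> X. nrm E (dq E f w) \<le> C"
  proof (cases "X = {}")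
    case False
    then obtain x0 where x0: "x0 \<in> X" by blast
    obtain B where B: "\<And>x. x \<in> X \<Longrightarrow> dist x x0 \<le> B"
      using compact_imp_bounded[OF compact] by (auto simp: bounded_any_center[of _ x0] dist_commute)
    have 1: "nrm E (f x) \<le> nrm E (f x0) + \<bar>L\<bar> * \<bar>B\<bar>" if x: "x \<in> X" for x
    proof -
      have "nrm E (f x - f x0) \<le> \<bar>L\<bar> * \<bar>B\<bar>"
      proof (cases "x = x0")
        case False
        then have "nrm E (f x - f x0) \<le> L * dist x x0"
          using L[OF x x0] by (simp add: field_simps)
        also have "\<dots> \<le> \<bar>L\<bar> * \<bar>B\<bar>"
          using B[OF x] by (intro mult_mono) auto
        finally show ?thesis .
      qed simp
      then show ?thesis
        using nrm_add[of "f x - f x0" "f x0"] im x x0 by (auto simp: image_subset_iff)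
    qed
    have "nrm E (dq E f w) \<le> max L (nrm E (f x0) + \<bar>L\<bar> * \<bar>B\<bar>)" if "w \<in> X \<times> X" for w
    proof (cases "fst w = snd w")
      case True
      then show ?thesis
        using 1[of "fst w"] that by (auto simp: dq_def)
    next
      case False
      then show ?thesis
        using L[of "fst w" "snd w"] nrm_dq_offdiag[OF im, of "fst w" "snd w"] that by auto
    qed
    then show ?thesis by blast
  qed simp
  with f im show "f ` X \<subseteq> carr E \<and> (\<forall>x. x \<notin> X \<longrightarrow> f x = 0) \<and>
     (\<exists>C. \<forall>w\<in>X \<times> X. nrm E (dq E f w) \<le> C)"
    by (simp add: Lip_def)
next
  assume "f ` X \<subseteq> carr E \<and> (\<forall>x. x \<notin> X \<longrightarrow> f x = 0) \<and>
     (\<exists>C. \<forall>w\<in>X \<times> X. nrm E (dq E f w) \<le> C)"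
  then obtain C where f: "f ` X \<subseteq> carr E" "\<And>x. x \<notin> X \<Longrightarrow> f x = 0"
    and C: "\<And>w. w \<in> X \<times> X \<Longrightarrow> nrm E (dq E f w) \<le> C"
    by blast
  have "continuous_map (top_of_set X) (ntopology E) f"
    by (rule continuous_if_lipschitz[OF f(1) nrm_diff_le_dq[OF f(1) C]])
  moreover have "bdd_above (lip_quotients X E f)"
  proof (rule bdd_aboveI)
    fix q assume "q \<in> lip_quotients X E f"
    then obtain x x' where "q = nrm E (f x - f x') / dist x x'" "x \<in> X" "x' \<in> X" "x \<noteq> x'"
      unfolding lip_quotients_def by blast
    then show "q \<le> C"
      using C[of "(x, x')"] f(1) by (simp add: nrm_dq_offdiag)
  qed
  ultimately show "f \<in> carr (Lip X E)"
    using f(2) by (simp add: Lip_def)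
qed

lemma nrm_Lip:
  assumes "f \<in> carr (Lip X E)"
  shows "nrm (Lip X E) f = sup_norm (X \<times> X) E (dq E f)"
proof -
  obtain C where f: "f ` X \<subseteq> carr E" and C: "\<And>w. w \<in> X \<times> X \<Longrightarrow> nrm E (dq E f w) \<le> C"
    using assms unfolding Lip_iff by blast
  have q: "lip_quotients X E f = (\<lambda>w. nrm E (dq E f w)) ` {w \<in> X \<times> X. fst w \<noteq> snd w}"
  proof -
    have "lip_quotients X E f =
        (\<lambda>w. nrm E (f (fst w) - f (snd w)) / dist (fst w) (snd w)) ` {w \<in> X \<times> X. fst w \<noteq> snd w}"
      unfolding lip_quotients_def image_def by (intro Collect_cong) auto
    also have "\<dots> = (\<lambda>w. nrm E (dq E f w)) ` {w \<in> X \<times> X. fst w \<noteq> snd w}"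
      using nrm_dq_offdiag[OF f] by (intro image_cong refl) auto
    finally show ?thesis .
  qed
  have d: "(\<lambda>x. nrm E (f x)) ` X = (\<lambda>w. nrm E (dq E f w)) ` {w \<in> X \<times> X. fst w = snd w}"
    by (auto simp: dq_def image_iff)
  have "insert 0 ((\<lambda>x. nrm E (f x)) ` X) \<union> insert 0 (lip_quotients X E f) =
      insert 0 ((\<lambda>w. nrm E (dq E f w)) ` (X \<times> X))"
    unfolding q d by blast
  moreover have "bdd_above ((\<lambda>w. nrm E (dq E f w)) ` A)" if "A \<subseteq> X \<times> X" for A
    using C that by (intro bdd_aboveI[of _ C]) auto
  then have "bdd_above ((\<lambda>x. nrm E (f x)) ` X)" "bdd_above (lip_quotients X E f)"
    unfolding q d by simp_all
  ultimately show ?thesis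
    using cSup_union_distrib[of "insert 0 ((\<lambda>x. nrm E (f x)) ` X)" "insert 0 (lip_quotients X E f)"]
    by (simp add: Lip_def sup_norm_def lip_const_def sup_max)
qed

text \<open>\<open>dq E f\<close> can be nonzero at a pair with only one entry in \<open>X\<close>;
  the cut-off puts it into \<open>bounded_functions\<close>.\<close>

definition D :: "('x \<Rightarrow> 'e) \<Rightarrow> 'x \<times> 'x \<Rightarrow> 'e" where
  "D f w = (if w \<in> X \<times> X then dq E f w else 0)"

lemma D_in: "f \<in> carr (Lip X E) \<Longrightarrow> D f \<in> carr (bounded_functions (X \<times> X) E)"
  using dq_in by (simp add: Lip_iff D_def)

lemma D_add: "D (f + g) = D f + D g"
  by (auto simp: D_def dq_add)

lemma D_scl: "D (\<lambda>x. scl E c (f x)) = scl (bounded_functions (X \<times> X) E) c (D f)"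
  by (auto simp: D_def dq_scl)

lemma sup_norm_D: "sup_norm (X \<times> X) E (D f) = sup_norm (X \<times> X) E (dq E f)"
  unfolding sup_norm_def D_def by (simp cong: image_cong)

text \<open>The norm axioms are pulled back along the injective linear map \<open>D\<close> into the
  bounded functions.\<close>

lemma normed_nspace_Lip: "normed_nspace (Lip X E)"
proof
  interpret B: normed_nspace "bounded_functions (X \<times> X) E"
    by (rule normed_nspace_bounded_functions)
  let ?L = "Lip X E"
  have eq: "scl ?L = (\<lambda>c f x. scl E c (f x))"
    by (intro ext) simp
  interpret L: vector_space "scl ?L"
    unfolding eq by (rule vector_space_pointwise)
  have nrm: "nrm ?L f = nrm (bounded_functions (X \<times> X) E) (D f)" if "f \<in> carr ?L" for f
    using that by (simp add: nrm_Lip sup_norm_D)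
  have inL: "f \<in> carr ?L \<longleftrightarrow> f ` X \<subseteq> carr E \<and> (\<forall>x. x \<notin> X \<longrightarrow> f x = 0) \<and>
      D f \<in> carr (bounded_functions (X \<times> X) E)" for f
    using dq_in[of f] by (auto simp: Lip_iff D_def)
  have D0: "D f = 0 \<longleftrightarrow> f = 0" if "f \<in> carr ?L" for f
  proof
    assume *: "D f = 0"
    have "f x = 0" for x
      using that fun_cong[OF *, of "(x, x)"] by (cases "x \<in> X") (auto simp: D_def dq_def inL)
    then show "f = 0" by (simp add: fun_eq_iff)
  qed (simp add: D_def dq_def fun_eq_iff)
  have add: "f + g \<in> carr ?L" if "f \<in> carr ?L" "g \<in> carr ?L" for f g
    using that B.add_in[of "D f" "D g"] unfolding inL D_add by (auto simp: image_subset_iff)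
  have scl: "scl ?L c f \<in> carr ?L" if "f \<in> carr ?L" for c f
    using that B.scl_in[of "D f" c] unfolding inL D_scl little_lip_simps by (auto simp: image_subset_iff)
  have z: "0 \<in> carr ?L"
    unfolding Lip_iff by (auto simp: dq_def)
  have "L.subspace (carr ?L)"
    unfolding L.subspace_def using z add scl by blast
  moreover have "0 \<le> nrm ?L x \<and> (nrm ?L x = 0 \<longleftrightarrow> x = 0)" if "x \<in> carr ?L" for x
    using B.nrm_nonneg[OF D_in[OF that]] B.nrm_eq_0[OF D_in[OF that]] D0[OF that] nrm[OF that] by metis
  moreover have "nrm ?L (x + y) \<le> nrm ?L x + nrm ?L y" if "x \<in> carr ?L" "y \<in> carr ?L" for x y
    unfolding nrm[OF add[OF that]] nrm[OF that(1)] nrm[OF that(2)] D_add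
    by (intro B.nrm_add D_in that)
  moreover have "nrm ?L (scl ?L c x) = norm c * nrm ?L x" if "x \<in> carr ?L" for c x
    using nrm[OF scl[OF that, of c]] B.nrm_scl[OF D_in[OF that], of c] nrm[OF that] D_scl[of c x] by simp
  ultimately show "normed_space ?L"
    unfolding normed_space_def using L.vector_space_axioms by blast
qed

sublocale L: normed_nspace "Lip X E"
  by (rule normed_nspace_Lip)

lemma nrm_dq_le:
  assumes "f \<in> carr (Lip X E)" "w \<in> X \<times> X"
  shows "nrm E (dq E f w) \<le> nrm (Lip X E) f"
proof -
  obtain C where C: "\<And>w. w \<in> X \<times> X \<Longrightarrow> nrm E (dq E f w) \<le> C"
    using assms(1) unfolding Lip_iff by blast
  show ?thesis
    unfolding nrm_Lip[OF assms(1)] by (rule sup_norm_upper[of _ _ _ C, OF C assms(2)])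
qed

lemma nrm_Lip_le:
  "f \<in> carr (Lip X E) \<Longrightarrow> (\<And>w. w \<in> X \<times> X \<Longrightarrow> nrm E (dq E f w) \<le> C) \<Longrightarrow> 0 \<le> C \<Longrightarrow> nrm (Lip X E) f \<le> C"
  by (simp add: nrm_Lip sup_norm_least)

lemma LipI:
  "f ` X \<subseteq> carr E \<Longrightarrow> (\<And>x. x \<notin> X \<Longrightarrow> f x = 0) \<Longrightarrow> (\<And>w. w \<in> X \<times> X \<Longrightarrow> nrm E (dq E f w) \<le> C) \<Longrightarrow>
    f \<in> carr (Lip X E)"
  unfolding Lip_iff by blast

lemma Lip_image: "f \<in> carr (Lip X E) \<Longrightarrow> f ` X \<subseteq> carr E"
  and Lip_outside: "f \<in> carr (Lip X E) \<Longrightarrow> x \<notin> X \<Longrightarrow> f x = 0"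
  unfolding Lip_iff by blast+

lemma Lip_dq_in [intro]: "f \<in> carr (Lip X E) \<Longrightarrow> w \<in> X \<times> X \<Longrightarrow> dq E f w \<in> carr E"
  by (rule dq_in[OF Lip_image])

lemma Lip_diff_le:
  "f \<in> carr (Lip X E) \<Longrightarrow> x \<in> X \<Longrightarrow> x' \<in> X \<Longrightarrow> nrm E (f x - f x') \<le> nrm (Lip X E) f * dist x x'"
  by (rule nrm_diff_le_dq[OF Lip_image nrm_dq_le])

text \<open>Multiplied out by the distance, the condition includes equal points and is easily added
  up.\<close>

lemma little_lip_iff:
  "f \<in> carr (little_lip X E) \<longleftrightarrow> f \<in> carr (Lip X E) \<and>
    (\<forall>\<epsilon>>0. \<exists>\<delta>>0. \<forall>x\<in>X. \<forall>x'\<in>X. dist x x' < \<delta> \<longrightarrow> nrm E (f x - f x') \<le> \<epsilon> * dist x x')"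
proof -
  have "(\<forall>\<epsilon>>0. \<exists>\<delta>>0. \<forall>x\<in>X. \<forall>x'\<in>X. x \<noteq> x' \<and> dist x x' < \<delta> \<longrightarrow> nrm E (f x - f x') / dist x x' < \<epsilon>) \<longleftrightarrow>
    (\<forall>\<epsilon>>0. \<exists>\<delta>>0. \<forall>x\<in>X. \<forall>x'\<in>X. dist x x' < \<delta> \<longrightarrow> nrm E (f x - f x') \<le> \<epsilon> * dist x x')"
    (is "?l \<longleftrightarrow> ?r")
  proof (intro iffI allI impI)
    fix \<epsilon> :: real assume "\<epsilon> > 0" ?l
    then obtain \<delta> where \<delta>: "\<delta> > 0"
      "\<And>x x'. x \<in> X \<Longrightarrow> x' \<in> X \<Longrightarrow> x \<noteq> x' \<Longrightarrow> dist x x' < \<delta> \<Longrightarrow> nrm E (f x - f x') / dist x x' < \<epsilon>"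
      by meson
    show "\<exists>\<delta>>0. \<forall>x\<in>X. \<forall>x'\<in>X. dist x x' < \<delta> \<longrightarrow> nrm E (f x - f x') \<le> \<epsilon> * dist x x'"
    proof (intro exI[of _ \<delta>] conjI ballI impI \<delta>(1))
      show "nrm E (f x - f x') \<le> \<epsilon> * dist x x'" if "x \<in> X" "x' \<in> X" "dist x x' < \<delta>" for x x'
        using \<delta>(2)[of x x'] that by (cases "x = x'") (auto simp: field_simps)
    qed
  next
    fix \<epsilon> :: real assume "\<epsilon> > 0" ?r
    \<comment> \<open>Halving \<open>\<epsilon>\<close> turns the weak inequality back into a strict
      one.\<close>
    then obtain \<delta> where \<delta>: "\<delta> > 0"
      "\<And>x x'. x \<in> X \<Longrightarrow> x' \<in> X \<Longrightarrow> dist x x' < \<delta> \<Longrightarrow> nrm E (f x - f x') \<le> (\<epsilon> / 2) * dist x x'"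
      by (meson half_gt_zero)
    show "\<exists>\<delta>>0. \<forall>x\<in>X. \<forall>x'\<in>X. x \<noteq> x' \<and> dist x x' < \<delta> \<longrightarrow> nrm E (f x - f x') / dist x x' < \<epsilon>"
    proof (intro exI[of _ \<delta>] conjI ballI impI \<delta>(1))
      fix x x' assume "x \<in> X" "x' \<in> X" "x \<noteq> x' \<and> dist x x' < \<delta>"
      then have "nrm E (f x - f x') / dist x x' \<le> \<epsilon> / 2"
        using \<delta>(2)[of x x'] by (simp add: field_simps)
      then show "nrm E (f x - f x') / dist x x' < \<epsilon>"
        using \<open>\<epsilon> > 0\<close> by linarith
    qed
  qed
  then show ?thesis by (simp add: little_lip_def)
qed

lemma little_lipD:
  assumes "f \<in> carr (little_lip X E)" "\<epsilon> > 0"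
  obtains \<delta> where "\<delta> > 0"
    "\<And>x x'. x \<in> X \<Longrightarrow> x' \<in> X \<Longrightarrow> dist x x' < \<delta> \<Longrightarrow> nrm E (f x - f x') \<le> \<epsilon> * dist x x'"
proof -
  have "\<exists>\<delta>>0. \<forall>x\<in>X. \<forall>x'\<in>X. dist x x' < \<delta> \<longrightarrow> nrm E (f x - f x') \<le> \<epsilon> * dist x x'"
    using assms by (simp add: little_lip_iff)
  then show ?thesis using that by blast
qed

lemma little_lip_Lip: "f \<in> carr (little_lip X E) \<Longrightarrow> f \<in> carr (Lip X E)"
  by (simp add: little_lip_iff)

lemma normed_nspace_little_lip: "normed_nspace (little_lip X E)"
proof
  let ?l = "little_lip X E"
  have eq: "scl ?l = scl (Lip X E)"
    by (intro ext) simp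
  have add: "f + g \<in> carr ?l" if f: "f \<in> carr ?l" and g: "g \<in> carr ?l" for f g
    unfolding little_lip_iff
  proof (intro conjI allI impI)
    show "f + g \<in> carr (Lip X E)"
      using f g by (simp add: little_lip_iff)
    fix \<epsilon> :: real assume "\<epsilon> > 0"
    then have "\<epsilon> / 2 > 0" by simp
    obtain \<delta> where \<delta>: "\<delta> > 0"
      "\<And>x x'. x \<in> X \<Longrightarrow> x' \<in> X \<Longrightarrow> dist x x' < \<delta> \<Longrightarrow> nrm E (f x - f x') \<le> (\<epsilon> / 2) * dist x x'"
      using little_lipD[OF f \<open>\<epsilon> / 2 > 0\<close>] by blast
    obtain \<delta>' where \<delta>': "\<delta>' > 0"
      "\<And>x x'. x \<in> X \<Longrightarrow> x' \<in> X \<Longrightarrow> dist x x' < \<delta>' \<Longrightarrow> nrm E (g x - g x') \<le> (\<epsilon> / 2) * dist x x'"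
      using little_lipD[OF g \<open>\<epsilon> / 2 > 0\<close>] by blast
    show "\<exists>\<delta>>0. \<forall>x\<in>X. \<forall>x'\<in>X. dist x x' < \<delta> \<longrightarrow> nrm E ((f + g) x - (f + g) x') \<le> \<epsilon> * dist x x'"
    proof (intro exI[of _ "min \<delta> \<delta>'"] conjI ballI impI)
      fix x x' assume *: "x \<in> X" "x' \<in> X" "dist x x' < min \<delta> \<delta>'"
      have "f ` X \<subseteq> carr E" "g ` X \<subseteq> carr E"
        using f g by (auto simp: little_lip_iff Lip_iff)
      then have "nrm E ((f + g) x - (f + g) x') \<le> nrm E (f x - f x') + nrm E (g x - g x')"
        using nrm_add[of "f x - f x'" "g x - g x'"] * by (simp add: image_subset_iff algebra_simps)
      then show "nrm E ((f + g) x - (f + g) x') \<le> \<epsilon> * dist x x'"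
        using \<delta>(2)[of x x'] \<delta>'(2)[of x x'] * by simp
    qed (use \<delta> \<delta>' in simp)
  qed
  have scl: "scl ?l c f \<in> carr ?l" if f: "f \<in> carr ?l" for c f
    unfolding little_lip_iff
  proof (intro conjI allI impI)
    show "scl ?l c f \<in> carr (Lip X E)"
      using f L.scl_in[of f c] by (simp add: little_lip_iff)
    fix \<epsilon> :: real assume "\<epsilon> > 0"
    then have "\<epsilon> / (norm c + 1) > 0"
      by (simp add: add_nonneg_pos)
    then obtain \<delta> where \<delta>: "\<delta> > 0"
      "\<And>x x'. x \<in> X \<Longrightarrow> x' \<in> X \<Longrightarrow> dist x x' < \<delta> \<Longrightarrow> nrm E (f x - f x') \<le> (\<epsilon> / (norm c + 1)) * dist x x'"
      using little_lipD[OF f, of "\<epsilon> / (norm c + 1)"] by blast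
    show "\<exists>\<delta>>0. \<forall>x\<in>X. \<forall>x'\<in>X. dist x x' < \<delta> \<longrightarrow> nrm E (scl ?l c f x - scl ?l c f x') \<le> \<epsilon> * dist x x'"
    proof (intro exI[of _ \<delta>] conjI ballI impI \<delta>(1))
      fix x x' assume *: "x \<in> X" "x' \<in> X" "dist x x' < \<delta>"
      have im: "f ` X \<subseteq> carr E"
        using f by (auto simp: little_lip_iff Lip_iff)
      then have "nrm E (scl ?l c f x - scl ?l c f x') = norm c * nrm E (f x - f x')"
        using * by (simp add: image_subset_iff flip: scale_right_diff_distrib)
      also have "\<dots> \<le> (norm c + 1) * nrm E (f x - f x')"
        using im * by (intro mult_right_mono) (auto simp: image_subset_iff)
      also have "\<dots> \<le> (norm c + 1) * ((\<epsilon> / (norm c + 1)) * dist x x')"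
        using \<delta>(2)[of x x'] * by (intro mult_left_mono) auto
      also have "\<dots> = \<epsilon> * dist x x'"
        using add_nonneg_pos[of "norm c" 1] by (simp add: field_simps)
      finally show "nrm E (scl ?l c f x - scl ?l c f x') \<le> \<epsilon> * dist x x'" .
    qed
  qed
  have "0 \<in> carr ?l"
    unfolding little_lip_iff by (auto intro!: exI[of _ 1])
  then have "L.subspace (carr ?l)"
    unfolding L.subspace_def using add scl by (simp only: eq) blast
  then show "normed_space ?l"
    unfolding normed_space_def eq little_lip_simps
    using vector_space_pointwise L.nrm_add L.nrm_scl L.nrm_nonneg L.nrm_eq_0 little_lip_Lip
    by simp
qed

sublocale l: normed_nspace "little_lip X E"
  by (rule normed_nspace_little_lip)

section \<open>Elementary functionals\<close>

abbreviation bidual :: "('k, ('e \<Rightarrow> 'k) \<Rightarrow> 'k) nspace" where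
  "bidual \<equiv> dual (dual E)"

abbreviation lip_dual :: "('k, ('x \<Rightarrow> 'e) \<Rightarrow> 'k) nspace" where
  "lip_dual \<equiv> dual (little_lip X E)"

sublocale dE: normed_nspace "dual E"
  by (rule normed_nspace_dual)

sublocale dl: normed_nspace lip_dual
  by (rule l.normed_nspace_dual)

text \<open>This is \<open>b \<circ> w\<close> in the notation of the overview; off the diagonal it
  is a difference of two evaluations divided by the distance. The value 0 outside the carrier is
  what membership in the dual demands.\<close>

definition elem :: "'x \<times> 'x \<Rightarrow> ('e \<Rightarrow> 'k) \<Rightarrow> ('x \<Rightarrow> 'e) \<Rightarrow> 'k" where
  "elem w b f = (if f \<in> carr (little_lip X E) then b (dq E f w) else 0)"

lemma
  assumes w: "w \<in> X \<times> X" and b: "b \<in> carr (dual E)"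
  shows elem_dual: "elem w b \<in> carr lip_dual"
    and nrm_elem: "nrm lip_dual (elem w b) \<le> nrm (dual E) b"
proof -
  have le: "norm (elem w b f) \<le> nrm (dual E) b * nrm (little_lip X E) f" if f: "f \<in> carr (little_lip X E)" for f
  proof -
    have "norm (elem w b f) \<le> nrm (dual E) b * nrm E (dq E f w)"
      using dual_bound[OF b Lip_dq_in[OF little_lip_Lip[OF f] w]] f by (simp add: elem_def)
    also have "\<dots> \<le> nrm (dual E) b * nrm (little_lip X E) f"
      using nrm_dq_le[OF little_lip_Lip[OF f] w] b by (intro mult_left_mono) auto
    finally show ?thesis .
  qed
  show "elem w b \<in> carr lip_dual"
  proof (rule l.dualI[OF _ _ le])
    fix f g assume "f \<in> carr (little_lip X E)" "g \<in> carr (little_lip X E)"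
    then show "elem w b (f + g) = elem w b f + elem w b g"
      using b w Lip_dq_in little_lip_Lip by (auto simp: elem_def dq_add intro!: dual_add[OF b])
  next
    fix c f assume f: "f \<in> carr (little_lip X E)"
    then show "elem w b (scl (little_lip X E) c f) = c * elem w b f"
      using b w Lip_dq_in little_lip_Lip l.scl_in[OF f, of c] by (auto simp: elem_def dq_scl intro!: dual_scl[OF b])
  qed (auto simp: elem_def)
  show "nrm lip_dual (elem w b) \<le> nrm (dual E) b"
    using b by (intro l.nrm_dual_le le) auto
qed

end

section \<open>Approximation of functionals\<close>

text \<open>For estimates that are not homogeneous in \<open>x\<close>, such as those in the proof
  of superadditivity below.\<close>

lemma (in normed_nspace) nrm_dual_le_unit:
  assumes "\<And>x. x \<in> carr V \<Longrightarrow> nrm V x \<le> 1 \<Longrightarrow> norm (\<phi> x) \<le> C"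
  shows "nrm (dual V) \<phi> \<le> C"
  unfolding nrm_dual
proof (rule cSUP_least)
  have "0 \<in> {x \<in> carr V. nrm V x \<le> 1}" by simp
  then show "{x \<in> carr V. nrm V x \<le> 1} \<noteq> {}" by blast
qed (use assms in auto)

lemma unimodular_exists:
  fixes z :: "'k::real_normed_field"
  obtains u where "norm u = 1" "u * z = of_real (norm z)"
proof (cases "z = 0")
  case True
  then show ?thesis using that[of 1] by simp
next
  case False
  then show ?thesis using that[of "of_real (norm z) / z"] by (simp add: norm_divide)
qed

declare split_paired_All [simp del]

context lip_setting
begin

lemma inj_D:
  assumes "f \<in> carr (Lip X E)" "g \<in> carr (Lip X E)" "D f = D g"
  shows "f = g"
proof
  fix x
  show "f x = g x"
    using fun_cong[OF assms(3), of "(x, x)"] Lip_outside[OF assms(1)] Lip_outside[OF assms(2)]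
    by (cases "x \<in> X") (auto simp: D_def dq_def)
qed

text \<open>Away from the diagonal the quotients are Lipschitz functions of the pair, with a
  constant that depends on \<open>f\<close> only through its norm. This equicontinuity lets one
  finite partition serve the whole unit ball in \<open>functional_approx\<close>.\<close>

lemma dq_diff_le:
  assumes f: "f \<in> carr (Lip X E)" and mem: "x \<in> X" "x' \<in> X" "y \<in> X" "y' \<in> X"
    and \<delta>: "0 < \<delta>" "\<delta> \<le> dist x x'" "\<delta> \<le> dist y y'"
  shows "nrm E (dq E f (x, x') - dq E f (y, y')) \<le> 2 * (dist x y + dist x' y') / \<delta> * nrm (Lip X E) f"
proof -
  define d d' where "d = dist x x'" and "d' = dist y y'"
  define a a' where "a = f x - f x'" and "a' = f y - f y'"
  define N where "N = nrm (Lip X E) f"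
  have N: "N \<ge> 0" using f by (simp add: N_def)
  have pos: "d > 0" "d' > 0" "\<delta> \<le> d'" using \<delta> by (auto simp: d_def d'_def)
  have "x \<noteq> x'" "y \<noteq> y'" using \<delta> by auto
  have fX: "f x \<in> carr E" if "x \<in> X" for x
    using Lip_image[OF f] that by blast
  have a: "a \<in> carr E" "a' \<in> carr E" using mem fX by (auto simp: a_def a'_def)
  have dd: "\<bar>d' - d\<bar> \<le> dist x y + dist x' y'"
    unfolding d_def d'_def by metric
  have eq: "dq E f (x, x') - dq E f (y, y') =
      scl E (of_real (inverse d - inverse d')) a + scl E (of_real (inverse d')) (a - a')"
    using \<open>x \<noteq> x'\<close> \<open>y \<noteq> y'\<close>
    by (simp add: dq_def a_def a'_def d_def d'_def scale_left_diff_distrib scale_right_diff_distrib)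
  have n1: "nrm E (scl E (of_real (inverse d - inverse d')) a) \<le> (dist x y + dist x' y') / \<delta> * N"
  proof -
    have "nrm E (scl E (of_real (inverse d - inverse d')) a) = \<bar>inverse d - inverse d'\<bar> * nrm E a"
      using a by (simp del: of_real_diff)
    \<comment> \<open>The factor \<open>d\<close> cancels one denominator of
      \<open>inverse d - inverse d'\<close>; the other one is at least
      \<open>\<delta>\<close>.\<close>
    also have "\<dots> \<le> \<bar>inverse d - inverse d'\<bar> * (N * d)"
      unfolding N_def a_def d_def by (intro mult_left_mono Lip_diff_le f mem) auto
    also have "\<dots> = \<bar>d' - d\<bar> / d' * N"
      using pos by (simp add: inverse_diff_inverse abs_mult abs_minus_commute field_simps)
    also have "\<dots> \<le> (dist x y + dist x' y') / \<delta> * N"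
      using dd pos \<delta> N by (intro mult_right_mono frac_le) auto
    finally show ?thesis .
  qed
  have n2: "nrm E (scl E (of_real (inverse d')) (a - a')) \<le> (dist x y + dist x' y') / \<delta> * N"
  proof -
    \<comment> \<open>Regrouped by first and second entries, the change of the numerator is bounded
      by the displacement of the points.\<close>
    have "a - a' = (f x - f y) - (f x' - f y')"
      by (simp add: a_def a'_def)
    then have "nrm E (a - a') \<le> nrm E (f x - f y) + nrm E (f x' - f y')"
      using nrm_diff[of "f x - f y" "f x' - f y'"] fX mem by simp
    also have "\<dots> \<le> N * dist x y + N * dist x' y'"
      unfolding N_def by (intro add_mono Lip_diff_le f mem)
    finally have "nrm E (a - a') \<le> N * (dist x y + dist x' y')"
      by (simp add: distrib_left)
    moreover have "inverse d' \<le> inverse \<delta>"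
      using pos \<delta> by (intro le_imp_inverse_le) auto
    ultimately have "inverse d' * nrm E (a - a') \<le> inverse \<delta> * (N * (dist x y + dist x' y'))"
      using a pos \<delta> by (intro mult_mono) auto
    then show ?thesis
      using a pos by (simp add: divide_inverse mult.commute mult.left_commute norm_inverse)
  qed
  have n3: "nrm E (scl E (of_real (inverse d - inverse d')) a + scl E (of_real (inverse d')) (a - a')) \<le>
      nrm E (scl E (of_real (inverse d - inverse d')) a) + nrm E (scl E (of_real (inverse d')) (a - a'))"
    by (intro nrm_add scl_in diff_in a)
  have "nrm E (dq E f (x, x') - dq E f (y, y')) \<le> 2 * ((dist x y + dist x' y') / \<delta> * N)"
    using order_trans[OF n3 add_mono[OF n1 n2]] unfolding eq mult_2 .
  also have "\<dots> = 2 * (dist x y + dist x' y') / \<delta> * N"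
    by (simp only: times_divide_eq_left times_divide_eq_right mult.assoc)
  finally show ?thesis
    unfolding N_def .
qed

text \<open>This takes the place of a representation by a vector measure on
  \<open>X \<times> X\<close>: the cells of a finite partition act as measurable sets and
  \<open>v\<close> as the variation. The sum of the norms is bounded by \<open>r\<close> itself,
  without a constant, as is appropriate for an isometry.\<close>

lemma functional_approx:
  assumes \<phi>: "\<phi> \<in> carr lip_dual"
    and r: "0 \<le> r" "\<And>f. f \<in> carr (little_lip X E) \<Longrightarrow> norm (\<phi> f) \<le> r * nrm (Lip X E) f"
    and \<epsilon>: "\<epsilon> > 0"
  shows "\<exists>l. (\<forall>(w, b)\<in>set l. w \<in> X \<times> X \<and> b \<in> carr (dual E)) \<and> (\<Sum>(w, b)\<leftarrow>l. nrm (dual E) b) \<le> r \<and>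
    (\<forall>f\<in>carr (little_lip X E). norm (\<phi> f - (\<Sum>(w, b)\<leftarrow>l. b (dq E f w))) \<le> \<epsilon> * nrm (Lip X E) f)"
proof -
  define W where "W = X \<times> X"
  define B where "B = bounded_functions W E"
  define l where "l = little_lip X E"
  interpret B: normed_nspace B
    unfolding B_def by (rule normed_nspace_bounded_functions)
  interpret dB: normed_nspace "dual B"
    by (rule B.normed_nspace_dual)
  have nrmB: "nrm B = sup_norm W E"
    by (simp add: B_def)
  have lL: "f \<in> carr (Lip X E)" if "f \<in> carr l" for f
    using that little_lip_Lip by (simp add: l_def)
  have DB: "D f \<in> carr B" if "f \<in> carr l" for f
    using D_in[OF lL[OF that]] by (simp add: B_def W_def)
  have nrmD: "nrm B (D f) = nrm (Lip X E) f" if "f \<in> carr l" for f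
    using lL[OF that] by (simp add: nrmB nrm_Lip sup_norm_D W_def)
  have D_scl': "D (scl l c f) = scl B c (D f)" for c f
    by (simp add: D_scl B_def l_def W_def)
  have injD: "inj_on D (carr l)"
    using inj_D lL by (auto intro: inj_onI)
  \<comment> \<open>\<open>D\<close> is injective, so \<open>\<phi>\<close> can be transported to
    the range of \<open>D\<close>, from which Hahn--Banach extends it.\<close>
  define f0 where "f0 g = \<phi> (inv_into (carr l) D g)" for g
  have f0: "f0 (D f) = \<phi> f" if "f \<in> carr l" for f
    using injD that by (simp add: f0_def)
  have \<phi>': "\<phi> \<in> carr (dual l)" using \<phi> by (simp add: l_def)
  have l_add: "f + g \<in> carr l" if "f \<in> carr l" "g \<in> carr l" for f g
    using that unfolding l_def by simp
  have l_scl: "scl l c f \<in> carr l" if "f \<in> carr l" for f c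
    using that l.scl_in unfolding l_def by blast
  have "\<exists>\<psi>\<in>carr (dual B). (\<forall>x\<in>D ` carr l. \<psi> x = f0 x) \<and> (\<forall>x\<in>carr B. norm (\<psi> x) \<le> r * nrm B x)"
  proof (rule B.hahn_banach)
    show "B.subspace (D ` carr l)"
      unfolding B.subspace_def
    proof (intro conjI ballI allI)
      have "D 0 = 0" by (auto simp: D_def dq_def)
      then show "0 \<in> D ` carr l" using l.zero_in unfolding l_def by (metis image_eqI)
    next
      fix x y assume "x \<in> D ` carr l" "y \<in> D ` carr l"
      then show "x + y \<in> D ` carr l"
        using l_add by (auto simp flip: D_add)
    next
      fix c x assume "x \<in> D ` carr l"
      then show "scl B c x \<in> D ` carr l"
        using l_scl by (auto simp flip: D_scl')
    qed
    show "D ` carr l \<subseteq> carr B" using DB by blast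
    show "f0 (x + y) = f0 x + f0 y" if "x \<in> D ` carr l" "y \<in> D ` carr l" for x y
      using that l_add dual_add[OF \<phi>'] by (auto simp: f0 simp flip: D_add)
    show "f0 (scl B c x) = c * f0 x" if "x \<in> D ` carr l" for c x
      using that l_scl dual_scl[OF \<phi>'] by (auto simp: f0 simp flip: D_scl')
    show "norm (f0 x) \<le> r * nrm B x" if "x \<in> D ` carr l" for x
      using that r(2) by (auto simp: f0 nrmD) (auto simp: l_def)
  qed (rule r)
  then obtain \<psi> where \<psi>: "\<psi> \<in> carr (dual B)" and \<psi>D: "\<And>f. f \<in> carr l \<Longrightarrow> \<psi> (D f) = \<phi> f"
    and \<psi>r: "\<And>g. g \<in> carr B \<Longrightarrow> norm (\<psi> g) \<le> r * nrm B g"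
    using f0 by (metis image_eqI)
  have BI: "g \<in> carr B \<and> nrm B g \<le> C"
    if "0 \<le> C" "\<And>w. w \<in> W \<Longrightarrow> g w \<in> carr E \<and> nrm E (g w) \<le> C" "\<And>w. w \<notin> W \<Longrightarrow> g w = 0" for g C
  proof
    show "g \<in> carr B" unfolding B_def bounded_functions_simps using that by blast
    show "nrm B g \<le> C" unfolding nrmB by (rule sup_norm_least) (use that in auto)
  qed
  have BE: "g w \<in> carr E" "nrm E (g w) \<le> nrm B g" if "g \<in> carr B" for g w
  proof -
    show "g w \<in> carr E"
      using that zero_in unfolding B_def bounded_functions_simps by (metis (full_types))
    show "nrm E (g w) \<le> nrm B g"
    proof (cases "w \<in> W")
      case True
      then show ?thesis
        using that sup_norm_upper[of W E g _ w] unfolding nrmB B_def bounded_functions_simps by blast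
    next
      case False
      then show ?thesis
        using that B.nrm_nonneg[OF that] by (auto simp: B_def)
    qed
  qed
  \<comment> \<open>Multiplication by the indicator function of \<open>A\<close>. It stays within
    the space because bounded functions are subject to no continuity; this is the gain from
    extending \<open>\<phi>\<close>.\<close>
  define R where "R A g = (\<lambda>w. if w \<in> A then g w else 0 :: 'e)" for A :: "('x \<times> 'x) set" and g
  have R: "R A g \<in> carr B" "nrm B (R A g) \<le> nrm B g" if "g \<in> carr B" for A g
  proof -
    have "R A g \<in> carr B \<and> nrm B (R A g) \<le> nrm B g"
      using that BE[OF that] B.nrm_nonneg[OF that] by (intro BI) (auto simp: R_def B_def)
    then show "R A g \<in> carr B" "nrm B (R A g) \<le> nrm B g" by simp_all
  qed
  have \<psi>r_le: "norm (\<psi> (R A g)) \<le> r * nrm B g" if "g \<in> carr B" for A g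
    using order_trans[OF \<psi>r[OF R(1)] mult_left_mono[OF R(2) r(1)]] that by blast
  define \<psi>r where "\<psi>r A g = (if g \<in> carr B then \<psi> (R A g) else 0)" for A g
  have R_add: "R A (g + h) = R A g + R A h" for A g h
    by (auto simp: R_def)
  have R_scl: "R A (scl B c g) = scl B c (R A g)" for A c g
    by (auto simp: R_def B_def)
  have \<psi>r_in: "\<psi>r A \<in> carr (dual B)" for A
  proof (rule B.dualI)
    show "norm (\<psi>r A g) \<le> r * nrm B g" if "g \<in> carr B" for g
      using \<psi>r_le[OF that] that by (simp add: \<psi>r_def)
    show "\<psi>r A (scl B c g) = c * \<psi>r A g" if "g \<in> carr B" for c g
      using that B.scl_in[OF that] by (simp add: \<psi>r_def R_scl dual_scl[OF \<psi>] R)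
  qed (simp_all add: \<psi>r_def R_add dual_add[OF \<psi>] R)
  \<comment> \<open>The norm of \<open>\<psi>\<close> on functions supported in \<open>A\<close>, in
    other words the variation of a finitely additive vector measure.\<close>
  define v where "v A = nrm (dual B) (\<psi>r A)" for A
  have v_nonneg: "0 \<le> v A" for A
    unfolding v_def by (rule B.nrm_dual_nonneg[OF \<psi>r_in])
  have v_le: "v A \<le> r" for A
    unfolding v_def
  proof (rule B.nrm_dual_le[OF _ r(1)])
    show "norm (\<psi>r A g) \<le> r * nrm B g" if "g \<in> carr B" for g
      using \<psi>r_le[OF that] that by (simp add: \<psi>r_def)
  qed
  have \<psi>_R: "norm (\<psi> (R A g)) \<le> v A * nrm B g" if "g \<in> carr B" for A g
    using B.dual_bound[OF \<psi>r_in that] that by (simp add: v_def \<psi>r_def)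
  \<comment> \<open>Unit functions with disjoint supports glue to a unit function, and unimodular
    factors align the two values so that their moduli add up. This superadditivity controls both the
    mass near the diagonal and the total norm of the coefficients.\<close>
  have v_add: "v A + v A' \<le> v (A \<union> A')" if disj: "A \<inter> A' = {}" for A A'
  proof -
    have le: "norm (\<psi> (R A g)) + norm (\<psi> (R A' h)) \<le> v (A \<union> A')"
      if g: "g \<in> carr B" "nrm B g \<le> 1" and h: "h \<in> carr B" "nrm B h \<le> 1" for g h
    proof -
      obtain u u' where u: "norm u = 1" "u * \<psi> (R A g) = of_real (norm (\<psi> (R A g)))"
        and u': "norm u' = 1" "u' * \<psi> (R A' h) = of_real (norm (\<psi> (R A' h)))"
        using unimodular_exists by metis
      define k where "k = scl B u (R A g) + scl B u' (R A' h)"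
      have k: "k \<in> carr B \<and> nrm B k \<le> 1"
      proof (rule BI)
        fix w assume "w \<in> W"
        have "k w = (if w \<in> A then scl E u (g w) else if w \<in> A' then scl E u' (h w) else 0)"
          using disj by (auto simp: k_def R_def B_def)
        then show "k w \<in> carr E \<and> nrm E (k w) \<le> 1"
          using BE[OF g(1), of w] BE[OF h(1), of w] g(2) h(2) u(1) u'(1) by auto
      qed (use g h in \<open>auto simp: k_def R_def B_def\<close>)
      have "R (A \<union> A') k = k"
        by (auto simp: R_def k_def B_def)
      then have "norm (\<psi> k) \<le> v (A \<union> A') * nrm B k"
        using \<psi>_R[of k "A \<union> A'"] k by simp
      also have "\<dots> \<le> v (A \<union> A')"
        using k mult_left_mono[OF _ v_nonneg, of "nrm B k" 1 "A \<union> A'"] by simp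
      also have "\<psi> k = of_real (norm (\<psi> (R A g)) + norm (\<psi> (R A' h)))"
        using R(1)[OF g(1), of A] R(1)[OF h(1), of A'] u u'
        by (simp add: k_def dual_add[OF \<psi>] dual_scl[OF \<psi>])
      finally show ?thesis
        by (simp only: norm_of_real)
    qed
    have "v A \<le> v (A \<union> A') - norm (\<psi> (R A' h))" if h: "h \<in> carr B" "nrm B h \<le> 1" for h
      unfolding v_def[of A] using le[OF _ _ h]
      by (intro B.nrm_dual_le_unit) (simp add: \<psi>r_def le_diff_eq)
    then have "v A' \<le> v (A \<union> A') - v A"
      unfolding v_def[of A'] by (intro B.nrm_dual_le_unit) (simp add: \<psi>r_def le_diff_eq algebra_simps)
    then show ?thesis by simp
  qed
  have v_sum: "(\<Sum>i\<in>I. v (C i)) \<le> v (\<Union>i\<in>I. C i)"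
    if "finite I" "\<And>i j. i \<in> I \<Longrightarrow> j \<in> I \<Longrightarrow> i \<noteq> j \<Longrightarrow> C i \<inter> C j = {}" for I :: "('x \<times> 'x \<times> bool) set" and C
    using that
  proof (induction I)
    case empty
    then show ?case using v_nonneg by simp
  next
    case (insert i I)
    have "C i \<inter> (\<Union>j\<in>I. C j) = {}"
      using insert.prems[of i] insert.hyps by fastforce
    from v_add[OF this] insert show ?case by simp
  qed
  \<comment> \<open>The diagonal belongs to every \<open>K \<delta>\<close>: it carries the values
    of the functions, and these need not be small.\<close>
  define K where "K \<delta> = {w \<in> W. fst w = snd w \<or> \<delta> \<le> dist (fst w) (snd w)}" for \<delta>
  \<comment> \<open>A nearly optimal \<open>\<delta>\<close> for the supremum of
    \<open>v (K \<delta>)\<close>, hence one that does not depend on \<open>f\<close>. By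
    superadditivity at most \<open>\<epsilon> / 2\<close> of mass lies in \<open>K \<delta>'\<close>
    outside \<open>K \<delta>\<close>, for every \<open>\<delta>'\<close>.\<close>
  obtain \<delta> where \<delta>: "\<delta> > 0" and \<delta>v: "\<And>\<delta>'. \<delta>' > 0 \<Longrightarrow> v (K \<delta>') \<le> v (K \<delta>) + \<epsilon> / 2"
  proof -
    define S where "S = (SUP \<delta>\<in>{0<..}. v (K \<delta>))"
    have bdd: "bdd_above ((\<lambda>\<delta>. v (K \<delta>)) ` {0<..})"
      using v_le by (intro bdd_aboveI[of _ r]) auto
    have "S - \<epsilon> / 2 < S" using \<epsilon> by simp
    then obtain \<delta> where "\<delta> > 0" "S - \<epsilon> / 2 < v (K \<delta>)"
      unfolding S_def using less_cSUP_iff[OF _ bdd] by auto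
    moreover have "v (K \<delta>') \<le> S" if "\<delta>' > 0" for \<delta>'
      unfolding S_def using that by (intro cSUP_upper bdd) auto
    ultimately show ?thesis using that[of \<delta>] by fastforce
  qed
  have tail: "norm (\<phi> f - \<psi> (R (K \<delta>) (D f))) \<le> \<epsilon> / 2 * nrm (Lip X E) f" if f: "f \<in> carr l" for f
  proof (rule field_le_epsilon)
    fix e :: real assume "e > 0"
    \<comment> \<open>\<open>\<delta>'\<close> below depends on \<open>f\<close> and
      \<open>e\<close>. This is harmless: the piece between \<open>K \<delta>\<close> and
      \<open>K \<delta>'\<close> is estimated by its mass, uniformly in \<open>\<delta>'\<close>,
      and the piece outside \<open>K \<delta>'\<close> contributes at most the arbitrary
      \<open>e\<close>.\<close>
    define \<eta> where "\<eta> = e / (r + 1)"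
    have \<eta>: "\<eta> > 0" "r * \<eta> \<le> e"
      using \<open>e > 0\<close> r(1) by (auto simp: \<eta>_def field_simps)
    obtain \<delta>0 where \<delta>0: "\<delta>0 > 0"
      "\<And>x x'. x \<in> X \<Longrightarrow> x' \<in> X \<Longrightarrow> dist x x' < \<delta>0 \<Longrightarrow> nrm E (f x - f x') \<le> \<eta> * dist x x'"
      using little_lipD[OF f[unfolded l_def] \<eta>(1)] by blast
    define \<delta>' where "\<delta>' = min \<delta> \<delta>0"
    have \<delta>': "\<delta>' > 0" "\<delta>' \<le> \<delta>" "\<delta>' \<le> \<delta>0" using \<delta> \<delta>0 by (auto simp: \<delta>'_def)
    have sub: "K \<delta> \<subseteq> K \<delta>'" using \<delta>' by (auto simp: K_def)
    define g where "g = D f"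
    have g: "g \<in> carr B" "nrm B g = nrm (Lip X E) f"
      using DB nrmD f by (auto simp: g_def)
    have "g = R (K \<delta>) g + (R (K \<delta>' - K \<delta>) g + R (W - K \<delta>') g)"
      using sub g(1) by (auto simp: R_def B_def fun_eq_iff K_def)
    then have "\<psi> g = \<psi> (R (K \<delta>) g) + (\<psi> (R (K \<delta>' - K \<delta>) g) + \<psi> (R (W - K \<delta>') g))"
      by (metis B.add_in R(1) dual_add[OF \<psi>] g(1))
    moreover have "norm (\<psi> (R (K \<delta>' - K \<delta>) g)) \<le> \<epsilon> / 2 * nrm (Lip X E) f"
    proof -
      have "v (K \<delta>' - K \<delta>) \<le> \<epsilon> / 2"
        using v_add[of "K \<delta>" "K \<delta>' - K \<delta>"] \<delta>v[OF \<delta>'(1)] sub by (simp add: Un_absorb1)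
      then show ?thesis
        using \<psi>_R[OF g(1), of "K \<delta>' - K \<delta>"] B.nrm_nonneg[OF g(1)] mult_right_mono g(2)
        by (smt (verit))
    qed
    moreover have "norm (\<psi> (R (W - K \<delta>') g)) \<le> e"
    proof -
      have "R (W - K \<delta>') g \<in> carr B \<and> nrm B (R (W - K \<delta>') g) \<le> \<eta>"
      proof (rule BI)
        fix w assume "w \<in> W"
        show "R (W - K \<delta>') g w \<in> carr E \<and> nrm E (R (W - K \<delta>') g w) \<le> \<eta>"
        proof (cases "w \<in> K \<delta>'")
          case False
          then obtain x x' where w: "w = (x, x')" "x \<in> X" "x' \<in> X" "x \<noteq> x'" "dist x x' < \<delta>'"
            using \<open>w \<in> W\<close> by (cases w) (auto simp: K_def W_def)
          have "nrm E (dq E f w) = nrm E (f x - f x') / dist x x'"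
            unfolding w(1) by (rule nrm_dq_offdiag[OF Lip_image[OF lL[OF f]] w(2-4)])
          also have "\<dots> \<le> \<eta>"
            using \<delta>0(2)[of x x'] w \<delta>' by (simp add: field_simps)
          finally show ?thesis
            using BE(1)[OF g(1), of w] w \<open>w \<in> W\<close> False by (auto simp: R_def g_def D_def)
        qed (use \<eta> in \<open>simp add: R_def\<close>)
      qed (use \<eta> in \<open>auto simp: R_def\<close>)
      then show ?thesis
        using \<psi>r[of "R (W - K \<delta>') g"] \<eta>(2) r(1) mult_left_mono by (smt (verit))
    qed
    moreover have "norm (\<psi> (R (K \<delta>' - K \<delta>) g) + \<psi> (R (W - K \<delta>') g)) \<le>
        norm (\<psi> (R (K \<delta>' - K \<delta>) g)) + norm (\<psi> (R (W - K \<delta>') g))"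
      by (rule norm_triangle_ineq)
    ultimately show "norm (\<phi> f - \<psi> (R (K \<delta>) (D f))) \<le> \<epsilon> / 2 * nrm (Lip X E) f + e"
      using \<psi>D[OF f] by (simp add: g_def)
  qed
  \<comment> \<open>The oscillation allowed on a cell, relative to the norm of the function. The
    summand 1 covers \<open>r = 0\<close>.\<close>
  define \<tau> where "\<tau> = \<epsilon> / (2 * (r + 1))"
  have \<tau>: "\<tau> > 0" "r * \<tau> \<le> \<epsilon> / 2"
    using \<epsilon> r(1) by (auto simp: \<tau>_def field_simps)
  \<comment> \<open>Entries with equal labels are at most \<open>2 * \<eta>\<close> apart. Thus
    \<open>2 * \<eta> \<le> \<tau>\<close> controls the values on the diagonal, and
    \<open>2 * (2 * \<eta> + 2 * \<eta>) / \<delta> \<le> \<tau>\<close> controls the quotients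
    through \<open>dq_diff_le\<close>.\<close>
  define \<eta> where "\<eta> = min (\<tau> / 2) (\<tau> * \<delta> / 8)"
  have \<eta>: "\<eta> > 0" "2 * \<eta> \<le> \<tau>" "8 * \<eta> / \<delta> \<le> \<tau>"
    using \<tau> \<delta> by (auto simp: \<eta>_def min_def field_simps)
  obtain k where k: "finite k" "X \<subseteq> (\<Union>c\<in>k. ball c \<eta>)"
    using compact \<eta>(1) unfolding compact_eq_totally_bounded by blast
  define q where "q x = (SOME c. c \<in> k \<and> dist c x < \<eta>)" for x
  have q: "q x \<in> k" "dist (q x) x < \<eta>" if "x \<in> X" for x
  proof -
    obtain c where "c \<in> k" "x \<in> ball c \<eta>" using k(2) \<open>x \<in> X\<close> by blast
    then have "\<exists>c. c \<in> k \<and> dist c x < \<eta>" by auto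
    from someI_ex[OF this] show "q x \<in> k" "dist (q x) x < \<eta>" by (auto simp: q_def)
  qed
  \<comment> \<open>The flag separates the diagonal from its complement, since \<open>dq\<close>
    jumps there between values and quotients.\<close>
  define lab where "lab w = (q (fst w), q (snd w), fst w = snd w)" for w
  define I where "I = lab ` K \<delta>"
  have "I \<subseteq> k \<times> k \<times> UNIV"
    using q(1) by (auto simp: I_def lab_def K_def W_def)
  then have "finite I"
    by (rule finite_subset) (use k(1) in auto)
  define C where "C i = {w \<in> K \<delta>. lab w = i}" for i
  define rp where "rp i = (SOME w. w \<in> C i)" for i
  have rp: "rp i \<in> C i" if "i \<in> I" for i
    unfolding rp_def by (rule someI_ex) (use that in \<open>auto simp: I_def C_def\<close>)
  have KW: "w \<in> W" if "w \<in> K \<delta>" for w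
    using that by (simp add: K_def)
  have rpW: "rp i \<in> X \<times> X" if "i \<in> I" for i
    using rp[OF that] by (auto simp: C_def K_def W_def)
  have osc: "nrm E (dq E f w - dq E f (rp (lab w))) \<le> \<tau> * nrm (Lip X E) f"
    if f: "f \<in> carr l" and w: "w \<in> K \<delta>" for f w
  proof -
    have "lab w \<in> I" using w by (simp add: I_def)
    from rp[OF this] have r1: "rp (lab w) \<in> K \<delta>" "lab (rp (lab w)) = lab w"
      by (auto simp: C_def)
    obtain x x' y y' where xy: "w = (x, x')" "rp (lab w) = (y, y')"
      by fastforce
    have mem: "x \<in> X" "x' \<in> X" "y \<in> X" "y' \<in> X"
      using w r1(1) xy by (auto simp: K_def W_def)
    have eq: "q x = q y" "q x' = q y'" "x = x' \<longleftrightarrow> y = y'"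
      using r1(2) unfolding xy(2) unfolding xy(1) lab_def by auto
    have d: "dist x y \<le> 2 * \<eta>" "dist x' y' \<le> 2 * \<eta>"
      using q(2)[OF mem(1)] q(2)[OF mem(3)] q(2)[OF mem(2)] q(2)[OF mem(4)] eq
        dist_triangle3[of x y "q x"] dist_triangle3[of x' y' "q x'"] by auto
    have N: "nrm (Lip X E) f \<ge> 0" using lL[OF f] by simp
    show ?thesis
    proof (cases "x = x'")
      case True
      then have "nrm E (dq E f w - dq E f (rp (lab w))) = nrm E (f x - f y)"
        using eq(3) unfolding xy(2) unfolding xy(1) by (simp add: dq_def)
      also have "\<dots> \<le> nrm (Lip X E) f * dist x y"
        by (rule Lip_diff_le[OF lL[OF f] mem(1,3)])
      also have "\<dots> \<le> nrm (Lip X E) f * \<tau>"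
        using d \<eta> N by (intro mult_left_mono) auto
      finally show ?thesis by (simp add: mult.commute)
    next
      case False
      then have "\<delta> \<le> dist x x'" "\<delta> \<le> dist y y'"
        using w r1(1) eq(3) unfolding xy(2) unfolding xy(1) by (auto simp: K_def)
      then have "nrm E (dq E f w - dq E f (rp (lab w))) \<le> 2 * (dist x y + dist x' y') / \<delta> * nrm (Lip X E) f"
        unfolding xy(2) unfolding xy(1) by (rule dq_diff_le[OF lL[OF f] mem \<delta>])
      also have "\<dots> \<le> \<tau> * nrm (Lip X E) f"
      proof (intro mult_right_mono N)
        have "2 * (dist x y + dist x' y') / \<delta> \<le> 8 * \<eta> / \<delta>"
          using d \<delta> by (intro divide_right_mono) auto
        also note \<eta>(3)
        finally show "2 * (dist x y + dist x' y') / \<delta> \<le> \<tau>" .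
      qed
      finally show ?thesis .
    qed
  qed
  have CW: "C i \<subseteq> W" for i
    using KW by (auto simp: C_def)
  \<comment> \<open>The vector-valued mass of the cell \<open>C i\<close>: the effect of
    \<open>\<psi>\<close> on functions that are constant on the cell and vanish elsewhere. Its norm
    is at most \<open>v (C i)\<close>, and the cells are disjoint.\<close>
  define b where "b i e = (if e \<in> carr E then \<psi> (\<lambda>w. if w \<in> C i then e else 0) else 0)" for i e
  have cst: "(\<lambda>w. if w \<in> C i then e else 0) \<in> carr B \<and> nrm B (\<lambda>w. if w \<in> C i then e else 0) \<le> nrm E e"
    if "e \<in> carr E" for i e
    using that CW[of i] by (intro BI) (auto dest: subsetD)
  have b_le: "norm (b i e) \<le> v (C i) * nrm E e" if e: "e \<in> carr E" for i e
  proof -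
    have "R (C i) (\<lambda>w. if w \<in> C i then e else 0) = (\<lambda>w. if w \<in> C i then e else 0)"
      by (auto simp: R_def)
    then have "norm (b i e) \<le> v (C i) * nrm B (\<lambda>w. if w \<in> C i then e else 0)"
      using \<psi>_R[of "\<lambda>w. if w \<in> C i then e else 0" "C i"] cst[OF e, of i] e by (simp add: b_def)
    also have "\<dots> \<le> v (C i) * nrm E e"
      using cst[OF e, of i] v_nonneg by (intro mult_left_mono) auto
    finally show ?thesis .
  qed
  have b_in: "b i \<in> carr (dual E)" for i
  proof (rule dualI[OF _ _ b_le])
    fix e e' assume e: "e \<in> carr E" "e' \<in> carr E"
    have "(\<lambda>w. if w \<in> C i then e + e' else 0) =
        (\<lambda>w. if w \<in> C i then e else 0) + (\<lambda>w. if w \<in> C i then e' else 0)"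
      by auto
    then show "b i (e + e') = b i e + b i e'"
      using dual_add[OF \<psi>] cst[OF e(1), of i] cst[OF e(2), of i] e by (simp add: b_def)
  next
    fix c e assume e: "e \<in> carr E"
    have "(\<lambda>w. if w \<in> C i then scl E c e else 0) = scl B c (\<lambda>w. if w \<in> C i then e else 0)"
      by (auto simp: B_def)
    then show "b i (scl E c e) = c * b i e"
      using dual_scl[OF \<psi>] cst[OF e, of i] e by (simp add: b_def)
  qed (simp_all add: b_def)
  have b_nrm: "(\<Sum>i\<in>I. nrm (dual E) (b i)) \<le> r"
  proof -
    have "(\<Sum>i\<in>I. nrm (dual E) (b i)) \<le> (\<Sum>i\<in>I. v (C i))"
      by (intro sum_mono nrm_dual_le b_le v_nonneg)
    also have "\<dots> \<le> v (\<Union>i\<in>I. C i)"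
      by (rule v_sum[OF \<open>finite I\<close>]) (auto simp: C_def)
    also have "\<dots> \<le> r" by (rule v_le)
    finally show ?thesis .
  qed
  have b_sum: "(\<Sum>i\<in>J. b i (e i)) = \<psi> (\<lambda>w. if w \<in> K \<delta> \<and> lab w \<in> J then e (lab w) else 0)
      \<and> (\<lambda>w. if w \<in> K \<delta> \<and> lab w \<in> J then e (lab w) else 0) \<in> carr B"
    if "finite J" "\<And>i. i \<in> J \<Longrightarrow> e i \<in> carr E" for J and e :: "'x \<times> 'x \<times> bool \<Rightarrow> 'e"
    using that
  proof (induction J)
    case empty
    have "(\<lambda>w. if w \<in> K \<delta> \<and> lab w \<in> {} then e (lab w) else 0) = 0" by auto
    then show ?case using B.dual_0[OF \<psi>] by simp
  next
    case (insert i J)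
    let ?F = "\<lambda>w. if w \<in> K \<delta> \<and> lab w \<in> J then e (lab w) else 0"
    have eq: "(\<lambda>w. if w \<in> K \<delta> \<and> lab w \<in> insert i J then e (lab w) else 0) =
        (\<lambda>w. if w \<in> C i then e i else 0) + ?F"
      using insert.hyps by (auto simp: C_def)
    have IH: "(\<Sum>i\<in>J. b i (e i)) = \<psi> ?F" "?F \<in> carr B"
      using insert by auto
    show ?case
      unfolding eq using insert.hyps insert.prems cst[of "e i" i] IH
      by (simp add: dual_add[OF \<psi>] b_def)
  qed
  have approx: "norm (\<psi> (R (K \<delta>) (D f)) - (\<Sum>i\<in>I. b i (dq E f (rp i)))) \<le> \<epsilon> / 2 * nrm (Lip X E) f"
    if f: "f \<in> carr l" for f
  proof -
    \<comment> \<open>The step function that takes on each cell the quotient at the representative;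
      \<open>\<psi>\<close> sends it to the finite sum.\<close>
    define F where "F w = (if w \<in> K \<delta> \<and> lab w \<in> I then dq E f (rp (lab w)) else 0)" for w
    have F: "(\<Sum>i\<in>I. b i (dq E f (rp i))) = \<psi> F" "F \<in> carr B"
      using b_sum[OF \<open>finite I\<close>, of "\<lambda>i. dq E f (rp i)"] Lip_dq_in[OF lL[OF f] rpW]
      unfolding F_def by auto
    have N: "nrm (Lip X E) f \<ge> 0" using lL[OF f] by simp
    have "R (K \<delta>) (D f) - F \<in> carr B \<and> nrm B (R (K \<delta>) (D f) - F) \<le> \<tau> * nrm (Lip X E) f"
    proof (rule BI)
      fix w assume "w \<in> W"
      have "(R (K \<delta>) (D f) - F) w \<in> carr E"
        by (intro BE B.diff_in R DB f F)
      moreover have "nrm E ((R (K \<delta>) (D f) - F) w) \<le> \<tau> * nrm (Lip X E) f"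
        using osc[OF f, of w] \<open>w \<in> W\<close> N \<tau>(1)
        by (auto simp: R_def F_def D_def I_def W_def)
      ultimately show "(R (K \<delta>) (D f) - F) w \<in> carr E \<and> nrm E ((R (K \<delta>) (D f) - F) w) \<le> \<tau> * nrm (Lip X E) f" ..
    qed (use N \<tau> KW in \<open>auto simp: R_def F_def\<close>)
    then have "norm (\<psi> (R (K \<delta>) (D f) - F)) \<le> r * (\<tau> * nrm (Lip X E) f)"
      using \<psi>r[of "R (K \<delta>) (D f) - F"] r(1) mult_left_mono by (smt (verit))
    also have "\<dots> \<le> \<epsilon> / 2 * nrm (Lip X E) f"
      using mult_right_mono[OF \<tau>(2) N] by (simp only: mult.assoc)
    finally show ?thesis
      using B.dual_diff[OF \<psi> R(1)[OF DB[OF f]] F(2)] F(1) by simp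
  qed
  obtain xs where xs: "set xs = I" "distinct xs"
    using finite_distinct_list[OF \<open>finite I\<close>] by blast
  have sum_xs: "(\<Sum>p\<leftarrow>map (\<lambda>i. (rp i, b i)) xs. h p) = (\<Sum>i\<in>I. h (rp i, b i))" for h :: "_ \<Rightarrow> 's::comm_monoid_add"
    using sum_list_distinct_conv_sum_set[OF xs(2), of "\<lambda>i. h (rp i, b i)"] xs(1) by (simp add: o_def)
  show ?thesis
  proof (intro exI[of _ "map (\<lambda>i. (rp i, b i)) xs"] conjI ballI)
    show "case p of (w, b) \<Rightarrow> w \<in> X \<times> X \<and> b \<in> carr (dual E)" if "p \<in> set (map (\<lambda>i. (rp i, b i)) xs)" for p
    proof -
      from that obtain i where "i \<in> I" "p = (rp i, b i)" using xs(1) by auto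
      then show ?thesis using rpW[of i] b_in[of i] by simp
    qed
    show "(\<Sum>(w, b)\<leftarrow>map (\<lambda>i. (rp i, b i)) xs. nrm (dual E) b) \<le> r"
      unfolding sum_xs using b_nrm by simp
    fix f assume "f \<in> carr (little_lip X E)"
    then have f: "f \<in> carr l" by (simp add: l_def)
    have "\<phi> f - (\<Sum>(w, b)\<leftarrow>map (\<lambda>i. (rp i, b i)) xs. b (dq E f w)) =
        (\<phi> f - \<psi> (R (K \<delta>) (D f))) + (\<psi> (R (K \<delta>) (D f)) - (\<Sum>i\<in>I. b i (dq E f (rp i))))"
      unfolding sum_xs by simp
    then show "norm (\<phi> f - (\<Sum>(w, b)\<leftarrow>map (\<lambda>i. (rp i, b i)) xs. b (dq E f w))) \<le> \<epsilon> * nrm (Lip X E) f"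
      using tail[OF f] approx[OF f]
        norm_triangle_ineq[of "\<phi> f - \<psi> (R (K \<delta>) (D f))" "\<psi> (R (K \<delta>) (D f)) - (\<Sum>i\<in>I. b i (dq E f (rp i)))"]
      by simp
  qed
qed

end

section \<open>The restriction map\<close>

lemma geometric_sums:
  fixes h :: "nat \<Rightarrow> 'a::real_normed_vector"
  assumes "\<And>k. norm (h k) \<le> C / 4 ^ k"
  shows "summable (\<lambda>k. norm (h k))" "norm (\<Sum>k<n. h k) \<le> 2 * C"
proof -
  have "summable (\<lambda>k. C * (1 / 4) ^ k)"
    by (intro summable_mult summable_geometric) simp
  moreover have "norm (norm (h k)) \<le> C * (1 / 4) ^ k" for k
    using assms[of k] by (simp add: power_one_over)
  ultimately show "summable (\<lambda>k. norm (h k))"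
    by (rule summable_comparison_test')
  have C: "C \<ge> 0"
    using assms[of 0] norm_ge_zero[of "h 0"] by (simp del: norm_ge_zero)
  have "norm (\<Sum>k<n. h k) \<le> (\<Sum>k<n. C / 4 ^ k)"
    by (rule sum_norm_le) (rule assms)
  \<comment> \<open>The exact constant of the infinite sum is 4/3; it is rounded up to 2.\<close>
  also have "\<dots> = 4 / 3 * C - 4 / 3 * (C / 4 ^ n)"
  proof (induction n)
    case (Suc n)
    have "C / 4 ^ Suc n = C / 4 ^ n / 4" by simp
    moreover have "4 / 3 * C - 4 / 3 * t + t = 4 / 3 * C - 4 / 3 * (t / 4)" for t
      by simp
    ultimately show ?case unfolding sum.lessThan_Suc Suc.IH by metis
  qed simp
  also have "\<dots> \<le> 2 * C"
  proof -
    have "0 \<le> 4 / 3 * (C / 4 ^ n)" "4 / 3 * C \<le> 2 * C" using C by simp_all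
    then show ?thesis by linarith
  qed
  finally show "norm (\<Sum>k<n. h k) \<le> 2 * C" .
qed

text \<open>A partial sum of a null series is minus the tail. The estimate for each finite
  \<open>n\<close>, stronger than convergence, permits test functions that vary with
  \<open>n\<close>.\<close>

lemma null_sums_bound:
  fixes h :: "nat \<Rightarrow> 'a::real_normed_vector"
  assumes h: "h sums 0" and le: "\<And>k. norm (h k) \<le> C / 4 ^ k"
  shows "norm (\<Sum>k<n. h k) \<le> 2 * C / 4 ^ n"
proof -
  have "(\<lambda>k. h (k + n)) sums (0 - (\<Sum>k<n. h k))"
    by (rule sums_split_initial_segment[OF h])
  then have lim: "(\<lambda>m. \<Sum>k<m. h (k + n)) \<longlonglongrightarrow> 0 - (\<Sum>k<n. h k)"
    unfolding sums_def .
  have "norm (\<Sum>k<m. h (k + n)) \<le> 2 * (C / 4 ^ n)" for m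
    using le[of "_ + n"] by (intro geometric_sums(2)) (simp add: power_add mult.commute)
  then have "norm (0 - (\<Sum>k<n. h k)) \<le> 2 * (C / 4 ^ n)"
    by (intro Lim_norm_ubound[OF sequentially_bot lim always_eventually] allI)
  then show ?thesis by simp
qed

text \<open>Completeness is inherited from the reals through the coordinates \<open>\<rho> x\<close>
  and \<open>\<rho> (\<iota> * x)\<close>.\<close>

lemma summable_scalar_if_summable_norm:
  fixes h :: "nat \<Rightarrow> 'k::real_or_complex"
  assumes "summable (\<lambda>k. norm (h k))"
  shows "summable h"
proof -
  obtain \<rho> :: "'k \<Rightarrow> real" and \<iota> :: 'k where \<rho>: "\<And>x. \<bar>\<rho> x\<bar> \<le> norm x" "norm \<iota> \<le> 1"
    and rep: "\<And>x. x = of_real (\<rho> x) - \<iota> * of_real (\<rho> (\<iota> * x))"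
    using real_part_exists by metis
  have "norm (\<rho> (\<iota> * x)) \<le> norm x" for x
    using \<rho>(1)[of "\<iota> * x"] mult_right_mono[OF \<rho>(2), of "norm x"] by (simp add: norm_mult)
  then have "summable (\<lambda>k. \<rho> (h k))" "summable (\<lambda>k. \<rho> (\<iota> * h k))"
    using \<rho>(1) by (auto intro!: summable_comparison_test'[OF assms])
  then have "(\<lambda>k. of_real (\<rho> (h k)) - \<iota> * of_real (\<rho> (\<iota> * h k))) sums
      (of_real (\<Sum>k. \<rho> (h k)) - \<iota> * of_real (\<Sum>k. \<rho> (\<iota> * h k)))"
    by (intro sums_diff sums_mult sums_of_real summable_sums)
  then show ?thesis
    unfolding rep[symmetric] by (rule sums_summable)
qed

context lip_setting
begin

sublocale ddE: normed_nspace bidual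
  by (rule dE.normed_nspace_dual)

sublocale ddl: normed_nspace "dual lip_dual"
  by (rule dl.normed_nspace_dual)

lemma lip_setting_bidual: "lip_setting bidual X"
  using ddE.normed_nspace_axioms compact by (simp add: lip_setting_def lip_setting_axioms_def)

text \<open>Lists serve as formal sums: concatenation is addition, and one functional has many
  lists. Unlike the norm of the functional, \<open>weight\<close> is additive.\<close>

definition elems :: "(('x \<times> 'x) \<times> ('e \<Rightarrow> 'k)) list \<Rightarrow> ('x \<Rightarrow> 'e) \<Rightarrow> 'k" where
  "elems l f = (\<Sum>(w, b)\<leftarrow>l. elem w b f)"

definition admissible :: "(('x \<times> 'x) \<times> ('e \<Rightarrow> 'k)) list \<Rightarrow> bool" where
  "admissible l \<longleftrightarrow> (\<forall>(w, b)\<in>set l. w \<in> X \<times> X \<and> b \<in> carr (dual E))"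

definition weight :: "(('x \<times> 'x) \<times> ('e \<Rightarrow> 'k)) list \<Rightarrow> real" where
  "weight l = (\<Sum>(w, b)\<leftarrow>l. nrm (dual E) b)"

lemma elems_simps [simp]: "elems [] = 0" "elems ((w, b) # l) = elem w b + elems l"
    "elems (l @ l') = elems l + elems l'"
  by (auto simp: elems_def fun_eq_iff)

lemma admissible_simps [simp]: "admissible []"
    "admissible ((w, b) # l) \<longleftrightarrow> w \<in> X \<times> X \<and> b \<in> carr (dual E) \<and> admissible l"
    "admissible (l @ l') \<longleftrightarrow> admissible l \<and> admissible l'"
  by (auto simp: admissible_def)

lemma weight_simps [simp]: "weight [] = 0" "weight ((w, b) # l) = nrm (dual E) b + weight l"
    "weight (l @ l') = weight l + weight l'"
  by (auto simp: weight_def)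

lemma weight_nonneg: "admissible l \<Longrightarrow> 0 \<le> weight l"
  by (induction l) auto

lemma elems_dual: "admissible l \<Longrightarrow> elems l \<in> carr lip_dual"
  by (induction l) (auto intro!: dl.add_in elem_dual)

lemma elem_add:
  "b \<in> carr (dual E) \<Longrightarrow> b' \<in> carr (dual E) \<Longrightarrow> elem w (b + b') = elem w b + elem w b'"
  and elem_scl: "elem w (\<lambda>e. c * b e) = scl lip_dual c (elem w b)"
  by (auto simp: elem_def)

lemma elems_scl: "elems (map (\<lambda>(w, b). (w, \<lambda>e. c * b e)) l) = scl lip_dual c (elems l)"
  by (induction l) (auto simp: elem_scl fun_eq_iff distrib_left)

lemma admissible_scl: "admissible l \<Longrightarrow> admissible (map (\<lambda>(w, b). (w, \<lambda>e. c * b e)) l)"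
  using dE.scl_in[of _ c] by (induction l) auto

lemma weight_scl:
  "admissible l \<Longrightarrow> weight (map (\<lambda>(w, b). (w, \<lambda>e. c * b e)) l) = norm c * weight l"
  using dE.nrm_scl[of _ c] by (induction l) (auto simp: distrib_left)

lemma dual_elems:
  assumes "\<Phi> \<in> carr (dual lip_dual)" "admissible l"
  shows "\<Phi> (elems l) = (\<Sum>(w, b)\<leftarrow>l. \<Phi> (elem w b))"
  using assms(2)
  by (induction l) (auto simp: dl.dual_0[OF assms(1)] dual_add[OF assms(1)] elem_dual elems_dual)

lemma elems_approx:
  assumes "\<phi> \<in> carr lip_dual" "\<epsilon> > 0"
  obtains l where "admissible l" "weight l \<le> nrm lip_dual \<phi>"
    "nrm lip_dual (\<phi> - elems l) \<le> \<epsilon>"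
proof -
  have "\<And>f. f \<in> carr (little_lip X E) \<Longrightarrow> norm (\<phi> f) \<le> nrm lip_dual \<phi> * nrm (Lip X E) f"
    using l.dual_bound[OF assms(1)] by simp
  from functional_approx[OF assms(1) dl.nrm_nonneg[OF assms(1)] this assms(2)]
  obtain l where l: "admissible l" "weight l \<le> nrm lip_dual \<phi>"
    and le: "\<And>f. f \<in> carr (little_lip X E) \<Longrightarrow>
      norm (\<phi> f - (\<Sum>(w, b)\<leftarrow>l. b (dq E f w))) \<le> \<epsilon> * nrm (Lip X E) f"
    unfolding admissible_def weight_def by blast
  have "elems l f = (\<Sum>(w, b)\<leftarrow>l. b (dq E f w))" if "f \<in> carr (little_lip X E)" for f
    using that by (simp add: elems_def elem_def)
  then have "nrm lip_dual (\<phi> - elems l) \<le> \<epsilon>"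
    using le assms(2) by (intro l.nrm_dual_le) auto
  with l that show ?thesis by blast
qed

definition restriction :: "((('x \<Rightarrow> 'e) \<Rightarrow> 'k) \<Rightarrow> 'k) \<Rightarrow> 'x \<Rightarrow> ('e \<Rightarrow> 'k) \<Rightarrow> 'k" where
  "restriction \<Phi> = (\<lambda>x b. if x \<in> X \<and> b \<in> carr (dual E) then \<Phi> (elem (x, x) b) else 0)"

text \<open>Off the diagonal \<open>elem w b\<close> is a multiple of a difference of evaluations.
  Hence the Lipschitz norm of \<open>restriction \<Phi>\<close> takes account of
  \<open>\<Phi>\<close> on all elementary functionals.\<close>

lemma dq_restriction:
  assumes \<Phi>: "\<Phi> \<in> carr (dual lip_dual)" and w: "w \<in> X \<times> X" and b: "b \<in> carr (dual E)"
  shows "dq bidual (restriction \<Phi>) w b = \<Phi> (elem w b)"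
proof (cases "fst w = snd w")
  case True
  then have "w = (fst w, fst w)" by (simp add: prod_eq_iff)
  then show ?thesis
    using True w b by (auto simp: dq_def restriction_def)
next
  case False
  obtain x x' where x: "w = (x, x')" "x \<in> X" "x' \<in> X" using w by blast
  define c where "c = (of_real (inverse (dist x x')) :: 'k)"
  have e: "elem (y, y) b \<in> carr lip_dual" if "y \<in> X" for y
    using elem_dual[of "(y, y)"] that b by simp
  have "elem w b = scl lip_dual c (elem (x, x) b - elem (x', x') b)"
  proof
    fix f
    show "elem w b f = scl lip_dual c (elem (x, x) b - elem (x', x') b) f"
    proof (cases "f \<in> carr (little_lip X E)")
      case True
      then have "f x \<in> carr E" "f x' \<in> carr E"
        using Lip_image[OF little_lip_Lip[OF True]] x by auto
      then show ?thesis
        using True False x dual_scl[OF b, of "f x - f x'" c] dual_diff[OF b, of "f x" "f x'"]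
        by (simp add: elem_def dq_def c_def)
    qed (simp add: elem_def)
  qed
  then have "\<Phi> (elem w b) = c * (\<Phi> (elem (x, x) b) - \<Phi> (elem (x', x') b))"
    using dual_scl[OF \<Phi> dl.diff_in[OF e[OF x(2)] e[OF x(3)]], of c] dl.dual_diff[OF \<Phi> e[OF x(2)] e[OF x(3)]]
    by (simp del: scl_dual)
  then show ?thesis
    using False x b by (simp add: dq_def restriction_def c_def)
qed

text \<open>The norm of \<open>restriction \<Phi>\<close> is the supremum of \<open>\<Phi>\<close>
  over the functionals \<open>elem w b\<close> with \<open>b\<close> in the unit ball, hence at most
  the norm of \<open>\<Phi>\<close>. Equality holds because each functional is a norm limit of lists
  whose weight does not exceed its norm.\<close>

lemma
  assumes \<Phi>: "\<Phi> \<in> carr (dual lip_dual)"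
  shows restriction_in: "restriction \<Phi> \<in> carr (Lip X bidual)"
    and nrm_restriction: "nrm (Lip X bidual) (restriction \<Phi>) = nrm (dual lip_dual) \<Phi>"
proof -
  interpret dd: lip_setting bidual X by (rule lip_setting_bidual)
  let ?N = "nrm (dual lip_dual) \<Phi>"
  have le: "norm (\<Phi> (elem w b)) \<le> ?N * nrm (dual E) b" if "w \<in> X \<times> X" "b \<in> carr (dual E)" for w b
    using dl.dual_bound[OF \<Phi> elem_dual[OF that]] nrm_elem[OF that] ddl.nrm_nonneg[OF \<Phi>]
    by (meson mult_left_mono order_trans)
  have im: "restriction \<Phi> ` X \<subseteq> carr bidual"
  proof clarify
    fix x assume x: "x \<in> X"
    then have xx: "(x, x) \<in> X \<times> X" by simp
    show "restriction \<Phi> x \<in> carr bidual"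
    proof (rule dE.dualI)
      show "norm (restriction \<Phi> x b) \<le> ?N * nrm (dual E) b" if "b \<in> carr (dual E)" for b
        using le[OF xx that] x that by (simp add: restriction_def)
      show "restriction \<Phi> x (b + b') = restriction \<Phi> x b + restriction \<Phi> x b'"
        if "b \<in> carr (dual E)" "b' \<in> carr (dual E)" for b b'
        using that x dE.add_in[OF that] dual_add[OF \<Phi> elem_dual[OF xx that(1)] elem_dual[OF xx that(2)]]
        by (simp add: restriction_def elem_add)
      show "restriction \<Phi> x (scl (dual E) c b) = c * restriction \<Phi> x b" if "b \<in> carr (dual E)" for c b
        using that x dE.scl_in[OF that, of c] dual_scl[OF \<Phi> elem_dual[OF xx that], of c]
        by (simp add: restriction_def elem_scl)
    qed (simp add: restriction_def)
  qed
  have dq_le: "nrm bidual (dq bidual (restriction \<Phi>) w) \<le> ?N" if w: "w \<in> X \<times> X" for w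
    using le[OF w] ddl.nrm_nonneg[OF \<Phi>] by (intro dE.nrm_dual_le) (auto simp: dq_restriction[OF \<Phi> w])
  show *: "restriction \<Phi> \<in> carr (Lip X bidual)"
    by (rule dd.LipI[OF im _ dq_le]) (auto simp: restriction_def fun_eq_iff)
  let ?M = "nrm (Lip X bidual) (restriction \<Phi>)"
  have M: "0 \<le> ?M" by (rule dd.L.nrm_nonneg[OF *])
  have sum_le: "norm (\<Sum>(w, b)\<leftarrow>l. \<Phi> (elem w b)) \<le> ?M * weight l" if "admissible l" for l
    using that
  proof (induction l)
    case (Cons p l)
    obtain w b where p: "p = (w, b)" by (cases p)
    then have wb: "w \<in> X \<times> X" "b \<in> carr (dual E)" and l: "admissible l"
      using Cons.prems by auto
    have "norm (\<Phi> (elem w b)) \<le> nrm bidual (dq bidual (restriction \<Phi>) w) * nrm (dual E) b"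
      using dE.dual_bound[OF dd.Lip_dq_in[OF * wb(1)] wb(2)] dq_restriction[OF \<Phi> wb] by simp
    also have "\<dots> \<le> ?M * nrm (dual E) b"
      using dd.nrm_dq_le[OF * wb(1)] wb by (intro mult_right_mono) auto
    finally show ?case
      using Cons.IH[OF l] norm_triangle_ineq[of "\<Phi> (elem w b)" "\<Sum>(w, b)\<leftarrow>l. \<Phi> (elem w b)"]
      by (simp add: p distrib_left)
  qed simp
  have "norm (\<Phi> \<phi>) \<le> ?M * nrm lip_dual \<phi>" if \<phi>: "\<phi> \<in> carr lip_dual" for \<phi>
  proof (rule field_le_epsilon)
    fix e :: real assume "e > 0"
    define \<epsilon> where "\<epsilon> = e / (?N + 1)"
    have N: "0 \<le> ?N" using ddl.nrm_nonneg[OF \<Phi>] .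
    then have \<epsilon>: "\<epsilon> > 0" "?N * \<epsilon> \<le> e"
      using \<open>e > 0\<close> by (auto simp: \<epsilon>_def field_simps)
    obtain l where l: "admissible l" "weight l \<le> nrm lip_dual \<phi>"
      "nrm lip_dual (\<phi> - elems l) \<le> \<epsilon>"
      using elems_approx[OF \<phi> \<epsilon>(1)] .
    have "\<Phi> \<phi> = \<Phi> (elems l) + \<Phi> (\<phi> - elems l)"
      using dl.dual_diff[OF \<Phi> \<phi> elems_dual[OF l(1)]] by simp
    then have "norm (\<Phi> \<phi>) \<le> norm (\<Phi> (elems l)) + norm (\<Phi> (\<phi> - elems l))"
      by (simp add: norm_triangle_ineq)
    also have "norm (\<Phi> (elems l)) \<le> ?M * nrm lip_dual \<phi>"
      using sum_le[OF l(1)] dual_elems[OF \<Phi> l(1)] mult_left_mono[OF l(2) M] by simp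
    also have "norm (\<Phi> (\<phi> - elems l)) \<le> e"
      using dl.dual_bound[OF \<Phi> dl.diff_in[OF \<phi> elems_dual[OF l(1)]]] mult_left_mono[OF l(3) N] \<epsilon>(2)
      by linarith
    finally show "norm (\<Phi> \<phi>) \<le> ?M * nrm lip_dual \<phi> + e"
      by simp
  qed
  then have "?N \<le> ?M"
    using M by (rule dl.nrm_dual_le)
  moreover have "?M \<le> ?N"
    using dd.nrm_Lip_le[OF * dq_le ddl.nrm_nonneg[OF \<Phi>]] .
  ultimately show "?M = ?N" by simp
qed

lemma restriction_add: "restriction (\<Phi> + \<Psi>) = restriction \<Phi> + restriction \<Psi>"
  and restriction_scl: "restriction (\<lambda>\<phi>. c * \<Phi> \<phi>) = (\<lambda>x b. c * restriction \<Phi> x b)"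
  by (auto simp: restriction_def fun_eq_iff)

lemma restriction_inj:
  assumes "\<Phi> \<in> carr (dual lip_dual)" "\<Psi> \<in> carr (dual lip_dual)"
    "restriction \<Phi> = restriction \<Psi>"
  shows "\<Phi> = \<Psi>"
proof -
  interpret dd: lip_setting bidual X by (rule lip_setting_bidual)
  have "\<Phi> (elem (x, x) b) = \<Psi> (elem (x, x) b)" if "x \<in> X" "b \<in> carr (dual E)" for x b
    using fun_cong[OF fun_cong[OF assms(3), of x], of b] that by (simp add: restriction_def)
  then have "restriction (\<Phi> - \<Psi>) = 0"
    by (auto simp: restriction_def fun_eq_iff)
  then have "nrm (dual lip_dual) (\<Phi> - \<Psi>) = 0"
    using nrm_restriction[OF ddl.diff_in[OF assms(1,2)]] by simp
  then show ?thesis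
    using ddl.nrm_eq_0[OF ddl.diff_in[OF assms(1,2)]] by simp
qed

section \<open>Representation of functionals by series\<close>

definition geometric :: "real \<Rightarrow> (nat \<Rightarrow> (('x \<times> 'x) \<times> ('e \<Rightarrow> 'k)) list) \<Rightarrow> bool" where
  "geometric C z \<longleftrightarrow> (\<forall>k. admissible (z k) \<and> weight (z k) \<le> C / 4 ^ k)"

text \<open>For a series as in \<open>geometric\<close>, pointwise convergence amounts to
  convergence in norm.\<close>

definition represents ::
  "(nat \<Rightarrow> (('x \<times> 'x) \<times> ('e \<Rightarrow> 'k)) list) \<Rightarrow> (('x \<Rightarrow> 'e) \<Rightarrow> 'k) \<Rightarrow> bool" where
  "represents z \<phi> \<longleftrightarrow> (\<forall>f. (\<lambda>k. elems (z k) f) sums \<phi> f)"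

text \<open>Successive approximation: each remainder is approximated, up to a quarter of its norm,
  by a list whose weight is at most that norm.\<close>

lemma geometric_representation:
  assumes \<phi>: "\<phi> \<in> carr lip_dual"
  shows "\<exists>z. geometric (nrm lip_dual \<phi>) z \<and> represents z \<phi>"
proof -
  let ?n = "nrm lip_dual"
  have "\<exists>l. admissible l \<and> weight l \<le> ?n \<phi> \<and> ?n (\<phi> - elems l) \<le> ?n \<phi> / 4"
    if \<phi>: "\<phi> \<in> carr lip_dual" for \<phi>
  \<comment> \<open>\<open>elems_approx\<close> asks for a positive error; for norm 0 the empty list
    is exact.\<close>
  proof (cases "?n \<phi> = 0")
    case True
    then show ?thesis by (intro exI[of _ "[]"]) simp
  next
    case False
    then have "?n \<phi> / 4 > 0"
      using dl.nrm_nonneg[OF \<phi>] by linarith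
    then show ?thesis using elems_approx[OF \<phi>] by metis
  qed
  then obtain A where A: "\<And>\<phi>. \<phi> \<in> carr lip_dual \<Longrightarrow>
      admissible (A \<phi>) \<and> weight (A \<phi>) \<le> ?n \<phi> \<and> ?n (\<phi> - elems (A \<phi>)) \<le> ?n \<phi> / 4"
    by metis
  \<comment> \<open>The remainder after \<open>k\<close> steps.\<close>
  define \<Phi> where "\<Phi> k = ((\<lambda>\<phi>. \<phi> - elems (A \<phi>)) ^^ k) \<phi>" for k
  have \<Phi>_simps: "\<Phi> 0 = \<phi>" "\<Phi> (Suc k) = \<Phi> k - elems (A (\<Phi> k))" for k
    by (simp_all add: \<Phi>_def)
  have \<Phi>: "\<Phi> k \<in> carr lip_dual \<and> ?n (\<Phi> k) \<le> ?n \<phi> / 4 ^ k" for k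
  proof (induction k)
    case (Suc k)
    then have "\<Phi> (Suc k) \<in> carr lip_dual" "?n (\<Phi> (Suc k)) \<le> ?n (\<Phi> k) / 4"
      using A[of "\<Phi> k"] elems_dual by (auto simp: \<Phi>_simps)
    moreover have "?n (\<Phi> k) / 4 \<le> ?n \<phi> / 4 ^ Suc k"
      using Suc by simp
    ultimately show ?case by linarith
  qed (simp add: \<Phi>_simps \<phi>)
  have "geometric (?n \<phi>) (\<lambda>k. A (\<Phi> k))"
    unfolding geometric_def using A \<Phi> order_trans by blast
  moreover have "represents (\<lambda>k. A (\<Phi> k)) \<phi>"
    unfolding represents_def
  proof
    fix f
    have part: "(\<Sum>k<n. elems (A (\<Phi> k)) f) = \<phi> f - \<Phi> n f" for n
      by (induction n) (auto simp: \<Phi>_simps)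
    have "(\<lambda>n. \<Phi> n f) \<longlonglongrightarrow> 0"
    proof (cases "f \<in> carr (little_lip X E)")
      case True
      have le: "norm (\<Phi> n f) \<le> (?n \<phi> * nrm (Lip X E) f) * (1 / 4) ^ n" for n
      proof -
        have "norm (\<Phi> n f) \<le> ?n (\<Phi> n) * nrm (Lip X E) f"
          using l.dual_bound[of "\<Phi> n" f] \<Phi> True by simp
        also have "\<dots> \<le> ?n \<phi> / 4 ^ n * nrm (Lip X E) f"
          using \<Phi>[of n] l.nrm_nonneg[OF True] by (intro mult_right_mono) auto
        finally show ?thesis by (simp add: power_one_over field_simps)
      qed
      have "(\<lambda>n. (?n \<phi> * nrm (Lip X E) f) * (1 / 4) ^ n) \<longlonglongrightarrow> 0"
        by (intro tendsto_mult_right_zero LIMSEQ_power_zero) simp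
      then show ?thesis
        by (rule Lim_null_comparison[OF always_eventually, rotated]) (use le in blast)
    next
      case False
      then have "\<Phi> n f = 0" for n
        using \<Phi>[of n] dual_outside by blast
      then show ?thesis by simp
    qed
    then have "(\<lambda>n. \<phi> f - \<Phi> n f) \<longlonglongrightarrow> \<phi> f - 0"
      by (intro tendsto_intros)
    then show "(\<lambda>k. elems (A (\<Phi> k)) f) sums \<phi> f"
      unfolding sums_def part by simp
  qed
  ultimately show ?thesis by blast
qed

text \<open>The value that the functional sought should take at \<open>elems l\<close>. It is
  defined on lists because independence of the representation is still open.\<close>

definition pairing :: "('x \<Rightarrow> ('e \<Rightarrow> 'k) \<Rightarrow> 'k) \<Rightarrow> (('x \<times> 'x) \<times> ('e \<Rightarrow> 'k)) list \<Rightarrow> 'k" where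
  "pairing F l = (\<Sum>(w, b)\<leftarrow>l. dq bidual F w b)"

lemma pairing_simps [simp]: "pairing F [] = 0"
    "pairing F ((w, b) # l) = dq bidual F w b + pairing F l"
    "pairing F (l @ l') = pairing F l + pairing F l'"
  by (auto simp: pairing_def)

lemma pairing_bound:
  assumes F: "F \<in> carr (Lip X bidual)" and l: "admissible l"
  shows "norm (pairing F l) \<le> nrm (Lip X bidual) F * weight l"
  using l
proof (induction l)
  case (Cons p l)
  interpret dd: lip_setting bidual X by (rule lip_setting_bidual)
  obtain w b where p: "p = (w, b)" by (cases p)
  then have wb: "w \<in> X \<times> X" "b \<in> carr (dual E)" and l: "admissible l"
    using Cons.prems by auto
  have "norm (dq bidual F w b) \<le> nrm bidual (dq bidual F w) * nrm (dual E) b"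
    using dE.dual_bound[OF dd.Lip_dq_in[OF F wb(1)] wb(2)] by simp
  also have "\<dots> \<le> nrm (Lip X bidual) F * nrm (dual E) b"
    using dd.nrm_dq_le[OF F wb(1)] wb by (intro mult_right_mono) auto
  finally show ?case
    using Cons.IH[OF l] norm_triangle_ineq[of "dq bidual F w b" "pairing F l"]
    by (simp add: p distrib_left)
qed simp

lemma pairing_scl:
  assumes F: "F \<in> carr (Lip X bidual)" and l: "admissible l"
  shows "pairing F (map (\<lambda>(w, b). (w, \<lambda>e. c * b e)) l) = c * pairing F l"
  using l
proof (induction l)
  case (Cons p l)
  interpret dd: lip_setting bidual X by (rule lip_setting_bidual)
  obtain w b where p: "p = (w, b)" by (cases p)
  then have wb: "w \<in> X \<times> X" "b \<in> carr (dual E)"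
    using Cons.prems by auto
  show ?case
    using Cons dual_scl[OF dd.Lip_dq_in[OF F wb(1)] wb(2), of c] by (simp add: p distrib_left)
qed simp

text \<open>The functional is the sum of \<open>pairing F\<close> along any geometric
  representation; \<open>null\<close> says that the choice does not matter. A crude bound is enough
  to place it in the bidual, as \<open>nrm_restriction\<close> gives the exact norm.\<close>

theorem restriction_surj:
  assumes F: "F \<in> carr (Lip X bidual)"
    and null: "\<And>C z. geometric C z \<Longrightarrow> represents z 0 \<Longrightarrow> (\<lambda>k. pairing F (z k)) sums 0"
  shows "\<exists>\<Phi>\<in>carr (dual lip_dual). restriction \<Phi> = F"
proof -
  interpret dd: lip_setting bidual X by (rule lip_setting_bidual)
  let ?N = "nrm (Lip X bidual) F"
  have N: "0 \<le> ?N" by (rule dd.L.nrm_nonneg[OF F])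
  \<comment> \<open>A relation until uniqueness is established. It is linear because representations
    can be concatenated term by term and scaled.\<close>
  define rel where "rel \<phi> s \<longleftrightarrow> (\<exists>C z. geometric C z \<and> represents z \<phi> \<and> (\<lambda>k. pairing F (z k)) sums s)"
    for \<phi> s
  have bound: "norm (pairing F (z k)) \<le> (?N * C) / 4 ^ k" if "geometric C z" for C z k
  proof -
    have "norm (pairing F (z k)) \<le> ?N * weight (z k)"
      using that by (intro pairing_bound F) (simp add: geometric_def)
    also have "\<dots> \<le> ?N * (C / 4 ^ k)"
      using that N by (intro mult_left_mono) (auto simp: geometric_def)
    finally show ?thesis by simp
  qed
  have ex: "\<exists>s. rel \<phi> s \<and> norm s \<le> 2 * ?N * nrm lip_dual \<phi>"
    if \<phi>: "\<phi> \<in> carr lip_dual" for \<phi>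
  proof -
    obtain z where z: "geometric (nrm lip_dual \<phi>) z" "represents z \<phi>"
      using geometric_representation[OF \<phi>] by blast
    define h where "h k = pairing F (z k)" for k
    have h: "norm (h k) \<le> (?N * nrm lip_dual \<phi>) / 4 ^ k" for k
      unfolding h_def by (rule bound[OF z(1)])
    have sm: "summable h"
      by (rule summable_scalar_if_summable_norm[OF geometric_sums(1)[of h, OF h]])
    have "norm (suminf h) \<le> 2 * (?N * nrm lip_dual \<phi>)"
      by (intro Lim_norm_ubound[OF sequentially_bot summable_LIMSEQ[OF sm] always_eventually] allI
          geometric_sums(2)[of h, OF h])
    moreover have "rel \<phi> (suminf h)"
      unfolding rel_def using z summable_sums[OF sm] unfolding h_def by blast
    ultimately show ?thesis by (metis mult.assoc)
  qed
  have add: "rel (\<phi> + \<phi>') (s + s')" if rels: "rel \<phi> s" "rel \<phi>' s'" for \<phi> \<phi>' s s'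
  proof -
    obtain C z C' z' where "geometric C z" "represents z \<phi>" "(\<lambda>k. pairing F (z k)) sums s"
      "geometric C' z'" "represents z' \<phi>'" "(\<lambda>k. pairing F (z' k)) sums s'"
      using rels unfolding rel_def by blast
    then show ?thesis
      unfolding rel_def
      by (intro exI[of _ "C + C'"] exI[of _ "\<lambda>k. z k @ z' k"])
        (auto simp: geometric_def represents_def add_divide_distrib intro!: sums_add add_mono)
  qed
  have scl: "rel (scl lip_dual c \<phi>) (c * s)" if rel: "rel \<phi> s" for \<phi> c s
  proof -
    obtain C z where z: "geometric C z" "represents z \<phi>" "(\<lambda>k. pairing F (z k)) sums s"
      using rel unfolding rel_def by blast
    then have ad: "admissible (z k)" for k
      by (simp add: geometric_def)
    let ?z = "\<lambda>k. map (\<lambda>(w, b). (w, \<lambda>e. c * b e)) (z k)"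
    have "geometric (norm c * C) ?z"
      using z(1) by (auto simp: geometric_def admissible_scl weight_scl intro!: mult_left_mono
          simp flip: times_divide_eq_right)
    moreover have "represents ?z (scl lip_dual c \<phi>)"
      using z(2) by (auto simp: represents_def elems_scl intro!: sums_mult)
    moreover have "(\<lambda>k. pairing F (?z k)) sums (c * s)"
      using z(3) by (simp add: pairing_scl[OF F ad] sums_mult)
    ultimately show ?thesis unfolding rel_def by blast
  qed
  \<comment> \<open>The difference of two representations of \<open>\<phi>\<close> represents
    0.\<close>
  have uniq: "s = s'" if "rel \<phi> s" "rel \<phi> s'" for \<phi> s s'
  proof -
    have "rel (\<phi> + scl lip_dual (- 1) \<phi>) (s + (- 1) * s')"
      by (intro add scl that)
    moreover have "\<phi> + scl lip_dual (- 1) \<phi> = 0"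
      by (simp add: fun_eq_iff)
    ultimately have "rel 0 (s - s')" by simp
    then obtain C z where "geometric C z" "represents z 0" "(\<lambda>k. pairing F (z k)) sums (s - s')"
      unfolding rel_def by blast
    with null[of C z] show ?thesis
      using sums_unique2 by fastforce
  qed
  define \<Phi> where "\<Phi> \<phi> = (if \<phi> \<in> carr lip_dual then THE s. rel \<phi> s else 0)" for \<phi>
  have \<Phi>_eq: "\<Phi> \<phi> = s" if "rel \<phi> s" "\<phi> \<in> carr lip_dual" for \<phi> s
    using uniq that by (auto simp: \<Phi>_def)
  have \<Phi>_rel: "rel \<phi> (\<Phi> \<phi>)" if "\<phi> \<in> carr lip_dual" for \<phi>
    using ex[OF that] \<Phi>_eq that by blast
  have \<Phi>_in: "\<Phi> \<in> carr (dual lip_dual)"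
  proof (rule dl.dualI)
    show "\<Phi> (\<phi> + \<phi>') = \<Phi> \<phi> + \<Phi> \<phi>'"
      if "\<phi> \<in> carr lip_dual" "\<phi>' \<in> carr lip_dual" for \<phi> \<phi>'
      by (intro \<Phi>_eq add \<Phi>_rel dl.add_in that)
    show "\<Phi> (scl lip_dual c \<phi>) = c * \<Phi> \<phi>" if "\<phi> \<in> carr lip_dual" for c \<phi>
      by (intro \<Phi>_eq scl \<Phi>_rel dl.scl_in that)
    show "norm (\<Phi> \<phi>) \<le> 2 * ?N * nrm lip_dual \<phi>"
      if "\<phi> \<in> carr lip_dual" for \<phi>
      using ex[OF that] \<Phi>_eq that by blast
  qed (simp add: \<Phi>_def)
  have \<Phi>_elem: "\<Phi> (elem w b) = dq bidual F w b" if wb: "w \<in> X \<times> X" "b \<in> carr (dual E)" for w b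
  proof (rule \<Phi>_eq[OF _ elem_dual[OF wb]])
    let ?z = "\<lambda>k :: nat. if k = 0 then [(w, b)] else []"
    have "geometric (nrm (dual E) b) ?z"
      using wb by (auto simp: geometric_def)
    moreover have "represents ?z (elem w b)"
      unfolding represents_def
    proof
      fix f
      show "(\<lambda>k. elems (?z k) f) sums elem w b f"
        using sums_finite[of "{0 :: nat}" "\<lambda>k. elems (?z k) f"] by simp
    qed
    moreover have "(\<lambda>k. pairing F (?z k)) sums dq bidual F w b"
      using sums_finite[of "{0 :: nat}" "\<lambda>k. pairing F (?z k)"] by simp
    ultimately show "rel (elem w b) (dq bidual F w b)"
      unfolding rel_def by blast
  qed
  have "restriction \<Phi> = F"
  proof (intro ext)
    fix x b
    show "restriction \<Phi> x b = F x b"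
    proof (cases "x \<in> X")
      case True
      then have "F x \<in> carr bidual"
        using dd.Lip_image[OF F] by blast
      then show ?thesis
        using True \<Phi>_elem[of "(x, x)" b] dual_outside[of "F x" "dual E" b]
        by (auto simp: restriction_def dq_def)
    next
      case False
      then show ?thesis
        using dd.Lip_outside[OF F False] by (simp add: restriction_def)
    qed
  qed
  with \<Phi>_in show ?thesis by blast
qed

end

section \<open>Trace duality\<close>

context normed_nspace
begin

lemma dual_sum_list:
  assumes "\<phi> \<in> carr (dual V)" "\<And>p. p \<in> set l \<Longrightarrow> x p \<in> carr V"
  shows "\<phi> (\<Sum>p\<leftarrow>l. x p) = (\<Sum>p\<leftarrow>l. \<phi> (x p)) \<and> (\<Sum>p\<leftarrow>l. x p) \<in> carr V"
  using assms(2) by (induction l) (auto simp: dual_0[OF assms(1)] dual_add[OF assms(1)])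

text \<open>
  Coordinates on a finite-dimensional space of functionals are given by evaluation at finitely
  many vectors, which makes them automatically bounded.
\<close>

lemma span_evaluation:
  assumes "finite S" "S \<subseteq> carr (dual V)"
  shows "\<exists>l. (\<forall>(v, \<alpha>)\<in>set l. v \<in> carr V \<and> \<alpha> \<in> module.span (scl (dual V)) S) \<and>
    (\<forall>m\<in>module.span (scl (dual V)) S. \<forall>x. m x = (\<Sum>(v, \<alpha>)\<leftarrow>l. m v * \<alpha> x))"
  using assms
proof (induction S)
  interpret D: normed_nspace "dual V" by (rule normed_nspace_dual)
  case empty
  show ?case using D.span_empty by (intro exI[of _ "[]"]) (simp del: scl_dual)
next
  interpret D: normed_nspace "dual V" by (rule normed_nspace_dual)
  note scl_dual [simp del]
  case (insert s S)
  then obtain l where l: "\<And>v \<alpha>. (v, \<alpha>) \<in> set l \<Longrightarrow> v \<in> carr V \<and> \<alpha> \<in> D.span S"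
    and rep: "\<And>m x. m \<in> D.span S \<Longrightarrow> m x = (\<Sum>(v, \<alpha>)\<leftarrow>l. m v * \<alpha> x)"
    by blast
  \<comment> \<open>The induction hypothesis as an operator: \<open>P\<close> maps every functional
    into the span of \<open>S\<close> and fixes that span.\<close>
  define P where "P m = (\<lambda>x. \<Sum>(v, \<alpha>)\<leftarrow>l. m v * \<alpha> x)" for m :: "'v \<Rightarrow> 'k"
  have P_diff: "P (m - m') = P m - P m'" for m m'
    unfolding P_def by (rule ext, induction l) (auto simp: scl_dual algebra_simps)
  have P_scl: "P (scl (dual V) c m) = scl (dual V) c (P m)" for m c
    unfolding P_def by (rule ext, induction l) (auto simp: scl_dual algebra_simps)
  have P_in: "P m \<in> D.span S" for m
  proof -
    have "(\<lambda>x. \<Sum>(v, \<alpha>)\<leftarrow>l'. m v * \<alpha> x) \<in> D.span S"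
      if "\<And>v \<alpha>. (v, \<alpha>) \<in> set l' \<Longrightarrow> \<alpha> \<in> D.span S" for l'
      using that
    proof (induction l')
      case Nil
      then show ?case using D.span_zero[of S] by (simp add: zero_fun_def)
    next
      case (Cons p l')
      obtain v \<alpha> where p: "p = (v, \<alpha>)" by (cases p)
      have "scl (dual V) (m v) \<alpha> + (\<lambda>x. \<Sum>(v, \<alpha>)\<leftarrow>l'. m v * \<alpha> x) \<in> D.span S"
        using Cons p by (intro D.span_add D.span_scale) auto
      moreover have "scl (dual V) (m v) \<alpha> + (\<lambda>x. \<Sum>(v, \<alpha>)\<leftarrow>l'. m v * \<alpha> x) =
          (\<lambda>x. \<Sum>(v, \<alpha>)\<leftarrow>p # l'. m v * \<alpha> x)"
        by (simp add: p fun_eq_iff scl_dual)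
      ultimately show ?case by metis
    qed
    then show ?thesis unfolding P_def using l by blast
  qed
  have Pm: "P m = m" if "m \<in> D.span S" for m
    by (rule ext) (simp only: P_def rep[OF that, symmetric])
  define s' where "s' = s - P s"
  have sub: "D.span S \<subseteq> D.span (insert s S)"
    by (intro D.span_mono) blast
  have s'_span: "s' \<in> D.span (insert s S)"
    unfolding s'_def using P_in[of s] sub D.span_base[of s "insert s S"] by (intro D.span_diff) auto
  have span_carr: "m \<in> carr (dual V)" if "m \<in> D.span (insert s S)" for m
    using that insert.prems D.span_minimal[OF _ D.subspace_carr] by blast
  show ?case
  proof (cases "s' = 0")
    case True
    then have "s \<in> D.span S" using P_in[of s] by (simp add: s'_def)
    then have "D.span (insert s S) = D.span S" by (rule D.span_redundant)
    then show ?thesis using insert.IH insert.prems by simp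
  next
    case False
    then obtain v where v: "s' v \<noteq> 0" by (auto simp: fun_eq_iff)
    then have vV: "v \<in> carr V"
      using dual_outside[OF span_carr[OF s'_span]] by blast
    \<comment> \<open>The correction makes all functionals in the span of \<open>S\<close> vanish at
      \<open>v'\<close>, whereas \<open>s\<close> takes there the value \<open>s' v\<close>.
      Evaluation at \<open>v'\<close> thus reads off the coordinate along \<open>s'\<close>.\<close>
    define v' where "v' = v - (\<Sum>p\<leftarrow>l. scl V (snd p v) (fst p))"
    have fst_l: "scl V (snd p v) (fst p) \<in> carr V" if "p \<in> set l" for p
      using l[of "fst p" "snd p"] that by simp
    have w: "w x = w v' * (s' x / s' v) + P w x" if "w \<in> D.span (insert s S)" for w x
    proof -
      obtain c where c: "w - scl (dual V) c s \<in> D.span S"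
        using \<open>w \<in> _\<close> unfolding D.span_breakdown_eq[of w s S] by blast
      have "P w - scl (dual V) c (P s) = w - scl (dual V) c s"
        using Pm[OF c] unfolding P_diff P_scl .
      then have wx: "w x = c * s' x + P w x" for x
        using fun_cong[of "P w - scl (dual V) c (P s)" "w - scl (dual V) c s" x]
        by (simp add: s'_def scl_dual algebra_simps)
      note sl = dual_sum_list[OF span_carr[OF that], of l "\<lambda>p. scl V (snd p v) (fst p)", OF fst_l]
      have "w (scl V (snd p v) (fst p)) = w (fst p) * snd p v" if "p \<in> set l" for p
        using dual_scl[OF span_carr[OF \<open>w \<in> _\<close>], of "fst p" "snd p v"] l[of "fst p" "snd p"] that by simp
      then have "(\<Sum>p\<leftarrow>l. w (scl V (snd p v) (fst p))) = P w v"
        unfolding P_def by (auto intro!: arg_cong[of _ _ sum_list] simp: case_prod_unfold)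
      then have "w v' = w v - P w v"
        unfolding v'_def using sl dual_diff[OF span_carr[OF that] vV] by simp
      then have "w v' = c * s' v" using wx[of v] by simp
      then show ?thesis using v wx[of x] by simp
    qed
    have v'V: "v' \<in> carr V"
      unfolding v'_def using dual_sum_list[OF span_carr[OF s'_span], of l "\<lambda>p. scl V (snd p v) (fst p)", OF fst_l] vV
      by simp
    have \<alpha>: "(\<lambda>x. s' x / s' v) \<in> D.span (insert s S)"
      using D.span_scale[OF s'_span, of "inverse (s' v)"] by (simp add: scl_dual divide_inverse mult.commute)
    show ?thesis
      by (intro exI[of _ "(v', \<lambda>x. s' x / s' v) # l"])
        (use w v'V \<alpha> l sub in \<open>auto simp: P_def\<close>)
  qed
qed

text \<open>A null sequence with its limit is compact, as a neighbourhood of 0 contains all but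
  finitely many of the \<open>A k\<close>. Each index has a finite set because it will contribute a
  whole list.\<close>

lemma compactin_null_family:
  fixes A :: "nat \<Rightarrow> 'v set"
  assumes A: "\<And>k. finite (A k)" "\<And>k. A k \<subseteq> carr V"
    and null: "\<And>k x. x \<in> A k \<Longrightarrow> nrm V x \<le> 1 / 2 ^ k"
  shows "compactin (ntopology V) (insert 0 (\<Union>k. A k))"
proof -
  interpret M: Metric_space "carr V" "ndist V"
    by (rule normed_space_Metric_space[OF normed_space])
  show ?thesis
    unfolding ntopology_def compactin_def
  proof (intro conjI allI impI)
    show "insert 0 (\<Union>k. A k) \<subseteq> topspace M.mtopology"
      using A by auto
    fix \<U> assume \<U>: "Ball \<U> (openin M.mtopology) \<and> insert 0 (\<Union>k. A k) \<subseteq> \<Union>\<U>"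
    then obtain U where U: "U \<in> \<U>" "0 \<in> U" "openin M.mtopology U" by blast
    then obtain r where r: "r > 0" "M.mball 0 r \<subseteq> U"
      unfolding M.openin_mtopology by blast
    obtain n where n: "(1 / 2 :: real) ^ n < r"
      using real_arch_pow_inv[OF r(1)] by force
    have tail: "A k \<subseteq> U" if "n \<le> k" for k
    proof
      fix x assume x: "x \<in> A k"
      have "nrm V x \<le> (1 / 2) ^ k" using null[OF x] by (simp add: power_one_over)
      also have "\<dots> \<le> (1 / 2) ^ n" using that by (intro power_decreasing) auto
      finally have "x \<in> M.mball 0 r"
        using n x A(2) nrm_diff_commute[of 0 x] by (auto simp: ndist_def)
      then show "x \<in> U" using r by blast
    qed
    have "finite (\<Union>k<n. A k)" using A by auto
    moreover have "\<forall>x\<in>(\<Union>k<n. A k). \<exists>U. U \<in> \<U> \<and> x \<in> U"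
      using \<U> by blast
    then obtain h where h: "\<And>x. x \<in> (\<Union>k<n. A k) \<Longrightarrow> h x \<in> \<U> \<and> x \<in> h x"
      by metis
    ultimately have "finite (insert U (h ` (\<Union>k<n. A k)))" "insert U (h ` (\<Union>k<n. A k)) \<subseteq> \<U>"
      using U by auto
    moreover have "insert 0 (\<Union>k. A k) \<subseteq> \<Union>(insert U (h ` (\<Union>k<n. A k)))"
    proof
      fix x assume "x \<in> insert 0 (\<Union>k. A k)"
      then consider "x = 0" | k where "x \<in> A k" "n \<le> k" | k where "x \<in> A k" "k < n"
        by (metis UN_E insertE not_le)
      then show "x \<in> \<Union>(insert U (h ` (\<Union>k<n. A k)))"
      proof cases
        case 3
        then have "x \<in> (\<Union>k<n. A k)" by blast
        then show ?thesis using h by blast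
      qed (use U tail in blast)+
    qed
    ultimately show "\<exists>\<F>. finite \<F> \<and> \<F> \<subseteq> \<U> \<and> insert 0 (\<Union>k. A k) \<subseteq> \<Union>\<F>"
      by blast
  qed
qed

end

section \<open>Sums over lists\<close>

lemma sum_list_apply: "(\<Sum>p\<leftarrow>l. f p) x = (\<Sum>p\<leftarrow>l. f p x)"
  by (induction l) auto

lemma sum_list_concat_upt: "(\<Sum>p\<leftarrow>concat (map z [0..<n]). g p) = (\<Sum>k<n. \<Sum>p\<leftarrow>z k. g p)"
  for g :: "'p \<Rightarrow> 'a::comm_monoid_add"
  by (induction n) auto

lemma sum_list_swap:
  "(\<Sum>p\<leftarrow>l. \<Sum>q\<leftarrow>l'. g p q) = (\<Sum>q\<leftarrow>l'. \<Sum>p\<leftarrow>l. g p q)" for g :: "'p \<Rightarrow> 'q \<Rightarrow> 'a::comm_monoid_add"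
  by (induction l) (simp_all add: sum_list_addf)

lemma sums_sum_list_0:
  fixes g :: "'p \<Rightarrow> nat \<Rightarrow> 'a::real_normed_vector"
  assumes "\<And>p. p \<in> set l \<Longrightarrow> g p sums 0"
  shows "(\<lambda>k. \<Sum>p\<leftarrow>l. g p k) sums 0"
  using assms
proof (induction l)
  case (Cons p l)
  then have "(\<lambda>k. g p k + (\<Sum>p\<leftarrow>l. g p k)) sums (0 + 0)"
    by (intro sums_add) auto
  then show ?case by simp
qed simp

lemma (in normed_nspace) sum_list_map_additive:
  fixes T :: "'v \<Rightarrow> 'a::ab_group_add"
  assumes T: "\<And>x y. x \<in> carr V \<Longrightarrow> y \<in> carr V \<Longrightarrow> T (x + y) = T x + T y"
    and x: "\<And>p. p \<in> set l \<Longrightarrow> x p \<in> carr V"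
  shows "T (\<Sum>p\<leftarrow>l. x p) = (\<Sum>p\<leftarrow>l. T (x p)) \<and> (\<Sum>p\<leftarrow>l. x p) \<in> carr V"
proof -
  have "T 0 = 0" using T[of 0 0] by simp
  with x show ?thesis by (induction l) (auto simp: T)
qed

text \<open>
  Trace duality: if the tensor \<open>\<Sum> a \<otimes> b\<close> vanishes as a bilinear form on \<open>V \<times> W\<close> and \<open>V\<^sup>*\<close> has the
  approximation property, then it vanishes in the projective tensor product. Dividing the \<open>a\<close> by
  \<open>2\<^sup>k\<parallel>a\<parallel>\<close> turns them into a relatively compact set, on which the identity of \<open>V\<^sup>*\<close> is approximated by
  an operator \<open>R\<close> of finite rank; for \<open>R\<close> in place of the identity the claim is the hypothesis.
\<close>

theorem trace_duality:
  fixes V :: "('k::real_or_complex, 'v::ab_group_add) nspace"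
    and W :: "('k, 'w::ab_group_add) nspace"
    and z :: "nat \<Rightarrow> (('v \<Rightarrow> 'k) \<times> ('w \<Rightarrow> 'k)) list"
  assumes V: "normed_nspace V" and W: "normed_nspace W" and ap: "approximation_property (dual V)"
    and z: "\<And>k p. p \<in> set (z k) \<Longrightarrow> fst p \<in> carr (dual V) \<and> snd p \<in> carr (dual W)"
    and bound: "\<And>k. (\<Sum>p\<leftarrow>z k. nrm (dual V) (fst p) * nrm (dual W) (snd p)) \<le> C / 4 ^ k"
    and null: "\<And>v w. v \<in> carr V \<Longrightarrow> w \<in> carr W \<Longrightarrow> (\<lambda>k. \<Sum>p\<leftarrow>z k. fst p v * snd p w) sums 0"
    and \<beta>_add_left: "\<And>a a' b. a \<in> carr (dual V) \<Longrightarrow> a' \<in> carr (dual V) \<Longrightarrow> b \<in> carr (dual W) \<Longrightarrow>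
      \<beta> (a + a') b = \<beta> a b + \<beta> a' b"
    and \<beta>_add_right: "\<And>a b b'. a \<in> carr (dual V) \<Longrightarrow> b \<in> carr (dual W) \<Longrightarrow> b' \<in> carr (dual W) \<Longrightarrow>
      \<beta> a (b + b') = \<beta> a b + \<beta> a b'"
    and \<beta>_scl_left: "\<And>c a b. a \<in> carr (dual V) \<Longrightarrow> b \<in> carr (dual W) \<Longrightarrow>
      \<beta> (scl (dual V) c a) b = c * \<beta> a b"
    and \<beta>_scl_right: "\<And>c a b. a \<in> carr (dual V) \<Longrightarrow> b \<in> carr (dual W) \<Longrightarrow>
      \<beta> a (scl (dual W) c b) = c * \<beta> a b"
    and \<beta>_bound: "\<And>a b. a \<in> carr (dual V) \<Longrightarrow> b \<in> carr (dual W) \<Longrightarrow>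
      norm (\<beta> a b) \<le> M * (nrm (dual V) a * nrm (dual W) b)"
    and M: "0 \<le> M"
  shows "(\<lambda>k. \<Sum>p\<leftarrow>z k. \<beta> (fst p) (snd p)) sums (0 :: 'k)"
proof -
  let ?A = "dual V" and ?B = "dual W"
  note scl_dual [simp del]
  interpret V: normed_nspace V by (rule V)
  interpret W: normed_nspace W by (rule W)
  interpret dV: normed_nspace "dual V" by (rule V.normed_nspace_dual)
  interpret dW: normed_nspace "dual W" by (rule W.normed_nspace_dual)
  have z1: "fst p \<in> carr ?A" and z2: "snd p \<in> carr ?B" if "p \<in> set (z k)" for p k
    using z[OF that] by auto
  have C: "0 \<le> C"
  proof -
    have "0 \<le> (\<Sum>p\<leftarrow>z 0. nrm ?A (fst p) * nrm ?B (snd p))"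
      using z1[of _ 0] z2[of _ 0] by (intro sum_list_nonneg) auto
    then show ?thesis using bound[of 0] by simp
  qed
  have sum_bound: "norm (\<Sum>p\<leftarrow>z k. f p) \<le> D * C / 4 ^ k"
    if "0 \<le> D" "\<And>p. p \<in> set (z k) \<Longrightarrow> norm (f p) \<le> D * (nrm ?A (fst p) * nrm ?B (snd p))"
    for f :: "('v \<Rightarrow> 'k) \<times> ('w \<Rightarrow> 'k) \<Rightarrow> 'k" and D k
  proof -
    have "norm (\<Sum>p\<leftarrow>l. f p) \<le> (\<Sum>p\<leftarrow>l. norm (f p))" for l
      by (induction l) (auto intro: order_trans[OF norm_triangle_ineq])
    also have "(\<Sum>p\<leftarrow>z k. norm (f p)) \<le> (\<Sum>p\<leftarrow>z k. D * (nrm ?A (fst p) * nrm ?B (snd p)))"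
      using that by (intro sum_list_mono) auto
    also have "\<dots> \<le> D * (C / 4 ^ k)"
      unfolding sum_list_const_mult using bound that(1) by (intro mult_left_mono)
    finally show ?thesis by simp
  qed
  \<comment> \<open>One list for the first \<open>n\<close> terms, so that additive maps apply to a
    partial sum at once.\<close>
  define Z where "Z n = concat (map z [0..<n])" for n
  have Z1: "fst p \<in> carr ?A" and Z2: "snd p \<in> carr ?B" if "p \<in> set (Z n)" for p n
  proof -
    from that obtain k where "p \<in> set (z k)" by (auto simp: Z_def)
    from z[OF this] show "fst p \<in> carr ?A" "snd p \<in> carr ?B" by simp_all
  qed
  have Z_sum: "(\<Sum>p\<leftarrow>Z n. g p) = (\<Sum>k<n. \<Sum>p\<leftarrow>z k. g p)" for g :: "_ \<Rightarrow> 'k" and n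
    unfolding Z_def by (rule sum_list_concat_upt)
  \<comment> \<open>By \<open>span_evaluation\<close>, \<open>R\<close> is a finite sum of maps that
    send \<open>a\<close> to \<open>R a v\<close> times a fixed \<open>\<alpha>\<close>; for each of
    them the claim is \<open>single\<close>.\<close>
  have finite_rank_null: "(\<lambda>k. \<Sum>p\<leftarrow>z k. \<beta> (R (fst p)) (snd p)) sums 0"
    if R: "R \<in> carr (bounded_operators ?A ?A)" and fin: "finite_rank ?A ?A R" for R
  proof -
    have R_in: "R a \<in> carr ?A" if "a \<in> carr ?A" for a
      using R that by (auto simp: bounded_operators_def linear_map_def)
    have R_add: "R (a + a') = R a + R a'" if "a \<in> carr ?A" "a' \<in> carr ?A" for a a'
      using R that by (auto simp: bounded_operators_def linear_map_def)
    have R_scl: "R (scl ?A c a) = scl ?A c (R a)" if "a \<in> carr ?A" for a c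
      using R that by (auto simp: bounded_operators_def linear_map_def)
    obtain K where K: "\<And>a. a \<in> carr ?A \<Longrightarrow> nrm ?A (R a) \<le> K * nrm ?A a"
      using R by (auto simp: bounded_operators_def)
    obtain S where S: "finite S" "S \<subseteq> carr ?A" "R ` carr ?A \<subseteq> dV.span S"
      using fin unfolding finite_rank_def by blast
    obtain l where l: "\<And>v \<alpha>. (v, \<alpha>) \<in> set l \<Longrightarrow> v \<in> carr V \<and> \<alpha> \<in> dV.span S"
      and rep: "\<And>m x. m \<in> dV.span S \<Longrightarrow> m x = (\<Sum>(v, \<alpha>)\<leftarrow>l. m v * \<alpha> x)"
      using V.span_evaluation[OF S(1,2)] by blast
    have spanS: "\<alpha> \<in> carr ?A" if "\<alpha> \<in> dV.span S" for \<alpha>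
      using that dV.span_minimal[OF S(2) dV.subspace_carr] by blast
    have l1: "fst q \<in> carr V" and l2: "snd q \<in> carr ?A" if "q \<in> set l" for q
      using l[of "fst q" "snd q"] that spanS by auto
    have R_rep: "R a = (\<Sum>q\<leftarrow>l. scl ?A (R a (fst q)) (snd q))" if "a \<in> carr ?A" for a
    proof
      fix x
      have "R a \<in> dV.span S" using S(3) that by blast
      from rep[OF this, of x] show "R a x = (\<Sum>q\<leftarrow>l. scl ?A (R a (fst q)) (snd q)) x"
        by (simp add: sum_list_apply scl_dual case_prod_unfold)
    qed
    have \<beta>R: "\<beta> (R a) b = (\<Sum>q\<leftarrow>l. R a (fst q) * \<beta> (snd q) b)"
      if a: "a \<in> carr ?A" and b: "b \<in> carr ?B" for a b
    proof -
      have "\<beta> (\<Sum>q\<leftarrow>l. scl ?A (R a (fst q)) (snd q)) b =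
          (\<Sum>q\<leftarrow>l. \<beta> (scl ?A (R a (fst q)) (snd q)) b)"
        using dV.sum_list_map_additive[of "\<lambda>a. \<beta> a b" l "\<lambda>q. scl ?A (R a (fst q)) (snd q)"]
          \<beta>_add_left[OF _ _ b] l2 by simp
      also have "\<dots> = (\<Sum>q\<leftarrow>l. R a (fst q) * \<beta> (snd q) b)"
        by (intro arg_cong[of _ _ sum_list] map_cong refl \<beta>_scl_left l2 b)
      finally show ?thesis unfolding R_rep[OF a, symmetric] .
    qed
    have single: "(\<lambda>k. \<Sum>p\<leftarrow>z k. R (fst p) v * \<beta> \<alpha> (snd p)) sums 0"
      if v: "v \<in> carr V" and \<alpha>: "\<alpha> \<in> carr ?A" for v \<alpha>
    proof -
      \<comment> \<open>The functional sending \<open>a\<close> to \<open>R a v\<close> belongs to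
        the bidual of \<open>V\<close> and need not be evaluation at a vector, so
        \<open>null\<close> does not apply to it directly. Instead \<open>B n\<close> is shown to
        tend to 0 in norm, which the bounded map \<open>\<beta> \<alpha>\<close> preserves.\<close>
      define B where "B n = (\<Sum>p\<leftarrow>Z n. scl ?B (R (fst p) v) (snd p))" for n
      have B_in: "B n \<in> carr ?B" and \<beta>B: "\<beta> \<alpha> (B n) = (\<Sum>p\<leftarrow>Z n. R (fst p) v * \<beta> \<alpha> (snd p))" for n
      proof -
        have 1: "\<beta> \<alpha> (B n) = (\<Sum>p\<leftarrow>Z n. \<beta> \<alpha> (scl ?B (R (fst p) v) (snd p))) \<and> B n \<in> carr ?B"
          unfolding B_def
          by (rule dW.sum_list_map_additive[of "\<beta> \<alpha>", OF \<beta>_add_right[OF \<alpha>] dW.scl_in[OF Z2]])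
        also have "(\<Sum>p\<leftarrow>Z n. \<beta> \<alpha> (scl ?B (R (fst p) v) (snd p))) = (\<Sum>p\<leftarrow>Z n. R (fst p) v * \<beta> \<alpha> (snd p))"
          by (intro arg_cong[of _ _ sum_list] map_cong refl \<beta>_scl_right[OF \<alpha>] Z2)
        finally show "B n \<in> carr ?B" "\<beta> \<alpha> (B n) = (\<Sum>p\<leftarrow>Z n. R (fst p) v * \<beta> \<alpha> (snd p))"
          by simp_all
      qed
      have B_le: "norm (B n w) \<le> (\<bar>K\<bar> * nrm V v * (2 * C / 4 ^ n)) * nrm W w" if w: "w \<in> carr W" for n w
      proof -
        \<comment> \<open>For fixed \<open>w\<close> the sum is formed in \<open>dual V\<close>
          before \<open>R\<close> is applied. There \<open>null_sums_bound\<close> makes it small in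
          norm, uniformly on the unit ball of \<open>V\<close>, and the bounded operator
          \<open>R\<close> keeps it small.\<close>
        define A where "A = (\<Sum>p\<leftarrow>Z n. scl ?A (snd p w) (fst p))"
        have A: "R A = (\<Sum>p\<leftarrow>Z n. R (scl ?A (snd p w) (fst p))) \<and> A \<in> carr ?A"
          unfolding A_def by (rule dV.sum_list_map_additive[of R, OF R_add dV.scl_in[OF Z1]])
        also have "(\<Sum>p\<leftarrow>Z n. R (scl ?A (snd p w) (fst p))) = (\<Sum>p\<leftarrow>Z n. scl ?A (snd p w) (R (fst p)))"
          by (intro arg_cong[of _ _ sum_list] map_cong refl R_scl Z1)
        finally have RA: "R A = (\<Sum>p\<leftarrow>Z n. scl ?A (snd p w) (R (fst p)))" "A \<in> carr ?A"
          by simp_all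
        have "B n w = R A v"
          unfolding RA(1) B_def by (simp add: sum_list_apply scl_dual mult.commute)
        have "nrm ?A A \<le> 2 * C / 4 ^ n * nrm W w"
        proof (rule V.nrm_dual_le)
          fix v' assume v': "v' \<in> carr V"
          have eq: "A v' = (\<Sum>k<n. \<Sum>p\<leftarrow>z k. fst p v' * snd p w)"
            unfolding A_def Z_sum[symmetric] by (simp add: sum_list_apply scl_dual mult.commute)
          have "norm (A v') \<le> 2 * (nrm V v' * nrm W w * C) / 4 ^ n"
            unfolding eq
          proof (rule null_sums_bound[OF null[OF v' w] sum_bound])
            fix p k assume p: "p \<in> set (z k)"
            have "norm (fst p v') * norm (snd p w) \<le>
                (nrm ?A (fst p) * nrm V v') * (nrm ?B (snd p) * nrm W w)"
              using V.dual_bound[OF z1[OF p] v'] W.dual_bound[OF z2[OF p] w] z1[OF p] v'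
              by (intro mult_mono) auto
            then show "norm (fst p v' * snd p w) \<le>
                nrm V v' * nrm W w * (nrm ?A (fst p) * nrm ?B (snd p))"
              by (simp add: norm_mult mult_ac)
          qed (use v' w in simp)
          then show "norm (A v') \<le> 2 * C / 4 ^ n * nrm W w * nrm V v'"
            by (simp add: mult_ac)
        qed (use C w in simp)
        then have "\<bar>K\<bar> * nrm ?A A \<le> \<bar>K\<bar> * (2 * C / 4 ^ n * nrm W w)"
          by (intro mult_left_mono) auto
        moreover have "nrm ?A (R A) \<le> \<bar>K\<bar> * nrm ?A A"
          using order_trans[OF K[OF RA(2)] mult_right_mono[OF abs_ge_self dV.nrm_nonneg[OF RA(2)]]] .
        ultimately have "nrm ?A (R A) * nrm V v \<le> \<bar>K\<bar> * (2 * C / 4 ^ n * nrm W w) * nrm V v"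
          using v by (intro mult_right_mono) auto
        then show ?thesis
          using V.dual_bound[OF R_in[OF RA(2)] v] \<open>B n w = R A v\<close> by (simp add: mult_ac)
      qed
      have "norm (\<beta> \<alpha> (B n)) \<le> (M * nrm ?A \<alpha> * (\<bar>K\<bar> * nrm V v * (2 * C))) * (1 / 4) ^ n" for n
      proof -
        have "nrm ?B (B n) \<le> \<bar>K\<bar> * nrm V v * (2 * C / 4 ^ n)"
          by (rule W.nrm_dual_le[OF B_le]) (use v C in auto)
        then have "M * (nrm ?A \<alpha> * nrm ?B (B n)) \<le>
            M * (nrm ?A \<alpha> * (\<bar>K\<bar> * nrm V v * (2 * C / 4 ^ n)))"
          using M \<alpha> by (intro mult_left_mono) auto
        then show ?thesis
          using \<beta>_bound[OF \<alpha> B_in[of n]] by (simp add: power_one_over mult_ac)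
      qed
      then have le: "\<forall>n. norm (\<beta> \<alpha> (B n)) \<le> (M * nrm ?A \<alpha> * (\<bar>K\<bar> * nrm V v * (2 * C))) * (1 / 4) ^ n"
        by blast
      have "(\<lambda>n. (M * nrm ?A \<alpha> * (\<bar>K\<bar> * nrm V v * (2 * C))) * (1 / 4) ^ n) \<longlonglongrightarrow> 0"
        by (intro tendsto_mult_right_zero LIMSEQ_power_zero) simp
      from Lim_null_comparison[OF always_eventually[OF le] this]
      show ?thesis
        unfolding sums_def \<beta>B Z_sum .
    qed
    have "(\<lambda>k. \<Sum>q\<leftarrow>l. \<Sum>p\<leftarrow>z k. R (fst p) (fst q) * \<beta> (snd q) (snd p)) sums 0"
      by (rule sums_sum_list_0[of l "\<lambda>q k. \<Sum>p\<leftarrow>z k. R (fst p) (fst q) * \<beta> (snd q) (snd p)"])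
        (intro single l1 l2)
    moreover have "(\<Sum>p\<leftarrow>z k. \<beta> (R (fst p)) (snd p)) =
        (\<Sum>q\<leftarrow>l. \<Sum>p\<leftarrow>z k. R (fst p) (fst q) * \<beta> (snd q) (snd p))" for k
      unfolding sum_list_swap[where l = l and l' = "z k"]
      by (intro arg_cong[of _ _ sum_list] map_cong refl \<beta>R z1 z2)
    ultimately show ?thesis by simp
  qed
  define h where "h k = (\<Sum>p\<leftarrow>z k. \<beta> (fst p) (snd p))" for k
  have h_le: "norm (h k) \<le> M * C / 4 ^ k" for k
    unfolding h_def by (rule sum_bound[OF M]) (intro \<beta>_bound z1 z2)
  have summ: "summable h"
    by (rule summable_scalar_if_summable_norm[OF geometric_sums(1)[of h, OF h_le]])
  have small: "norm (suminf h) \<le> \<epsilon> * (M * C * 2)" if \<epsilon>: "\<epsilon> > 0" for \<epsilon>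
  proof -
    \<comment> \<open>Rescaling to norm at most \<open>1 / 2 ^ k\<close>; for
      \<open>fst p = 0\<close> the inverse of 0 is 0, and so is the element.\<close>
    define A where "A k = (\<lambda>p. scl ?A (of_real (inverse (2 ^ k * nrm ?A (fst p)))) (fst p)) ` set (z k)" for k
    have "compactin (ntopology ?A) (insert 0 (\<Union>k. A k))"
    proof (rule dV.compactin_null_family)
      show "finite (A k)" "A k \<subseteq> carr ?A" for k
        using z1 by (auto simp: A_def)
      fix k x assume "x \<in> A k"
      then obtain p where p: "p \<in> set (z k)"
        "x = scl ?A (of_real (inverse (2 ^ k * nrm ?A (fst p)))) (fst p)"
        by (auto simp: A_def)
      have "nrm ?A x = \<bar>inverse (2 ^ k * nrm ?A (fst p))\<bar> * nrm ?A (fst p)"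
        unfolding p(2) dV.nrm_scl[OF z1[OF p(1)]] norm_of_real ..
      also have "\<dots> \<le> 1 / 2 ^ k"
        using dV.nrm_nonneg[OF z1[OF p(1)]]
        by (cases "nrm ?A (fst p) = 0") (simp_all only: abs_of_nonneg, simp_all add: field_simps)
      finally show "nrm ?A x \<le> 1 / 2 ^ k" .
    qed
    then obtain R where R: "R \<in> carr (bounded_operators ?A ?A)" "finite_rank ?A ?A R"
      and R_close: "\<And>x. x \<in> insert 0 (\<Union>k. A k) \<Longrightarrow> nrm ?A (R x - x) < \<epsilon>"
      using ap \<epsilon> unfolding approximation_property_def by blast
    have R_in: "R a \<in> carr ?A" if "a \<in> carr ?A" for a
      using R(1) that by (auto simp: bounded_operators_def linear_map_def)
    have R_scl: "R (scl ?A c a) = scl ?A c (R a)" if "a \<in> carr ?A" for a c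
      using R(1) that by (auto simp: bounded_operators_def linear_map_def)
    \<comment> \<open>Undoing the rescaling multiplies the error \<open>\<epsilon>\<close> by
      \<open>2 ^ k\<close> and the norm.\<close>
    have close: "nrm ?A (R (fst p) - fst p) \<le> \<epsilon> * 2 ^ k * nrm ?A (fst p)" if p: "p \<in> set (z k)" for p k
    proof (cases "nrm ?A (fst p) = 0")
      case True
      then have "fst p = 0" using dV.nrm_eq_0[OF z1[OF p]] by simp
      moreover have "R 0 = 0" using R_scl[of 0 0] by simp
      ultimately show ?thesis by simp
    next
      case False
      define N where "N = nrm ?A (fst p)"
      have N: "N > 0" using False dV.nrm_nonneg[OF z1[OF p]] by (simp add: N_def)
      define c where "c = inverse (2 ^ k * N)"
      have c: "c > 0" using N by (simp add: c_def)
      have "scl ?A (of_real c) (fst p) \<in> A k"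
        using p by (auto simp: A_def c_def N_def)
      then have "nrm ?A (R (scl ?A (of_real c) (fst p)) - scl ?A (of_real c) (fst p)) < \<epsilon>"
        by (intro R_close) blast
      moreover have "R (scl ?A (of_real c) (fst p)) - scl ?A (of_real c) (fst p) =
          scl ?A (of_real c) (R (fst p) - fst p)"
        unfolding R_scl[OF z1[OF p]] by (rule dV.scale_right_diff_distrib[symmetric])
      ultimately have "c * nrm ?A (R (fst p) - fst p) < \<epsilon>"
        using dV.nrm_scl[OF dV.diff_in[OF R_in[OF z1[OF p]] z1[OF p]], of "of_real c"] c by simp
      then show ?thesis
        unfolding N_def[symmetric] using N by (simp add: c_def field_simps)
    qed
    \<comment> \<open>The error of replacing the identity by \<open>R\<close>. As the part with
      \<open>R\<close> sums to 0, \<open>g\<close> and \<open>h\<close> have the same sum, and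
      \<open>2 ^ k / 4 ^ k\<close> leaves a geometric series with partial sums at most 2.\<close>
    define g where "g k = (\<Sum>p\<leftarrow>z k. \<beta> (fst p - R (fst p)) (snd p))" for k
    have \<beta>_diff: "\<beta> (a - a') b = \<beta> a b - \<beta> a' b"
      if "a \<in> carr ?A" "a' \<in> carr ?A" "b \<in> carr ?B" for a a' b
      using \<beta>_add_left[of "a - a'" a' b] that by simp
    have "g = (\<lambda>k. h k - (\<Sum>p\<leftarrow>z k. \<beta> (R (fst p)) (snd p)))"
      unfolding g_def[abs_def] h_def sum_list_subtractf[symmetric]
      by (intro ext arg_cong[of _ _ sum_list] map_cong refl \<beta>_diff z1 z2 R_in)
    then have "g sums (suminf h - 0)"
      using sums_diff[OF summable_sums[OF summ] finite_rank_null[OF R]] by simp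
    then have lim: "(\<lambda>n. \<Sum>k<n. g k) \<longlonglongrightarrow> suminf h"
      by (simp add: sums_def)
    have g_le: "norm (g k) \<le> (\<epsilon> * M * C) * (1 / 2) ^ k" for k
    proof -
      have "norm (g k) \<le> (M * (\<epsilon> * 2 ^ k)) * C / 4 ^ k"
        unfolding g_def
      proof (rule sum_bound)
        fix p assume p: "p \<in> set (z k)"
        have "norm (\<beta> (fst p - R (fst p)) (snd p)) \<le> M * (nrm ?A (fst p - R (fst p)) * nrm ?B (snd p))"
          by (intro \<beta>_bound dV.diff_in z1[OF p] z2[OF p] R_in)
        also have "\<dots> \<le> M * ((\<epsilon> * 2 ^ k * nrm ?A (fst p)) * nrm ?B (snd p))"
          using close[OF p] M dV.nrm_diff_commute[OF z1[OF p] R_in[OF z1[OF p]]] dW.nrm_nonneg[OF z2[OF p]]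
          by (intro mult_left_mono mult_right_mono) auto
        finally show "norm (\<beta> (fst p - R (fst p)) (snd p)) \<le>
            M * (\<epsilon> * 2 ^ k) * (nrm ?A (fst p) * nrm ?B (snd p))"
          by (simp add: mult_ac)
      qed (use M \<epsilon> in simp)
      also have "(4 :: real) ^ k = 2 ^ k * 2 ^ k"
        by (simp flip: power_mult_distrib)
      finally show ?thesis by (simp add: power_one_over mult_ac)
    qed
    have "norm (\<Sum>k<n. g k) \<le> \<epsilon> * (M * C * 2)" for n
    proof -
      have "norm (\<Sum>k<n. g k) \<le> (\<Sum>k<n. (\<epsilon> * M * C) * (1 / 2) ^ k)"
        by (intro sum_norm_le g_le)
      also have "\<dots> = (\<epsilon> * M * C) * (\<Sum>k<n. (1 / 2) ^ k)"
        by (simp add: sum_distrib_left)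
      also have "\<dots> \<le> (\<epsilon> * M * C) * 2"
      proof (rule mult_left_mono)
        have "(\<Sum>k<n. (1 / 2 :: real) ^ k) = 2 - 2 * (1 / 2) ^ n"
          by (induction n) simp_all
        then show "(\<Sum>k<n. (1 / 2 :: real) ^ k) \<le> 2"
          by simp
      qed (use M C \<epsilon> in simp)
      finally show ?thesis by (simp add: mult_ac)
    qed
    then show ?thesis
      by (intro Lim_norm_ubound[OF sequentially_bot lim always_eventually] allI)
  qed
  have "norm (suminf h) \<le> 0"
  proof (rule field_le_epsilon)
    fix e :: real assume "e > 0"
    have pos: "M * C * 2 + 1 > 0" using M C by (simp add: add_nonneg_pos)
    have "norm (suminf h) \<le> e / (M * C * 2 + 1) * (M * C * 2)"
      using small[of "e / (M * C * 2 + 1)"] pos \<open>e > 0\<close> by simp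
    also have "\<dots> \<le> e"
      using pos \<open>e > 0\<close> by (simp add: pos_divide_le_eq)
    finally show "norm (suminf h) \<le> 0 + e" by simp
  qed
  then show ?thesis
    using summable_sums[OF summ] by (simp add: h_def[abs_def])
qed

section \<open>Interpolation by little Lipschitz functions\<close>

text \<open>A real-valued counterpart of \<open>little_lip\<close> with a prescribed constant. Real
  values make \<open>max\<close> and \<open>min\<close> available, and these preserve
  \<open>L\<close>.\<close>

definition little_lipschitz :: "'x::metric_space set \<Rightarrow> real \<Rightarrow> ('x \<Rightarrow> real) \<Rightarrow> bool" where
  "little_lipschitz X L u \<longleftrightarrow> (\<forall>x\<in>X. \<forall>x'\<in>X. \<bar>u x - u x'\<bar> \<le> L * dist x x') \<and>
     (\<forall>\<epsilon>>0. \<exists>\<delta>>0. \<forall>x\<in>X. \<forall>x'\<in>X. dist x x' < \<delta> \<longrightarrow> \<bar>u x - u x'\<bar> \<le> \<epsilon> * dist x x')"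

lemma little_lipschitz_const: "0 \<le> L \<Longrightarrow> little_lipschitz X L (\<lambda>x. c)"
  unfolding little_lipschitz_def by (auto intro!: exI[of _ 1])

lemma little_lipschitzD:
  assumes "little_lipschitz X L u" "\<epsilon> > 0"
  obtains \<delta> where "\<delta> > 0"
    "\<And>x x'. x \<in> X \<Longrightarrow> x' \<in> X \<Longrightarrow> dist x x' < \<delta> \<Longrightarrow> \<bar>u x - u x'\<bar> \<le> \<epsilon> * dist x x'"
proof -
  have "\<exists>\<delta>>0. \<forall>x\<in>X. \<forall>x'\<in>X. dist x x' < \<delta> \<longrightarrow> \<bar>u x - u x'\<bar> \<le> \<epsilon> * dist x x'"
    using assms unfolding little_lipschitz_def by simp
  then show ?thesis using that by blast
qed

text \<open>Both \<open>max\<close> and \<open>min\<close> satisfy the hypothesis on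
  \<open>w\<close>, so the constant does not grow, however many functions are combined.\<close>

lemma little_lipschitz_combine:
  assumes u: "little_lipschitz X L u" and v: "little_lipschitz X L v"
    and w: "\<And>x x'. \<bar>w x - w x'\<bar> \<le> max \<bar>u x - u x'\<bar> \<bar>v x - v x'\<bar>"
  shows "little_lipschitz X L w"
  unfolding little_lipschitz_def
proof (intro conjI allI impI)
  show "\<forall>x\<in>X. \<forall>x'\<in>X. \<bar>w x - w x'\<bar> \<le> L * dist x x'"
    using u v order_trans[OF w] unfolding little_lipschitz_def by simp
  fix \<epsilon> :: real assume "\<epsilon> > 0"
  obtain \<delta> where \<delta>: "\<delta> > 0" "\<And>x x'. x \<in> X \<Longrightarrow> x' \<in> X \<Longrightarrow> dist x x' < \<delta> \<Longrightarrow> \<bar>u x - u x'\<bar> \<le> \<epsilon> * dist x x'"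
    using little_lipschitzD[OF u \<open>\<epsilon> > 0\<close>] by blast
  obtain \<delta>' where \<delta>': "\<delta>' > 0" "\<And>x x'. x \<in> X \<Longrightarrow> x' \<in> X \<Longrightarrow> dist x x' < \<delta>' \<Longrightarrow> \<bar>v x - v x'\<bar> \<le> \<epsilon> * dist x x'"
    using little_lipschitzD[OF v \<open>\<epsilon> > 0\<close>] by blast
  show "\<exists>\<delta>>0. \<forall>x\<in>X. \<forall>x'\<in>X. dist x x' < \<delta> \<longrightarrow> \<bar>w x - w x'\<bar> \<le> \<epsilon> * dist x x'"
  proof (intro exI[of _ "min \<delta> \<delta>'"] conjI ballI impI)
    show "\<bar>w x - w x'\<bar> \<le> \<epsilon> * dist x x'" if "x \<in> X" "x' \<in> X" "dist x x' < min \<delta> \<delta>'" for x x'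
      using that \<delta>(2) \<delta>'(2) order_trans[OF w[of x x']] by simp
  qed (use \<delta> \<delta>' in simp)
qed

lemma little_lipschitz_max:
  "little_lipschitz X L u \<Longrightarrow> little_lipschitz X L v \<Longrightarrow> little_lipschitz X L (\<lambda>x. max (u x) (v x))"
  and little_lipschitz_min:
  "little_lipschitz X L u \<Longrightarrow> little_lipschitz X L v \<Longrightarrow> little_lipschitz X L (\<lambda>x. min (u x) (v x))"
  by (rule little_lipschitz_combine[where u = u and v = v]; auto simp: max_def min_def)+

text \<open>The Kakutani--Stone argument: a minimum of two-point interpolants through a fixed
  \<open>y\<close> is exact at \<open>y\<close> and below \<open>g\<close> on \<open>Y\<close>; the
  maximum of these functions over \<open>y\<close> is exact on \<open>Y\<close>. Truncation at
  \<open>M\<close> and \<open>- M\<close> then bounds the values. The constant is independent of the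
  number of points.\<close>

lemma little_lipschitz_interpolation:
  assumes "finite Y" and L: "0 \<le> L"
    and pair: "\<And>y z. y \<in> Y \<Longrightarrow> z \<in> Y \<Longrightarrow> \<exists>p. little_lipschitz X L p \<and> p y = g y \<and> p z = g z"
    and bound: "\<And>y. y \<in> Y \<Longrightarrow> \<bar>g y\<bar> \<le> M" and M: "0 \<le> M"
  shows "\<exists>u. little_lipschitz X L u \<and> (\<forall>y\<in>Y. u y = g y) \<and> (\<forall>x. \<bar>u x\<bar> \<le> M)"
proof -
  have below: "\<exists>u. little_lipschitz X L u \<and> u y = g y \<and> (\<forall>z\<in>T. u z \<le> g z)"
    if "finite T" "T \<subseteq> Y" "y \<in> Y" for T y
    using that
  proof (induction T)
    case empty
    then show ?case using pair[of y y] by auto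
  next
    case (insert z T)
    then obtain u p where "little_lipschitz X L u" "u y = g y" "\<forall>z\<in>T. u z \<le> g z"
      "little_lipschitz X L p" "p y = g y" "p z = g z"
      using pair[of y z] by auto
    then show ?case
      by (intro exI[of _ "\<lambda>x. min (u x) (p x)"]) (auto simp: little_lipschitz_min min.coboundedI1)
  qed
  have "\<exists>u. little_lipschitz X L u \<and> (\<forall>z\<in>Y. u z \<le> g z) \<and> (\<forall>z\<in>T. g z \<le> u z)"
    if "finite T" "T \<subseteq> Y" for T
    using that
  proof (induction T)
    case empty
    show ?case
    proof (cases "Y = {}")
      case True
      then show ?thesis using little_lipschitz_const[OF L] by auto
    next
      case False
      then show ?thesis using below[OF \<open>finite Y\<close>] by auto
    qed
  next
    case (insert y T)
    then obtain u v where "little_lipschitz X L u" "\<forall>z\<in>Y. u z \<le> g z" "\<forall>z\<in>T. g z \<le> u z"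
      "little_lipschitz X L v" "v y = g y" "\<forall>z\<in>Y. v z \<le> g z"
      using below[OF \<open>finite Y\<close>, of y] by auto
    then show ?case
      by (intro exI[of _ "\<lambda>x. max (u x) (v x)"]) (auto simp: little_lipschitz_max max.coboundedI1)
  qed
  from this[OF \<open>finite Y\<close>] obtain u where u: "little_lipschitz X L u" "\<And>y. y \<in> Y \<Longrightarrow> u y = g y"
    by force
  show ?thesis
  proof (intro exI[of _ "\<lambda>x. max (- M) (min M (u x))"] conjI ballI allI)
    show "little_lipschitz X L (\<lambda>x. max (- M) (min M (u x)))"
      by (intro little_lipschitz_max little_lipschitz_min little_lipschitz_const L u)
    show "max (- M) (min M (u y)) = g y" if "y \<in> Y" for y
      using u(2)[OF that] bound[OF that] by auto
    show "\<bar>max (- M) (min M (u x))\<bar> \<le> M" for x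
      using M by auto
  qed
qed

lemma lip_setting_scalars: "compact X \<Longrightarrow> lip_setting (scalars :: ('k::real_or_complex, 'k) nspace) X"
  using normed_nspace_scalars by (simp add: lip_setting_def lip_setting_axioms_def)

text \<open>The two real coordinates of a scalar function are interpolated separately, which doubles
  the separation constant \<open>c\<close>.\<close>

lemma scalar_interpolation:
  fixes X :: "'x::metric_space set"
  assumes X: "compact X" and sep: "lip_separates_points_uniformly TYPE('k::real_or_complex) X"
  obtains K where "0 \<le> K"
    "\<And>g Y. g \<in> carr (Lip X (scalars :: ('k, 'k) nspace)) \<Longrightarrow> finite Y \<Longrightarrow> Y \<subseteq> X \<Longrightarrow>
      \<exists>f\<in>carr (little_lip X scalars).
        nrm (Lip X scalars) f \<le> K * nrm (Lip X scalars) g \<and>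
        (\<forall>y\<in>Y. f y = g y)"
proof -
  let ?K = "scalars :: ('k, 'k) nspace"
  interpret S: lip_setting ?K X
    by (rule lip_setting_scalars[OF X])
  obtain \<rho> :: "'k \<Rightarrow> real" and \<iota> :: 'k where \<rho>: "\<And>x y. \<rho> (x + y) = \<rho> x + \<rho> y"
    "\<And>r x. \<rho> (of_real r * x) = r * \<rho> x" "\<And>x. \<bar>\<rho> x\<bar> \<le> norm x" "\<rho> 1 = 1"
    and \<iota>: "norm \<iota> \<le> 1" and rep: "\<And>x. x = of_real (\<rho> x) - \<iota> * of_real (\<rho> (\<iota> * x))"
    using real_part_exists by metis
  have \<rho>_minus: "\<rho> (- x) = - \<rho> x" for x
    using \<rho>(2)[of "- 1" x] by simp
  have \<rho>_diff: "\<rho> (x - y) = \<rho> x - \<rho> y" for x y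
    using \<rho>(1)[of x "- y"] \<rho>_minus by simp
  have \<rho>_of_real: "\<rho> (of_real r) = r" for r
    using \<rho>(2)[of r 1] \<rho>(4) by simp
  obtain c where c: "c > 1" and sep': "\<And>x x'. x \<in> X \<Longrightarrow> x' \<in> X \<Longrightarrow> x \<noteq> x' \<Longrightarrow>
      \<exists>f\<in>carr (little_lip X ?K).
        lip_const X ?K f \<le> c \<and> norm (f x - f x') = dist x x'"
    using sep unfolding lip_separates_points_uniformly_def by blast
  have peak: "\<exists>h. little_lipschitz X c h \<and> h y - h z = dist y z" if y: "y \<in> X" and z: "z \<in> X" and yz: "y \<noteq> z" for y z
  proof -
    obtain f where f: "f \<in> carr (little_lip X ?K)"
      and fc: "lip_const X ?K f \<le> c" and fd: "norm (f y - f z) = dist y z"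
      using sep'[OF y z yz] by blast
    \<comment> \<open>The rotation makes \<open>f y - f z\<close> real and positive, so that it
      survives the passage to real parts.\<close>
    obtain u where u: "norm u = 1" "u * (f y - f z) = of_real (norm (f y - f z))"
      using unimodular_exists by blast
    define h where "h x = \<rho> (u * f x)" for x
    have h_diff: "h x - h x' = \<rho> (u * (f x - f x'))" for x x'
      by (simp add: h_def \<rho>_diff right_diff_distrib)
    have h_le: "\<bar>h x - h x'\<bar> \<le> norm (f x - f x')" for x x'
      using \<rho>(3)[of "u * (f x - f x')"] u(1) by (simp add: h_diff norm_mult)
    have f_le: "norm (f x - f x') \<le> c * dist x x'" if x: "x \<in> X" "x' \<in> X" for x x'
    proof (cases "x = x'")
      case False
      have "bdd_above (lip_quotients X ?K f)"
        using f by (simp add: little_lip_def Lip_def)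
      then have "nrm ?K (f x - f x') / dist x x' \<le> lip_const X ?K f"
        unfolding lip_const_def using x False by (intro cSup_upper) (auto simp: lip_quotients_def)
      then have "norm (f x - f x') / dist x x' \<le> c"
        using fc by simp
      then show ?thesis
        using False by (simp add: pos_divide_le_eq)
    qed simp
    have "little_lipschitz X c h"
      unfolding little_lipschitz_def
    proof (intro conjI ballI allI impI)
      show "\<bar>h x - h x'\<bar> \<le> c * dist x x'" if "x \<in> X" "x' \<in> X" for x x'
        using h_le[of x x'] f_le[OF that] by simp
      fix \<epsilon> :: real assume "\<epsilon> > 0"
      from S.little_lipD[OF f this] obtain \<delta> where \<delta>: "\<delta> > 0"
        "\<And>x x'. x \<in> X \<Longrightarrow> x' \<in> X \<Longrightarrow> dist x x' < \<delta> \<Longrightarrow> norm (f x - f x') \<le> \<epsilon> * dist x x'"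
        unfolding scalars_simps by blast
      then show "\<exists>\<delta>>0. \<forall>x\<in>X. \<forall>x'\<in>X. dist x x' < \<delta> \<longrightarrow> \<bar>h x - h x'\<bar> \<le> \<epsilon> * dist x x'"
        using order_trans[OF h_le] by blast
    qed
    moreover have "h y - h z = dist y z"
      unfolding h_diff u(2) \<rho>_of_real by (rule fd)
    ultimately show ?thesis by blast
  qed
  have real: "\<exists>u. little_lipschitz X (G * c) u \<and> (\<forall>y\<in>Y. u y = g y) \<and> (\<forall>x. \<bar>u x\<bar> \<le> G)"
    if Y: "finite Y" "Y \<subseteq> X" and G: "0 \<le> G" "\<And>x x'. x \<in> X \<Longrightarrow> x' \<in> X \<Longrightarrow> \<bar>g x - g x'\<bar> \<le> G * dist x x'"
      "\<And>x. x \<in> X \<Longrightarrow> \<bar>g x\<bar> \<le> G" for g :: "'x \<Rightarrow> real" and G Y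
  proof (rule little_lipschitz_interpolation[OF Y(1)])
    show Gc: "0 \<le> G * c" using G(1) c by simp
    fix y z assume "y \<in> Y" "z \<in> Y"
    then have yz: "y \<in> X" "z \<in> X" using Y by auto
    show "\<exists>p. little_lipschitz X (G * c) p \<and> p y = g y \<and> p z = g z"
    proof (cases "y = z")
      case True
      then show ?thesis using little_lipschitz_const[OF Gc, of X "g y"] by auto
    next
      case False
      obtain h where h: "little_lipschitz X c h" "h y - h z = dist y z"
        using peak[OF yz False] by blast
      \<comment> \<open>\<open>p\<close> is an affine function of \<open>h\<close> through both
        prescribed values. Its slope \<open>t\<close> is a difference quotient of \<open>g\<close>,
        hence at most \<open>G\<close> in modulus.\<close>
      define t where "t = (g y - g z) / dist y z"
      have t: "\<bar>t\<bar> \<le> G" using G(2)[OF yz] False by (simp add: t_def field_simps)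
      define p where "p x = g y + t * (h x - h y)" for x
      have p_diff: "\<bar>p x - p x'\<bar> \<le> G * \<bar>h x - h x'\<bar>" for x x'
      proof -
        have "p x - p x' = t * (h x - h x')" by (simp add: p_def algebra_simps)
        then show ?thesis using t by (simp add: abs_mult mult_right_mono)
      qed
      have "little_lipschitz X (G * c) p"
        unfolding little_lipschitz_def
      proof (intro conjI ballI allI impI)
        fix x x' assume "x \<in> X" "x' \<in> X"
        then have "G * \<bar>h x - h x'\<bar> \<le> G * (c * dist x x')"
          using h(1) G(1) unfolding little_lipschitz_def by (intro mult_left_mono) auto
        then show "\<bar>p x - p x'\<bar> \<le> G * c * dist x x'"
          using p_diff[of x x'] by simp
      next
        fix \<epsilon> :: real assume "\<epsilon> > 0"
        then have "\<epsilon> / (G + 1) > 0" using G(1) by simp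
        then obtain \<delta> where \<delta>: "\<delta> > 0"
          "\<And>x x'. x \<in> X \<Longrightarrow> x' \<in> X \<Longrightarrow> dist x x' < \<delta> \<Longrightarrow> \<bar>h x - h x'\<bar> \<le> \<epsilon> / (G + 1) * dist x x'"
          using little_lipschitzD[OF h(1)] by blast
        show "\<exists>\<delta>>0. \<forall>x\<in>X. \<forall>x'\<in>X. dist x x' < \<delta> \<longrightarrow> \<bar>p x - p x'\<bar> \<le> \<epsilon> * dist x x'"
        proof (intro exI[of _ \<delta>] conjI ballI impI \<delta>(1))
          fix x x' assume "x \<in> X" "x' \<in> X" "dist x x' < \<delta>"
          then have "\<bar>h x - h x'\<bar> \<le> \<epsilon> / (G + 1) * dist x x'" by (rule \<delta>(2))
          then have "G * \<bar>h x - h x'\<bar> \<le> G * (\<epsilon> / (G + 1) * dist x x')"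
            using G(1) by (intro mult_left_mono)
          also have "\<dots> = (G / (G + 1)) * (\<epsilon> * dist x x')" by simp
          also have "\<dots> \<le> 1 * (\<epsilon> * dist x x')"
            using G(1) \<open>\<epsilon> > 0\<close> by (intro mult_right_mono) auto
          finally show "\<bar>p x - p x'\<bar> \<le> \<epsilon> * dist x x'"
            using p_diff[of x x'] by simp
        qed
      qed
      moreover have "p y = g y" by (simp add: p_def)
      moreover have "p z = g z"
      proof -
        have "h z - h y = - dist y z" using h(2) by simp
        then show ?thesis using False by (simp add: p_def t_def)
      qed
      ultimately show ?thesis by blast
    qed
  qed (use Y G in auto)
  show ?thesis
  \<comment> \<open>Each coordinate contributes \<open>G * c\<close> to the Lipschitz constant and
    \<open>G\<close> to the values; since \<open>c > 1\<close>, both totals are at most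
    \<open>2 * c * G\<close>.\<close>
  proof (rule that[of "2 * c"])
    show "0 \<le> 2 * c" using c by simp
    fix g :: "'x \<Rightarrow> 'k" and Y assume g: "g \<in> carr (Lip X ?K)" and Y: "finite Y" "Y \<subseteq> X"
    define G where "G = nrm (Lip X ?K) g"
    have G: "0 \<le> G" unfolding G_def by (rule S.L.nrm_nonneg[OF g])
    have gd: "norm (g x - g x') \<le> G * dist x x'" if "x \<in> X" "x' \<in> X" for x x'
      using S.Lip_diff_le[OF g that] by (simp add: G_def)
    have gb: "norm (g x) \<le> G" if "x \<in> X" for x
      using S.nrm_dq_le[OF g, of "(x, x)"] that by (simp add: G_def dq_def)
    have \<iota>_le: "norm (\<iota> * x) \<le> norm x" for x
      using mult_right_mono[OF \<iota>, of "norm x"] by (simp add: norm_mult)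
    have "\<exists>u. little_lipschitz X (G * c) u \<and> (\<forall>y\<in>Y. u y = \<rho> (g y)) \<and> (\<forall>x. \<bar>u x\<bar> \<le> G)"
    proof (rule real[OF Y G])
      show "\<bar>\<rho> (g x) - \<rho> (g x')\<bar> \<le> G * dist x x'" if "x \<in> X" "x' \<in> X" for x x'
        using \<rho>(3)[of "g x - g x'"] gd[OF that] by (simp add: \<rho>_diff)
      show "\<bar>\<rho> (g x)\<bar> \<le> G" if "x \<in> X" for x
        using \<rho>(3)[of "g x"] gb[OF that] by simp
    qed
    then obtain u1 where u1: "little_lipschitz X (G * c) u1" "\<And>y. y \<in> Y \<Longrightarrow> u1 y = \<rho> (g y)" "\<And>x. \<bar>u1 x\<bar> \<le> G"
      by blast
    have "\<exists>u. little_lipschitz X (G * c) u \<and> (\<forall>y\<in>Y. u y = \<rho> (\<iota> * g y)) \<and> (\<forall>x. \<bar>u x\<bar> \<le> G)"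
    proof (rule real[OF Y G])
      show "\<bar>\<rho> (\<iota> * g x) - \<rho> (\<iota> * g x')\<bar> \<le> G * dist x x'" if "x \<in> X" "x' \<in> X" for x x'
        using \<rho>(3)[of "\<iota> * (g x - g x')"] gd[OF that] \<iota>_le[of "g x - g x'"]
        by (simp add: \<rho>_diff right_diff_distrib)
      show "\<bar>\<rho> (\<iota> * g x)\<bar> \<le> G" if "x \<in> X" for x
        using \<rho>(3)[of "\<iota> * g x"] \<iota>_le[of "g x"] gb[OF that] by simp
    qed
    then obtain u2 where u2: "little_lipschitz X (G * c) u2" "\<And>y. y \<in> Y \<Longrightarrow> u2 y = \<rho> (\<iota> * g y)" "\<And>x. \<bar>u2 x\<bar> \<le> G"
      by blast
    \<comment> \<open>Reassembled as in \<open>real_part_exists\<close>; over the reals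
      \<open>\<iota> = 0\<close> removes the second summand.\<close>
    define f where "f x = (if x \<in> X then of_real (u1 x) - \<iota> * of_real (u2 x) else 0)" for x
    have f_diff: "norm (f x - f x') \<le> \<bar>u1 x - u1 x'\<bar> + \<bar>u2 x - u2 x'\<bar>" if "x \<in> X" "x' \<in> X" for x x'
    proof -
      have "f x - f x' = of_real (u1 x - u1 x') - \<iota> * of_real (u2 x - u2 x')"
        using that by (simp add: f_def algebra_simps)
      then have "norm (f x - f x') \<le> norm (of_real (u1 x - u1 x') :: 'k) + norm (\<iota> * of_real (u2 x - u2 x'))"
        using norm_triangle_ineq4 by metis
      also have "\<dots> \<le> \<bar>u1 x - u1 x'\<bar> + \<bar>u2 x - u2 x'\<bar>"
        using \<iota>_le[of "of_real (u2 x - u2 x')"] unfolding norm_of_real by simp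
      finally show ?thesis .
    qed
    have f_bound: "norm (f x) \<le> 2 * G" if "x \<in> X" for x
    proof -
      have "norm (f x) \<le> norm (of_real (u1 x) :: 'k) + norm (\<iota> * of_real (u2 x))"
        using that norm_triangle_ineq4[of "of_real (u1 x) :: 'k" "\<iota> * of_real (u2 x)"] by (simp add: f_def)
      also have "\<dots> \<le> G + G"
        using \<iota>_le[of "of_real (u2 x)"] u1(3)[of x] u2(3)[of x] unfolding norm_of_real by (intro add_mono) auto
      finally show ?thesis by simp
    qed
    have Gc: "2 * G \<le> 2 * c * G" using mult_right_mono[of 1 c G] c G by simp
    have dq_le: "nrm ?K (dq scalars f w) \<le> 2 * c * G" if "w \<in> X \<times> X" for w
    proof (cases "fst w = snd w")
      case True
      then show ?thesis using f_bound[of "fst w"] that Gc by (auto simp: dq_def)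
    next
      case False
      obtain x x' where w: "w = (x, x')" "x \<in> X" "x' \<in> X" using \<open>w \<in> X \<times> X\<close> by blast
      have "norm (f x - f x') \<le> G * c * dist x x' + G * c * dist x x'"
        using f_diff[OF w(2,3)] u1(1) u2(1) w unfolding little_lipschitz_def by (smt (verit))
      moreover have "nrm ?K (dq scalars f w) = norm (f x - f x') / dist x x'"
        using S.nrm_dq_offdiag[of f x x'] w False by simp
      moreover have "G * c * dist x x' + G * c * dist x x' = 2 * c * G * dist x x'"
        by simp
      moreover have "dist x x' > 0" using False w by simp
      ultimately show ?thesis by (simp only: pos_divide_le_eq)
    qed
    have fL: "f \<in> carr (Lip X ?K)"
      by (rule S.LipI[OF _ _ dq_le]) (auto simp: f_def)
    have "f \<in> carr (little_lip X ?K)"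
      unfolding S.little_lip_iff
    proof (intro conjI allI impI fL)
      fix \<epsilon> :: real assume "\<epsilon> > 0"
      then have "\<epsilon> / 2 > 0" by simp
      obtain \<delta> where \<delta>: "\<delta> > 0"
        "\<And>x x'. x \<in> X \<Longrightarrow> x' \<in> X \<Longrightarrow> dist x x' < \<delta> \<Longrightarrow> \<bar>u1 x - u1 x'\<bar> \<le> \<epsilon> / 2 * dist x x'"
        using little_lipschitzD[OF u1(1) \<open>\<epsilon> / 2 > 0\<close>] by blast
      obtain \<delta>' where \<delta>': "\<delta>' > 0"
        "\<And>x x'. x \<in> X \<Longrightarrow> x' \<in> X \<Longrightarrow> dist x x' < \<delta>' \<Longrightarrow> \<bar>u2 x - u2 x'\<bar> \<le> \<epsilon> / 2 * dist x x'"
        using little_lipschitzD[OF u2(1) \<open>\<epsilon> / 2 > 0\<close>] by blast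
      show "\<exists>\<delta>>0. \<forall>x\<in>X. \<forall>x'\<in>X. dist x x' < \<delta> \<longrightarrow>
          nrm ?K (f x - f x') \<le> \<epsilon> * dist x x'"
      proof (intro exI[of _ "min \<delta> \<delta>'"] conjI ballI impI)
        fix x x' assume *: "x \<in> X" "x' \<in> X" "dist x x' < min \<delta> \<delta>'"
        then have "\<bar>u1 x - u1 x'\<bar> \<le> \<epsilon> / 2 * dist x x'" "\<bar>u2 x - u2 x'\<bar> \<le> \<epsilon> / 2 * dist x x'"
          using \<delta>(2) \<delta>'(2) by simp_all
        then show "nrm ?K (f x - f x') \<le> \<epsilon> * dist x x'"
          using f_diff[OF *(1,2)] by simp
      qed (use \<delta> \<delta>' in simp)
    qed
    moreover have "nrm (Lip X ?K) f \<le> 2 * c * nrm (Lip X ?K) g"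
      using S.nrm_Lip_le[OF fL dq_le] c G by (simp add: G_def)
    moreover have "f y = g y" if "y \<in> Y" for y
      using u1(2)[OF that] u2(2)[OF that] Y(2) that rep[of "g y"] by (auto simp: f_def)
    ultimately show "\<exists>f\<in>carr (little_lip X ?K).
        nrm (Lip X ?K) f \<le> 2 * c * nrm (Lip X ?K) g \<and>
        (\<forall>y\<in>Y. f y = g y)"
      by blast
  qed
qed

section \<open>Surjectivity of the restriction map\<close>

lemma id_dual_scalars: "(\<lambda>x. x) \<in> carr (dual (scalars :: ('k::real_or_complex, 'k) nspace))"
  by (rule normed_nspace.dualI[OF normed_nspace_scalars, where C = 1]) simp_all

lemma dual_scalarsE:
  assumes "c \<in> carr (dual (scalars :: ('k::real_or_complex, 'k) nspace))"
  obtains k where "\<And>x. c x = k * x"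
proof (rule that)
  fix x
  have "c (scl scalars x 1) = x * c 1"
    by (rule dual_scl[OF assms]) simp
  then show "c x = c 1 * x"
    by (metis mult.commute mult_1_right scalars_simps(2))
qed

context lip_setting
begin

lemma nrm_elems: "admissible l \<Longrightarrow> nrm lip_dual (elems l) \<le> weight l"
proof (induction l)
  case (Cons p l)
  obtain w b where p: "p = (w, b)" by (cases p)
  then have wb: "w \<in> X \<times> X" "b \<in> carr (dual E)" and l: "admissible l"
    using Cons.prems by auto
  have "nrm lip_dual (elem w b + elems l) \<le>
      nrm lip_dual (elem w b) + nrm lip_dual (elems l)"
    by (rule dl.nrm_add[OF elem_dual[OF wb] elems_dual[OF l]])
  also have "\<dots> \<le> nrm (dual E) b + weight l"
    by (rule add_mono[OF nrm_elem[OF wb] Cons.IH[OF l]])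
  finally show ?case unfolding p elems_simps weight_simps .
qed simp

text \<open>The bound depends on \<open>f\<close> only through its norm, so \<open>f\<close> may be
  chosen after \<open>n\<close>.\<close>

lemma represents_0_bound:
  assumes "geometric C z" "represents z 0" "f \<in> carr (little_lip X E)"
  shows "norm (\<Sum>k<n. elems (z k) f) \<le> 2 * (C * nrm (Lip X E) f) / 4 ^ n"
proof (rule null_sums_bound)
  show "(\<lambda>k. elems (z k) f) sums 0"
    using assms(2) by (simp add: represents_def)
  fix k
  have z: "admissible (z k)" "weight (z k) \<le> C / 4 ^ k"
    using assms(1) by (auto simp: geometric_def)
  have "norm (elems (z k) f) \<le> nrm lip_dual (elems (z k)) * nrm (little_lip X E) f"
    by (rule l.dual_bound[OF elems_dual[OF z(1)] assms(3)])
  also have "\<dots> \<le> C / 4 ^ k * nrm (little_lip X E) f"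
    using nrm_elems[OF z(1)] z(2) l.nrm_nonneg[OF assms(3)] by (intro mult_right_mono) auto
  finally show "norm (elems (z k) f) \<le> C * nrm (Lip X E) f / 4 ^ k"
    by simp
qed

end

lemma dq_bidual_apply:
  "dq (dual (dual V)) F w b = dq scalars (\<lambda>x. F x b) w"
  for V :: "('k::real_or_complex, 'v::ab_group_add) nspace"
  by (simp add: dq_def)

text \<open>Functionals on the scalars are multiples of the identity, so \<open>F\<close> amounts to
  the scalar function \<open>g\<close>. This \<open>g\<close> need not be little Lipschitz, but
  finitely many terms of a null series see it only at finitely many points.\<close>

lemma restriction_surj_scalars:
  fixes X :: "'x::metric_space set"
  assumes X: "compact X" and sep: "lip_separates_points_uniformly TYPE('k::real_or_complex) X"
    and F: "F \<in> carr (Lip X (dual (dual (scalars :: ('k, 'k) nspace))))"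
  shows "\<exists>\<Phi>\<in>carr (dual (dual (little_lip X (scalars :: ('k, 'k) nspace)))).
    lip_setting.restriction (scalars :: ('k, 'k) nspace) X \<Phi> = F"
proof -
  let ?S = "dual (dual (scalars :: ('k, 'k) nspace))" and ?T = "dual (scalars :: ('k, 'k) nspace)"
  let ?K = "scalars :: ('k, 'k) nspace"
  interpret S: lip_setting ?K X
    by (rule lip_setting_scalars[OF X])
  interpret dd: lip_setting "dual (dual ?K)" X
    by (rule S.lip_setting_bidual)
  obtain K where K: "0 \<le> K"
    "\<And>g Y. g \<in> carr (Lip X ?K) \<Longrightarrow> finite Y \<Longrightarrow> Y \<subseteq> X \<Longrightarrow>
      \<exists>f\<in>carr (little_lip X ?K).
        nrm (Lip X ?K) f \<le> K * nrm (Lip X ?K) g \<and>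
        (\<forall>y\<in>Y. f y = g y)"
    using scalar_interpolation[OF X sep] by blast
  define g where "g x = F x (\<lambda>y. y)" for x
  have dq_F: "dq ?S F w b = b (dq scalars g w)"
    if w: "w \<in> X \<times> X" and b: "b \<in> carr ?T" for w and b :: "'k \<Rightarrow> 'k"
  proof -
    obtain k where k: "\<And>y. b y = k * y" using dual_scalarsE[OF b] by blast
    have "b = scl ?T k (\<lambda>y. y)"
      by (rule ext) (simp add: k)
    then have "dq ?S F w b = k * dq ?S F w (\<lambda>y. y)"
      using dual_scl[OF dd.Lip_dq_in[OF F w] id_dual_scalars, of k] by simp
    then show ?thesis
      by (simp add: k dq_bidual_apply g_def[abs_def])
  qed
  have g: "g \<in> carr (Lip X ?K)"
  proof (rule S.LipI)
    fix w assume w: "w \<in> X \<times> X"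
    have "norm (dq ?S F w (\<lambda>y. y)) \<le>
        nrm ?S (dq ?S F w) * nrm ?T (\<lambda>y :: 'k. y)"
      by (rule S.dE.dual_bound[OF dd.Lip_dq_in[OF F w] id_dual_scalars])
    also have "\<dots> \<le> nrm (Lip X ?S) F * nrm ?T (\<lambda>y :: 'k. y)"
      by (intro mult_right_mono dd.nrm_dq_le[OF F w] S.dE.nrm_nonneg id_dual_scalars)
    finally show "nrm scalars (dq scalars g w) \<le>
        nrm (Lip X ?S) F * nrm ?T (\<lambda>y :: 'k. y)"
      using dq_F[OF w id_dual_scalars] by simp
  qed (use dd.Lip_outside[OF F] in \<open>auto simp: g_def\<close>)
  show ?thesis
  proof (rule S.restriction_surj[OF F])
    fix C z assume z: "S.geometric C z" "S.represents z 0"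
    have adm: "S.admissible (z k)" for k
      using z(1) by (simp add: S.geometric_def)
    have C: "0 \<le> C"
      using z(1) S.weight_nonneg[OF adm[of 0]] by (force simp: S.geometric_def dest: spec[of _ 0])
    define N where "N = nrm (Lip X ?K) g"
    have bound: "norm (\<Sum>k<n. S.pairing F (z k)) \<le> (2 * (C * (K * N))) * (1 / 4) ^ n" for n
    proof -
      \<comment> \<open>All points that occur in the first \<open>n\<close> terms. Where
        \<open>f\<close> agrees with \<open>g\<close> there, \<open>pairing F\<close> is evaluation
        at \<open>f\<close>, and the norm of \<open>f\<close> is bounded independently of
        \<open>n\<close>.\<close>
      define Y where "Y = (\<Union>k<n. \<Union>p\<in>set (z k). {fst (fst p), snd (fst p)})"
      have Y: "finite Y" "Y \<subseteq> X"
        using adm unfolding Y_def S.admissible_def by fastforce+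
      obtain f where f: "f \<in> carr (little_lip X ?K)"
        "nrm (Lip X ?K) f \<le> K * N" "\<And>y. y \<in> Y \<Longrightarrow> f y = g y"
        using K(2)[OF g Y] unfolding N_def by blast
      have "S.pairing F (z k) = S.elems (z k) f" if "k < n" for k
        unfolding S.pairing_def S.elems_def
      proof (intro arg_cong[of _ _ sum_list] map_cong refl)
        fix p assume p: "p \<in> set (z k)"
        obtain w b where wb: "p = (w, b)" by (cases p)
        have "w \<in> X \<times> X" "b \<in> carr ?T"
          using adm[of k] p wb by (auto simp: S.admissible_def)
        moreover have "fst w \<in> Y" "snd w \<in> Y"
          using p wb \<open>k < n\<close> unfolding Y_def by force+
        then have "dq scalars g w = dq scalars f w"
          using f(3) by (simp add: dq_def)
        ultimately show "(case p of (w, b) \<Rightarrow> dq ?S F w b) = (case p of (w, b) \<Rightarrow> S.elem w b f)"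
          using f(1) by (simp add: wb dq_F S.elem_def)
      qed
      then have "norm (\<Sum>k<n. S.pairing F (z k)) \<le> 2 * (C * nrm (Lip X ?K) f) / 4 ^ n"
        using S.represents_0_bound[OF z f(1), of n] by simp
      also have "\<dots> \<le> 2 * (C * (K * N)) / 4 ^ n"
        using mult_left_mono[OF f(2) C] by (simp add: divide_right_mono)
      finally show ?thesis by (simp add: power_one_over)
    qed
    have "(\<lambda>n. (2 * (C * (K * N))) * (1 / 4) ^ n) \<longlonglongrightarrow> 0"
      by (intro tendsto_mult_right_zero LIMSEQ_power_zero) simp
    then show "(\<lambda>k. S.pairing F (z k)) sums 0"
      unfolding sums_def
      by (rule Lim_null_comparison[OF always_eventually, rotated]) (use bound in blast)
  qed
qed

text \<open>A term \<open>(w, b)\<close> is read as the tensor of the scalar functional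
  \<open>e w\<close> and \<open>b\<close>, and \<open>pairing F\<close> as a bilinear form on such
  tensors. The form must be defined on the whole dual of the scalar little Lipschitz functions,
  because finite rank operators need not preserve the functionals \<open>e w\<close>; the scalar
  case provides this extension for each fixed \<open>b\<close>.\<close>

theorem (in lip_setting) restriction_surj_if_approximation_property:
  assumes sep: "lip_separates_points_uniformly TYPE('k) X"
    and ap: "approximation_property (dual E) \<or>
      approximation_property (dual (little_lip X (scalars :: ('k, 'k) nspace)))"
    and F: "F \<in> carr (Lip X bidual)"
  shows "\<exists>\<Phi>\<in>carr (dual lip_dual). restriction \<Phi> = F"
proof (rule restriction_surj[OF F])
  let ?S = "dual (dual (scalars :: ('k, 'k) nspace))" and ?T = "dual (scalars :: ('k, 'k) nspace)"
  interpret S: lip_setting "scalars :: ('k, 'k) nspace" X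
    by (rule lip_setting_scalars[OF compact])
  interpret dd: lip_setting bidual X
    by (rule lip_setting_bidual)
  interpret Sd: lip_setting "dual (dual (scalars :: ('k, 'k) nspace))" X
    by (rule S.lip_setting_bidual)
  let ?s = "little_lip X (scalars :: ('k, 'k) nspace)"
  let ?N = "nrm (Lip X bidual) F"
  let ?id = "\<lambda>y :: 'k. y"
  have N: "0 \<le> ?N" by (rule dd.L.nrm_nonneg[OF F])
  have n1: "0 \<le> nrm ?T ?id"
    by (rule S.dE.nrm_nonneg[OF id_dual_scalars])
  \<comment> \<open>The scalar function with values \<open>F x b\<close>, moved into the bidual of
    the scalars by the canonical embedding.\<close>
  define G where "G b = (\<lambda>x c. if x \<in> X \<and> c \<in> carr ?T then c (F x b) else 0)" for b :: "'e \<Rightarrow> 'k"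
  have dq_G: "dq ?S (G b) w c = c (dq bidual F w b)"
    if "w \<in> X \<times> X" "c \<in> carr ?T" for w b c
  proof -
    obtain k where k: "\<And>y. c y = k * y" using dual_scalarsE[OF \<open>c \<in> _\<close>] by blast
    have "G b x c = k * F x b" if "x \<in> X" for x
      using that \<open>c \<in> _\<close> by (simp add: G_def k)
    then show ?thesis
      using \<open>w \<in> _\<close> by (auto simp: dq_def k algebra_simps)
  qed
  have G_le: "nrm ?S (dq ?S (G b) w) \<le> ?N * nrm (dual E) b"
    if w: "w \<in> X \<times> X" and b: "b \<in> carr (dual E)" for w b
  proof (rule S.dE.nrm_dual_le)
    fix c :: "'k \<Rightarrow> 'k" assume c: "c \<in> carr ?T"
    have "norm (dq bidual F w b) \<le> nrm bidual (dq bidual F w) * nrm (dual E) b"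
      by (rule dE.dual_bound[OF dd.Lip_dq_in[OF F w] b])
    also have "\<dots> \<le> ?N * nrm (dual E) b"
      by (intro mult_right_mono dd.nrm_dq_le[OF F w] dE.nrm_nonneg b)
    finally have "nrm ?T c * norm (dq bidual F w b) \<le>
        nrm ?T c * (?N * nrm (dual E) b)"
      using S.dE.nrm_nonneg[OF c] by (intro mult_left_mono)
    moreover have "norm (c (dq bidual F w b)) \<le> nrm ?T c * norm (dq bidual F w b)"
      using S.dual_bound[OF c, of "dq bidual F w b"] by simp
    ultimately show "norm (dq ?S (G b) w c) \<le> ?N * nrm (dual E) b * nrm ?T c"
      unfolding dq_G[OF w c] by (simp add: mult.commute)
  qed (use N b in simp)
  have G_in: "G b \<in> carr (Lip X ?S)" if b: "b \<in> carr (dual E)" for b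
  proof (rule Sd.LipI[OF _ _ G_le[OF _ b]])
    show "G b ` X \<subseteq> carr ?S"
    proof clarify
      fix x assume x: "x \<in> X"
      show "G b x \<in> carr ?S"
      proof (rule S.dE.dualI)
        fix c c' :: "'k \<Rightarrow> 'k" assume c: "c \<in> carr ?T"
        show "norm (G b x c) \<le> norm (F x b) * nrm ?T c"
          using S.dual_bound[OF c, of "F x b"] x c by (simp add: G_def mult.commute)
        show "G b x (c + c') = G b x c + G b x c'" if "c' \<in> carr ?T"
          using x c that S.dE.add_in[OF c that] by (simp add: G_def)
        show "G b x (scl ?T r c) = r * G b x c" for r
          using x c S.dE.scl_in[OF c, of r] by (simp add: G_def)
      qed (simp add: G_def)
    qed
  qed (auto simp: G_def)
  have "\<exists>\<Phi>. \<Phi> \<in> carr (dual (dual ?s)) \<and> S.restriction \<Phi> = G b" if "b \<in> carr (dual E)" for b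
    using restriction_surj_scalars[OF compact sep G_in[OF that]] by blast
  then obtain \<Psi> where \<Psi>: "\<And>b. b \<in> carr (dual E) \<Longrightarrow> \<Psi> b \<in> carr (dual (dual ?s))"
    and \<Psi>_G: "\<And>b. b \<in> carr (dual E) \<Longrightarrow> S.restriction (\<Psi> b) = G b"
    by metis
  define \<beta> where "\<beta> a b = \<Psi> b a" for a b
  \<comment> \<open>\<open>\<Psi> b\<close> was chosen separately for each \<open>b\<close>;
    linearity in \<open>b\<close> comes from the uniqueness in
    \<open>restriction_inj\<close>.\<close>
  have \<Psi>_add: "\<Psi> (b + b') = \<Psi> b + \<Psi> b'" if b: "b \<in> carr (dual E)" "b' \<in> carr (dual E)" for b b'
  proof (rule S.restriction_inj)
    have "F x (b + b') = F x b + F x b'" if "x \<in> X" for x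
      using dual_add[OF _ b, of "F x"] dd.Lip_image[OF F] that by auto
    then have "G (b + b') = G b + G b'"
      using dual_add[of _ scalars] by (auto simp: G_def fun_eq_iff)
    then show "S.restriction (\<Psi> (b + b')) = S.restriction (\<Psi> b + \<Psi> b')"
      using b by (simp only: \<Psi>_G dE.add_in S.restriction_add)
  qed (intro \<Psi> dE.add_in S.ddl.add_in b)+
  have \<Psi>_scl: "\<Psi> (scl (dual E) r b) = scl (dual (dual ?s)) r (\<Psi> b)" if b: "b \<in> carr (dual E)" for r b
  proof (rule S.restriction_inj)
    have "F x (scl (dual E) r b) = r * F x b" if "x \<in> X" for x
      using dual_scl[OF _ b, of "F x" r] dd.Lip_image[OF F] that by blast
    then have "G (scl (dual E) r b) = (\<lambda>x c. r * G b x c)"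
      using dual_scl[of _ scalars] by (auto simp: G_def fun_eq_iff)
    then show "S.restriction (\<Psi> (scl (dual E) r b)) = S.restriction (scl (dual (dual ?s)) r (\<Psi> b))"
      using \<Psi>_G[OF dE.scl_in[OF b, of r]] \<Psi>_G[OF b] S.restriction_scl[of r "\<Psi> b"] by simp
  qed (intro \<Psi> dE.scl_in S.ddl.scl_in b)+
  have \<beta>_bound: "norm (\<beta> a b) \<le> ?N * (nrm (dual ?s) a * nrm (dual E) b)"
    if a: "a \<in> carr (dual ?s)" and b: "b \<in> carr (dual E)" for a b
  proof -
    have "nrm (dual (dual ?s)) (\<Psi> b) = nrm (Lip X ?S) (G b)"
      using S.nrm_restriction[OF \<Psi>[OF b]] \<Psi>_G[OF b] by simp
    also have "\<dots> \<le> ?N * nrm (dual E) b"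
      using N b by (intro Sd.nrm_Lip_le G_in G_le) auto
    finally have "nrm (dual (dual ?s)) (\<Psi> b) * nrm (dual ?s) a \<le> (?N * nrm (dual E) b) * nrm (dual ?s) a"
      by (rule mult_right_mono[OF _ S.dl.nrm_nonneg[OF a]])
    then show ?thesis
      using S.dl.dual_bound[OF \<Psi>[OF b] a] by (simp add: \<beta>_def mult_ac)
  qed
  have \<beta>_add_left: "\<beta> (a + a') b = \<beta> a b + \<beta> a' b"
    if "a \<in> carr (dual ?s)" "a' \<in> carr (dual ?s)" "b \<in> carr (dual E)" for a a' b
    unfolding \<beta>_def by (rule dual_add[OF \<Psi>[OF that(3)] that(1,2)])
  have \<beta>_scl_left: "\<beta> (scl (dual ?s) r a) b = r * \<beta> a b"
    if "a \<in> carr (dual ?s)" "b \<in> carr (dual E)" for r a b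
    unfolding \<beta>_def by (rule dual_scl[OF \<Psi>[OF that(2)] that(1)])
  have \<beta>_add_right: "\<beta> a (b + b') = \<beta> a b + \<beta> a b'"
    if "b \<in> carr (dual E)" "b' \<in> carr (dual E)" for a b b'
    unfolding \<beta>_def \<Psi>_add[OF that] by simp
  have \<beta>_scl_right: "\<beta> a (scl (dual E) r b) = r * \<beta> a b" if "b \<in> carr (dual E)" for r a b
    unfolding \<beta>_def \<Psi>_scl[OF that] by simp
  define e where "e w = S.elem w ?id" for w
  have e_in: "e w \<in> carr (dual ?s)" and e_le: "nrm (dual ?s) (e w) \<le> nrm ?T ?id"
    if "w \<in> X \<times> X" for w
    unfolding e_def using S.elem_dual[OF that id_dual_scalars] S.nrm_elem[OF that id_dual_scalars] by simp_all
  have \<beta>_e: "\<beta> (e w) b = dq bidual F w b" if w: "w \<in> X \<times> X" and b: "b \<in> carr (dual E)" for w b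
    using S.dq_restriction[OF \<Psi>[OF b] w id_dual_scalars] dq_G[OF w id_dual_scalars, of b] \<Psi>_G[OF b]
    by (simp add: \<beta>_def e_def)
  fix C z assume z: "geometric C z" "represents z 0"
  have adm: "admissible (z k)" and wt: "weight (z k) \<le> C / 4 ^ k" for k
    using z(1) by (auto simp: geometric_def)
  have z_in: "fst p \<in> X \<times> X" "snd p \<in> carr (dual E)" if "p \<in> set (z k)" for p k
    using adm[of k] that by (auto simp: admissible_def)
  have bound: "(\<Sum>p\<leftarrow>z k. nrm (dual ?s) (e (fst p)) * nrm (dual E) (snd p)) \<le> (nrm ?T ?id * C) / 4 ^ k" for k
  proof -
    have "(\<Sum>p\<leftarrow>z k. nrm (dual ?s) (e (fst p)) * nrm (dual E) (snd p)) \<le>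
        (\<Sum>p\<leftarrow>z k. nrm ?T ?id * nrm (dual E) (snd p))"
      by (intro sum_list_mono mult_right_mono e_le dE.nrm_nonneg z_in)
    also have "\<dots> = nrm ?T ?id * weight (z k)"
      by (simp add: sum_list_const_mult weight_def case_prod_unfold)
    also have "\<dots> \<le> nrm ?T ?id * (C / 4 ^ k)"
      by (intro mult_left_mono wt n1)
    finally show ?thesis by simp
  qed
  have null: "(\<lambda>k. \<Sum>p\<leftarrow>z k. e (fst p) v * snd p y) sums 0"
    if v: "v \<in> carr ?s" and y: "y \<in> carr E" for v y
  proof -
    \<comment> \<open>The product of a scalar function and a vector splits each term into its two
      factors, so the null series vanishes as a bilinear form.\<close>
    define f where "f x = scl E (v x) y" for x
    have dq_f: "dq E f w = scl E (dq scalars v w) y" for w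
      by (simp add: dq_def f_def flip: scale_left_diff_distrib)
    have vL: "v \<in> carr (Lip X scalars)" by (rule S.little_lip_Lip[OF v])
    have fL: "f \<in> carr (Lip X E)"
    proof (rule LipI)
      show "f ` X \<subseteq> carr E" using y by (auto simp: f_def)
      show "f x = 0" if "x \<notin> X" for x
        using S.Lip_outside[OF vL that] by (simp add: f_def)
      show "nrm E (dq E f w) \<le> nrm (Lip X scalars) v * nrm E y" if "w \<in> X \<times> X" for w
        using S.nrm_dq_le[OF vL that] y by (simp add: dq_f mult_right_mono)
    qed
    have f: "f \<in> carr (little_lip X E)"
      unfolding little_lip_iff
    proof (intro conjI allI impI fL)
      fix \<epsilon> :: real assume "\<epsilon> > 0"
      define M where "M = nrm E y + 1"
      have M: "M > 0" "nrm E y \<le> M" using y by (auto simp: M_def add_nonneg_pos)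
      have "\<epsilon> / M > 0" using \<open>\<epsilon> > 0\<close> M by simp
      from S.little_lipD[OF v this] obtain \<delta> where \<delta>: "\<delta> > 0"
        "\<And>x x'. x \<in> X \<Longrightarrow> x' \<in> X \<Longrightarrow> dist x x' < \<delta> \<Longrightarrow> norm (v x - v x') \<le> \<epsilon> / M * dist x x'"
        unfolding scalars_simps by blast
      show "\<exists>\<delta>>0. \<forall>x\<in>X. \<forall>x'\<in>X. dist x x' < \<delta> \<longrightarrow> nrm E (f x - f x') \<le> \<epsilon> * dist x x'"
      proof (intro exI[of _ \<delta>] conjI ballI impI \<delta>(1))
        fix x x' assume "x \<in> X" "x' \<in> X" "dist x x' < \<delta>"
        then have "norm (v x - v x') * nrm E y \<le> (\<epsilon> / M * dist x x') * M"
          using \<delta>(2) M y \<open>\<epsilon> > 0\<close> by (intro mult_mono) auto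
        moreover have "nrm E (f x - f x') = norm (v x - v x') * nrm E y"
          using y by (simp add: f_def flip: scale_left_diff_distrib)
        ultimately show "nrm E (f x - f x') \<le> \<epsilon> * dist x x'"
          using M by simp
      qed
    qed
    have "elem w b f = e w v * b y" if "b \<in> carr (dual E)" for w b
      using f v y dual_scl[OF that y, of "dq scalars v w"] by (simp add: elem_def e_def S.elem_def dq_f)
    then have eq: "elems (z k) f = (\<Sum>p\<leftarrow>z k. e (fst p) v * snd p y)" for k
      unfolding elems_def using z_in(2)[of _ k]
      by (intro arg_cong[of _ _ sum_list] map_cong refl) (simp add: case_prod_unfold)
    have "(\<lambda>k. elems (z k) f) sums 0"
      using z(2) by (simp add: represents_def)
    then show ?thesis unfolding eq .
  qed
  have "(\<lambda>k. \<Sum>p\<leftarrow>z k. \<beta> (e (fst p)) (snd p)) sums 0"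
    using ap
  proof
    assume ap: "approximation_property (dual ?s)"
    let ?z = "\<lambda>k. map (\<lambda>p. (e (fst p), snd p)) (z k)"
    have "(\<lambda>k. \<Sum>p\<leftarrow>?z k. \<beta> (fst p) (snd p)) sums 0"
    proof (rule trace_duality[OF S.normed_nspace_little_lip normed_nspace_axioms ap, where \<beta> = \<beta>])
      show "fst p \<in> carr (dual ?s) \<and> snd p \<in> carr (dual E)" if "p \<in> set (?z k)" for p k
        using that e_in z_in by fastforce
      show "(\<Sum>p\<leftarrow>?z k. nrm (dual ?s) (fst p) * nrm (dual E) (snd p)) \<le> (nrm ?T ?id * C) / 4 ^ k" for k
        using bound[of k] by (simp add: o_def)
      show "(\<lambda>k. \<Sum>p\<leftarrow>?z k. fst p v * snd p y) sums 0" if "v \<in> carr ?s" "y \<in> carr E" for v y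
        using null[OF that] by (simp add: o_def)
    qed (rule \<beta>_add_left \<beta>_add_right \<beta>_scl_left \<beta>_scl_right \<beta>_bound N; assumption)+
    then show ?thesis by (simp add: o_def)
  next
    assume ap: "approximation_property (dual E)"
    \<comment> \<open>Trace duality asks for the approximation property of the first dual, so the
      factors are exchanged.\<close>
    let ?z = "\<lambda>k. map (\<lambda>p. (snd p, e (fst p))) (z k)"
    have "(\<lambda>k. \<Sum>p\<leftarrow>?z k. (\<lambda>b a. \<beta> a b) (fst p) (snd p)) sums 0"
    proof (rule trace_duality[OF normed_nspace_axioms S.normed_nspace_little_lip ap, where \<beta> = "\<lambda>b a. \<beta> a b"])
      show "fst p \<in> carr (dual E) \<and> snd p \<in> carr (dual ?s)" if "p \<in> set (?z k)" for p k
        using that e_in z_in by fastforce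
      show "(\<Sum>p\<leftarrow>?z k. nrm (dual E) (fst p) * nrm (dual ?s) (snd p)) \<le> (nrm ?T ?id * C) / 4 ^ k" for k
        using bound[of k] by (simp add: o_def mult.commute)
      show "(\<lambda>k. \<Sum>p\<leftarrow>?z k. fst p y * snd p v) sums 0" if "y \<in> carr E" "v \<in> carr ?s" for v y
        using null[OF that(2,1)] by (simp add: o_def mult.commute)
      show "norm (\<beta> a b) \<le> ?N * (nrm (dual E) b * nrm (dual ?s) a)"
        if "b \<in> carr (dual E)" "a \<in> carr (dual ?s)" for a b
        using \<beta>_bound[OF that(2,1)] by (simp only: mult.commute)
    qed (rule \<beta>_add_left \<beta>_add_right \<beta>_scl_left \<beta>_scl_right N; assumption)+
    then show ?thesis by (simp add: o_def)
  qed
  moreover have "(\<Sum>p\<leftarrow>z k. \<beta> (e (fst p)) (snd p)) = pairing F (z k)" for k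
    unfolding pairing_def using z_in[of _ k]
    by (intro arg_cong[of _ _ sum_list] map_cong refl) (simp add: case_prod_unfold \<beta>_e)
  ultimately show "(\<lambda>k. pairing F (z k)) sums 0" by simp
qed

theorem theorem1:
  fixes E :: "('k::real_or_complex, 'e::ab_group_add) nspace"
    and X :: "'x::metric_space set"
  assumes "banach_space E"
    and "compact X"
    and "lip_separates_points_uniformly TYPE('k) X"
    and "approximation_property (dual E) \<or>
         approximation_property (dual (little_lip X (scalars :: ('k, 'k) nspace)))"
  shows "isometrically_isomorphic (dual (dual (little_lip X E))) (Lip X (dual (dual E)))"
proof -
  interpret lip_setting E X
    using assms(1,2) by unfold_locales (simp_all add: banach_space_def)
  have "linear_map (dual (dual (little_lip X E))) (Lip X (dual (dual E))) restriction"
    unfolding linear_map_def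
    using restriction_in by (auto simp: restriction_add restriction_scl)
  moreover have "restriction ` carr (dual (dual (little_lip X E))) = carr (Lip X (dual (dual E)))"
    using restriction_in restriction_surj_if_approximation_property[OF assms(3,4)] by blast
  ultimately show ?thesis
    unfolding isometrically_isomorphic_def using nrm_restriction by blast
qed

end
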